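(* Let $0<\sigma<1$ and let $\mathcal{O}\subseteq\mathbb{T}^n$ be an open set. For any compact subset $\mathcal{K}\subset\mathcal{O}$, there exists a constant $C>0$, that depends only on $n$, $\sigma$ and $\mathcal{K}$, such that $$\sup_{\mathcal{K}}v\le C\inf_{\mathcal{K}}v,$$ for all solutions $v\in\operatorname{Dom}((-\Delta_{\mathbb{T}^n})^\sigma)$ to $$\begin{cases}(-\Delta_{\mathbb{T}^n})^\sigma v=0,&\text{in }\mathcal{O},\\ v\ge0,&\text{on }\mathbb{T}^n.\end{cases}$$
   Context: $\mathbb{T}^n=\mathbb{R}^n/(2\pi\mathbb{Z}^n)$ is identified with $Q_n=(-\pi,\pi]^n$, and $c_k(v)=(2\pi)^{-n}\int_{Q_n}v(z)e^{-ik\cdot z}\,dz$ is the Fourier coefficient of $v:\mathbb{T}^n\to\mathbb{R}$. The fractional Laplacian is $(-\Delta_{\mathbb{T}^n})^\sigma v(z)=\sum_{k\in\mathbb{Z}^n}|k|^{2\sigma}c_k(v)e^{ik\cdot z}$, with $L^2$-domain $\operatorname{Dom}((-\Delta_{\mathbb{T}^n})^\sigma)=\{v\in L^2(\mathbb{T}^n):\sum_{k\in\mathbb{Z}^n}|k|^{4\sigma}|c_k(v)|^2<\infty\}$. The equation $(-\Delta_{\mathbb{T}^n})^\sigma v=0$ in $\mathcal{O}$ is understood in the sense that $\int_{\mathbb{T}^n}v\,(-\Delta_{\mathbb{T}^n})^\sigma\phi\,dz=0$ for every $\phi\in C^\infty(\mathbb{T}^n)$ supported in $\mathcal{O}$.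
   Formalization: The constant C is allowed to depend on the open set 𝒪 as well as n, σ, 𝒦; independence of 𝒪 is false (𝒦={a,b}, 𝒪 two balls of radius ε→0, exterior data at distance about 2ε from a gives v(a)/v(b)→∞). *)

theory Defs
  imports "HOL-Analysis.Analysis"
begin

definition torus_rel :: "real ^ 'n::finite \<Rightarrow> real ^ 'n \<Rightarrow> bool" where
  "torus_rel x y \<longleftrightarrow> (\<exists>m :: int ^ 'n. \<forall>i. x $ i - y $ i = 2 * pi * of_int (m $ i))"

lemma equivp_torus_rel: "equivp (torus_rel :: real ^ 'n::finite \<Rightarrow> real ^ 'n \<Rightarrow> bool)"
proof (rule equivpI)
  show "reflp (torus_rel :: real ^ 'n \<Rightarrow> real ^ 'n \<Rightarrow> bool)"
    unfolding reflp_def torus_rel_def by (intro allI exI[of _ 0]) simp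
  show "symp (torus_rel :: real ^ 'n \<Rightarrow> real ^ 'n \<Rightarrow> bool)"
  proof (rule sympI)
    fix x y :: "real ^ 'n" assume "torus_rel x y"
    then obtain m :: "int ^ 'n" where "\<And>i. x $ i - y $ i = 2 * pi * of_int (m $ i)"
      unfolding torus_rel_def by blast
    then have "\<forall>i. y $ i - x $ i = 2 * pi * of_int ((- m) $ i)"
      by (simp add: algebra_simps)
    then show "torus_rel y x" unfolding torus_rel_def by blast
  qed
  show "transp (torus_rel :: real ^ 'n \<Rightarrow> real ^ 'n \<Rightarrow> bool)"
  proof (rule transpI)
    fix x y z :: "real ^ 'n" assume "torus_rel x y" "torus_rel y z"
    then obtain l m :: "int ^ 'n"
      where lm: "\<And>i. x $ i - y $ i = 2 * pi * of_int (l $ i)"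
        "\<And>i. y $ i - z $ i = 2 * pi * of_int (m $ i)"
      unfolding torus_rel_def by blast
    have "x $ i - z $ i = 2 * pi * of_int ((l + m) $ i)" for i
      using lm[of i] by (simp add: algebra_simps)
    then show "torus_rel x z" unfolding torus_rel_def by blast
  qed
qed

quotient_type (overloaded) 'n torus = "real ^ 'n::finite" / "torus_rel"
  morphisms rep_torus torus_proj
  by (rule equivp_torus_rel)

instantiation torus :: (finite) topological_space
begin

definition open_torus :: "'a torus set \<Rightarrow> bool" where
  "open_torus U \<longleftrightarrow> open (torus_proj -` U)"

instance
  by standard (auto simp: open_torus_def vimage_Union)

end

definition torus_box :: "(real ^ 'n::finite) set" where
  "torus_box = {x. \<forall>i. - pi < x $ i \<and> x $ i \<le> pi}"

definition torus_measure :: "'n::finite torus measure" where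
  "torus_measure = distr (restrict_space lborel torus_box) borel torus_proj"

definition freq :: "int ^ 'n::finite \<Rightarrow> real ^ 'n" where
  "freq k = (\<chi> i. of_int (k $ i))"

lift_definition fourier_char :: "int ^ 'n::finite \<Rightarrow> 'n torus \<Rightarrow> complex" is
  "\<lambda>k x. exp (\<i> * complex_of_real (freq k \<bullet> x))"
proof -
  fix k :: "int ^ 'n" and x y :: "real ^ 'n"
  assume "torus_rel x y"
  then obtain m :: "int ^ 'n" where m: "\<And>i. x $ i - y $ i = 2 * pi * of_int (m $ i)"
    unfolding torus_rel_def by blast
  define N where "N = (\<Sum>i\<in>UNIV. k $ i * m $ i)"
  have "freq k \<bullet> x - freq k \<bullet> y = (\<Sum>i\<in>UNIV. of_int (k $ i) * (x $ i - y $ i))"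
    by (simp add: inner_vec_def freq_def sum_subtractf right_diff_distrib)
  also have "\<dots> = 2 * pi * of_int N"
    by (simp add: m N_def sum_distrib_left mult_ac)
  finally have "freq k \<bullet> x = freq k \<bullet> y + 2 * pi * of_int N" by simp
  then have "\<i> * complex_of_real (freq k \<bullet> x)
      = \<i> * complex_of_real (freq k \<bullet> y) + complex_of_real (of_int (2 * N) * pi) * \<i>"
    by (simp add: algebra_simps)
  then show "exp (\<i> * complex_of_real (freq k \<bullet> x)) = exp (\<i> * complex_of_real (freq k \<bullet> y))"
    unfolding exp_eq by blast
qed

definition fourier_coeff :: "int ^ 'n::finite \<Rightarrow> ('n torus \<Rightarrow> real) \<Rightarrow> complex" where
  "fourier_coeff k v =
     (LINT z|torus_measure. complex_of_real (v z) * fourier_char (- k) z) / (2 * pi) ^ CARD('n)"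

text \<open>The series is summed pointwise and unconditionally. This is the right notion for smooth
  functions, whose Fourier series converge absolutely; it is applied to test functions only.\<close>

definition frac_laplacian :: "real \<Rightarrow> ('n::finite torus \<Rightarrow> real) \<Rightarrow> 'n torus \<Rightarrow> complex" where
  "frac_laplacian \<sigma> v z =
     (\<Sum>\<^sub>\<infinity>k\<in>UNIV. complex_of_real (norm (freq k) powr (2 * \<sigma>)) * fourier_coeff k v * fourier_char k z)"

definition torus_L2 :: "('n::finite torus \<Rightarrow> real) set" where
  "torus_L2 = {v \<in> borel_measurable torus_measure. integrable torus_measure (\<lambda>z. (v z)\<^sup>2)}"

definition frac_laplacian_dom :: "real \<Rightarrow> ('n::finite torus \<Rightarrow> real) set" where
  "frac_laplacian_dom \<sigma> = {v \<in> torus_L2.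
     (\<lambda>k. norm (freq k) powr (4 * \<sigma>) * (cmod (fourier_coeff k v))\<^sup>2) summable_on UNIV}"

primrec Ck :: "nat \<Rightarrow> ('a::real_normed_vector \<Rightarrow> 'b::real_normed_vector) \<Rightarrow> bool" where
  "Ck 0 f \<longleftrightarrow> continuous_on UNIV f"
| "Ck (Suc m) f \<longleftrightarrow> (\<forall>x. f differentiable (at x)) \<and>
     (\<forall>h. Ck m (\<lambda>x. frechet_derivative f (at x) h))"

definition torus_smooth :: "('n::finite torus \<Rightarrow> real) \<Rightarrow> bool" where
  "torus_smooth \<phi> \<longleftrightarrow> (\<forall>m. Ck m (\<lambda>x. \<phi> (torus_proj x)))"

definition frac_harmonic_on :: "real \<Rightarrow> 'n::finite torus set \<Rightarrow> ('n torus \<Rightarrow> real) \<Rightarrow> bool" where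
  "frac_harmonic_on \<sigma> U v \<longleftrightarrow>
     (\<forall>\<phi>. torus_smooth \<phi> \<and> closure {z. \<phi> z \<noteq> 0} \<subseteq> U \<longrightarrow>
        (LINT z|torus_measure. complex_of_real (v z) * frac_laplacian \<sigma> \<phi> z) = 0)"

text \<open>An element of \<open>L\<^sup>2\<close> is a class of functions modulo null sets, so its values on an arbitrary
  compact set are those of its (unique) continuous representative on the open set.\<close>

definition continuous_rep_on ::
  "'n::finite torus set \<Rightarrow> ('n torus \<Rightarrow> real) \<Rightarrow> ('n torus \<Rightarrow> real) \<Rightarrow> bool" where
  "continuous_rep_on U v w \<longleftrightarrow>
     continuous_on U w \<and> (AE z in torus_measure. z \<in> U \<longrightarrow> w z = v z)"

end

theory Submission
  imports Defs
begin

text \<open>The Fourier multiplier of the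
  average over a ball of radius \<open>s\<close> depends only on \<open>s |k|\<close>, so by scaling, the fractional Laplacian is, up
  to a constant, \<open>\<integral>\<^sub>0\<^sup>\<infinity> (u(x) - avg\<^sub>s u(x)) s\<^sup>-\<^sup>1\<^sup>-\<^sup>2\<^sup>\<sigma> ds\<close>. Where this vanishes, two touching arguments bound
  \<open>u\<close> by its \<open>L\<^sup>1\<close> norm \<open>N\<close> over the torus. Above: touch \<open>u\<close> by a multiple of \<open>(r\<^sup>2 - |x - z|\<^sup>2)\<^sup>-\<^sup>n\<close>; at radii
  small compared with the height of the barrier its Hessian controls the averages, at larger radii
  periodicity controls them by \<open>N\<close>. Below, for \<open>u \<ge> 0\<close>: touch \<open>u\<close> by a multiple of \<open>r\<^sup>2 - |x - z|\<^sup>2\<close>;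
  averages over large balls are bounded below by a multiple of \<open>N\<close>. So \<open>N\<close> is comparable with the values
  of \<open>u\<close> on compact sets. A weak solution is mollified by testing it against translates of a smooth
  bump. The upper bound, applied to differences of mollifications, makes them converge locally
  uniformly, which yields the continuous representative.\<close>

subsection \<open>Periodic functions\<close>

text \<open>Touching needs a continuous function that satisfies the equation pointwise, whereas
  \<open>v\<close> is an L2 class that satisfies it only weakly. Two facts bridge the gap.
  Characters are eigenfunctions of ball averaging, so the operator is expressed through averages
  without any kernel for the torus; the power \<open>|k|^(2\<sigma>)\<close> comes out of a
  one-dimensional scaling. And mollification multiplies Fourier coefficients by rapidly decreasing
  ones, so that a mollified solution satisfies the averaged equation exactly, at every point with a
  suitable ball inside \<open>\<O>\<close>. Each estimate compares a single value of
  \<open>u\<close> with the global quantity \<open>N\<close>. Two values are therefore compared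
  through \<open>N\<close>, and no chain of balls joins the points of \<open>\<K>\<close>: this is
  the effect of nonlocality, and the reason why \<open>\<O>\<close> may be disconnected.
  Nonnegativity on the whole torus enters the lower bound, where the touching paraboloid has to stay
  below \<open>u\<close> also outside its ball.\<close>

definition periodic :: "(real ^ 'n::finite \<Rightarrow> 'b) \<Rightarrow> bool" where
  "periodic f \<longleftrightarrow> (\<forall>x m. f (x + (2 * pi) *\<^sub>R freq m) = f x)"

definition box_measure :: "(real ^ 'n::finite) measure" where
  "box_measure = restrict_space lborel torus_box"

text \<open>The ceiling matches the half-open box, which contains \<open>pi\<close> but not
  \<open>- pi\<close> in each coordinate, so that every point has exactly one
  representative.\<close>

definition box_reduce :: "real ^ 'n::finite \<Rightarrow> real ^ 'n" where
  "box_reduce x = (\<chi> i. x $ i - 2 * pi * of_int \<lceil>(x $ i - pi) / (2 * pi)\<rceil>)"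

lemma freq_nth [simp]: "freq k $ i = of_int (k $ i)"
  by (simp add: freq_def)

lemma freq_minus: "freq (- k) = - freq k"
  by (simp add: vec_eq_iff)

lemma periodicD: "periodic f \<Longrightarrow> f (x + (2 * pi) *\<^sub>R freq m) = f x"
  by (simp add: periodic_def)

lemma periodic_translate:
  assumes "periodic f" shows "periodic (\<lambda>x. f (x + z))"
proof -
  have "f (x + (2 * pi) *\<^sub>R freq m + z) = f (x + z)" for x m
    using periodicD[OF assms, of "x + z" m] by (simp add: algebra_simps)
  then show ?thesis by (simp add: periodic_def)
qed

lemma periodic_reduce:
  fixes f :: "real ^ 'n::finite \<Rightarrow> 'b"
  assumes "periodic f" shows "f (box_reduce x) = f x"
proof -
  have "box_reduce x = x + (2 * pi) *\<^sub>R freq (\<chi> i. - \<lceil>(x $ i - pi) / (2 * pi)\<rceil>)"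
    by (simp add: vec_eq_iff box_reduce_def)
  then show ?thesis using periodicD[OF assms] by metis
qed

lemma box_reduce_in_box: "box_reduce x \<in> torus_box"
proof -
  have "- pi < x $ i - 2 * pi * of_int \<lceil>(x $ i - pi) / (2 * pi)\<rceil> \<and>
      x $ i - 2 * pi * of_int \<lceil>(x $ i - pi) / (2 * pi)\<rceil> \<le> pi" for i
  proof -
    define c :: real where "c = of_int \<lceil>(x $ i - pi) / (2 * pi)\<rceil>"
    have "(x $ i - pi) / (2 * pi) \<le> c" "c < (x $ i - pi) / (2 * pi) + 1"
      unfolding c_def by linarith+
    then have "x $ i - pi \<le> 2 * pi * c" "2 * pi * c < x $ i - pi + 2 * pi"
      by (simp_all add: field_simps)
    then show ?thesis unfolding c_def by linarith
  qed
  then show ?thesis by (simp add: torus_box_def box_reduce_def)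
qed

lemma ex1_shift_in_box:
  fixes x :: "real ^ 'n::finite"
  shows "\<exists>!m. x + (2 * pi) *\<^sub>R freq m \<in> torus_box"
proof (rule ex_ex1I)
  have "box_reduce x = x + (2 * pi) *\<^sub>R freq (\<chi> i. - \<lceil>(x $ i - pi) / (2 * pi)\<rceil>)"
    by (simp add: vec_eq_iff box_reduce_def)
  then show "\<exists>m. x + (2 * pi) *\<^sub>R freq m \<in> torus_box"
    using box_reduce_in_box by metis
next
  fix k m :: "int ^ 'n"
  assume a: "x + (2 * pi) *\<^sub>R freq k \<in> torus_box" "x + (2 * pi) *\<^sub>R freq m \<in> torus_box"
  have "k $ i = m $ i" for i
  proof -
    have "- pi < x $ i + 2 * pi * k $ i" "x $ i + 2 * pi * k $ i \<le> pi"
      "- pi < x $ i + 2 * pi * m $ i" "x $ i + 2 * pi * m $ i \<le> pi"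
      using a by (auto simp: torus_box_def)
    then have "2 * pi * (real_of_int (k $ i) - m $ i) < 2 * pi * 1"
      "2 * pi * (real_of_int (m $ i) - k $ i) < 2 * pi * 1"
      by (simp_all add: algebra_simps)
    then have "real_of_int (k $ i) - m $ i < 1" "real_of_int (m $ i) - k $ i < 1"
      using mult_less_cancel_left_pos[of "2 * pi"] pi_gt_zero by auto
    then show ?thesis by linarith
  qed
  then show "k = m" by (simp add: vec_eq_iff)
qed

lemma torus_box_bounds: "x \<in> torus_box \<Longrightarrow> \<bar>x $ i\<bar> \<le> pi"
  by (auto simp: torus_box_def abs_le_iff) (metis less_eq_real_def minus_le_iff)

section \<open>Lebesgue measure on the period box\<close>

lemma torus_box_borel [measurable]: "torus_box \<in> sets borel"
proof -
  have "torus_box = (\<Inter>i\<in>UNIV. {x :: real ^ 'n. - pi < x $ i} \<inter> {x. x $ i \<le> pi})"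
    by (auto simp: torus_box_def)
  also have "\<dots> \<in> sets borel"
    by (intro sets.finite_INT sets.Int borel_open borel_closed open_halfspace_component_gt_cart
        closed_halfspace_component_le_cart) auto
  finally show ?thesis .
qed

lemma space_box_measure [simp]: "space box_measure = torus_box"
  by (simp add: box_measure_def space_restrict_space)

lemma measurable_box_measureI [measurable (raw)]:
  "f \<in> measurable borel N \<Longrightarrow> f \<in> measurable box_measure N"
  unfolding box_measure_def by (intro measurable_restrict_space1) simp

lemma nn_integral_box: "(\<integral>\<^sup>+ x. f x \<partial>box_measure) = (\<integral>\<^sup>+ x. f x * indicator torus_box x \<partial>lborel)"
  unfolding box_measure_def by (subst nn_integral_restrict_space) auto

lemma emeasure_torus_box: "emeasure lborel (torus_box :: (real ^ 'n::finite) set) = ennreal ((2 * pi) ^ CARD('n))"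
proof -
  let ?a = "(\<chi> i. - pi) :: real ^ 'n" and ?b = "(\<chi> i. pi) :: real ^ 'n"
  have sub: "box ?a ?b \<subseteq> torus_box" "torus_box \<subseteq> cbox ?a ?b"
    by (auto simp: torus_box_def mem_box_cart less_imp_le)
  have "emeasure lborel (cbox ?a ?b) = ennreal (measure lborel (cbox ?a ?b))"
    by (intro emeasure_eq_ennreal_measure) (auto simp: emeasure_lborel_cbox_eq)
  also have "measure lborel (cbox ?a ?b) = (2 * pi) ^ CARD('n)"
  proof -
    have "?a \<in> cbox ?a ?b" by (simp add: mem_box_cart)
    then have "cbox ?a ?b \<noteq> {}" by blast
    then show ?thesis by (subst content_cbox_cart) auto
  qed
  finally have c: "emeasure lborel (cbox ?a ?b) = ennreal ((2 * pi) ^ CARD('n))" .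
  have "emeasure lborel (box ?a ?b) = emeasure lborel (cbox ?a ?b)"
    by (simp add: emeasure_lborel_cbox_eq emeasure_lborel_box_eq)
  moreover have "emeasure lborel (box ?a ?b) \<le> emeasure lborel (torus_box :: (real ^ 'n) set)"
    by (intro emeasure_mono sub) auto
  moreover have "emeasure lborel (torus_box :: (real ^ 'n) set) \<le> emeasure lborel (cbox ?a ?b)"
    by (intro emeasure_mono sub) auto
  ultimately show ?thesis using c by simp
qed

lemma emeasure_box_measure: "emeasure (box_measure :: (real ^ 'n::finite) measure) torus_box = ennreal ((2 * pi) ^ CARD('n))"
  unfolding box_measure_def by (subst emeasure_restrict_space) (auto simp: emeasure_torus_box)

lemma finite_measure_box_measure: "finite_measure (box_measure :: (real ^ 'n::finite) measure)"
  by (rule finite_measureI) (simp add: emeasure_box_measure)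

interpretation box_measure: finite_measure "box_measure :: (real ^ 'n::finite) measure"
  by (rule finite_measure_box_measure)

lemma measure_box_measure: "measure (box_measure :: (real ^ 'n::finite) measure) torus_box = (2 * pi) ^ CARD('n)"
  by (simp add: measure_def emeasure_box_measure)

section \<open>Translation invariance of integrals over one period\<close>

lemma measurable_pair_countable:
  assumes "\<And>m :: 'c::countable. (\<lambda>x. f x m) \<in> measurable M N"
  shows "(\<lambda>(x, m). f x m) \<in> measurable (M \<Otimes>\<^sub>M count_space UNIV) N"
proof -
  have "(\<lambda>p. (\<lambda>m p. f (fst p) m) (snd p) p) \<in> measurable (M \<Otimes>\<^sub>M count_space UNIV) N"
    by (rule measurable_compose_countable) (use assms in measurable)
  then show ?thesis by (simp add: case_prod_unfold)
qed

lemma nn_integral_lborel_translate: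
  fixes g :: "'a::euclidean_space \<Rightarrow> ennreal"
  assumes [measurable]: "g \<in> borel_measurable borel"
  shows "(\<integral>\<^sup>+ x. g (x + z) \<partial>lborel) = (\<integral>\<^sup>+ x. g x \<partial>lborel)"
proof -
  have "(\<integral>\<^sup>+ x. g x \<partial>lborel) = (\<integral>\<^sup>+ x. g x \<partial>distr lborel borel ((+) z))"
    by (simp add: lborel_distr_plus)
  also have "\<dots> = (\<integral>\<^sup>+ x. g (z + x) \<partial>lborel)"
    by (subst nn_integral_distr) auto
  finally show ?thesis by (simp add: add.commute)
qed

text \<open>The box and its translate are both fundamental domains of the lattice. Inserting the
  indicators of all lattice translates of one box, exchanging sum and integral, and shifting by the
  lattice vector moves the sum onto the other box. The sum is an integral against
  \<open>count_space\<close>, so the exchange is Fubini's theorem.\<close>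

lemma nn_integral_box_translate:
  fixes g :: "real ^ 'n::finite \<Rightarrow> ennreal"
  assumes [measurable]: "g \<in> borel_measurable borel" and per: "periodic g"
  shows "(\<integral>\<^sup>+ x. g (x + z) \<partial>box_measure) = (\<integral>\<^sup>+ x. g x \<partial>box_measure)"
proof -
  let ?I = "indicator torus_box :: real ^ 'n \<Rightarrow> ennreal"
  let ?C = "count_space (UNIV :: (int ^ 'n) set)"
  interpret C: sigma_finite_measure ?C
    by (rule sigma_finite_measure_count_space_countable) simp
  interpret P: pair_sigma_finite "lborel :: (real ^ 'n) measure" ?C ..
  \<comment> \<open>Half-open boxes tile the space exactly, so the count is 1 at every point and no
    null set has to be discarded.\<close>
  have one: "(\<integral>\<^sup>+ m. ?I (x + (2 * pi) *\<^sub>R freq m) \<partial>?C) = 1" for x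
  proof -
    obtain k where k: "{m. x + (2 * pi) *\<^sub>R freq m \<in> torus_box} = {k}"
      using ex1_shift_in_box[of x] by (auto simp: set_eq_iff)
    have "(\<integral>\<^sup>+ m. ?I (x + (2 * pi) *\<^sub>R freq m) \<partial>?C)
        = (\<integral>\<^sup>+ m. indicator {m. x + (2 * pi) *\<^sub>R freq m \<in> torus_box} m \<partial>?C)"
      by (intro nn_integral_cong) (auto simp: indicator_def)
    also have "\<dots> = 1" unfolding k by simp
    finally show ?thesis .
  qed
  have one': "(\<integral>\<^sup>+ m. ?I (x - (2 * pi) *\<^sub>R freq m) \<partial>?C) = 1" for x
  proof -
    have "(\<integral>\<^sup>+ m. ?I (x - (2 * pi) *\<^sub>R freq m) \<partial>?C) = (\<integral>\<^sup>+ m. ?I (x + (2 * pi) *\<^sub>R freq (- m)) \<partial>?C)"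
      by (simp add: freq_minus)
    also have "\<dots> = (\<integral>\<^sup>+ m. ?I (x + (2 * pi) *\<^sub>R freq m) \<partial>?C)"
      by (rule nn_integral_bij_count_space) (auto intro!: bij_betwI[of _ _ _ uminus])
    finally show ?thesis using one by simp
  qed
  have [measurable]: "(\<lambda>(x, m). ?I (x + (2 * pi) *\<^sub>R freq m)) \<in> borel_measurable (borel \<Otimes>\<^sub>M ?C)"
    by (rule measurable_pair_countable) auto
  have "(\<integral>\<^sup>+ x. g (x + z) \<partial>box_measure) = (\<integral>\<^sup>+ x. g (x + z) * ?I (x + z - z) \<partial>lborel)"
    by (simp add: nn_integral_box)
  also have "\<dots> = (\<integral>\<^sup>+ x. g x * ?I (x - z) \<partial>lborel)"
    by (subst nn_integral_lborel_translate[of "\<lambda>x. g x * ?I (x - z)" z]) auto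
  also have "\<dots> = (\<integral>\<^sup>+ x. (\<integral>\<^sup>+ m. g x * ?I (x - z) * ?I (x + (2 * pi) *\<^sub>R freq m) \<partial>?C) \<partial>lborel)"
    by (subst nn_integral_cmult) (auto simp: one)
  also have "\<dots> = (\<integral>\<^sup>+ m. (\<integral>\<^sup>+ x. g x * ?I (x - z) * ?I (x + (2 * pi) *\<^sub>R freq m) \<partial>lborel) \<partial>?C)"
    by (rule P.Fubini'[symmetric]) measurable
  also have "\<dots> = (\<integral>\<^sup>+ m. (\<integral>\<^sup>+ x. g x * ?I x * ?I (x - z - (2 * pi) *\<^sub>R freq m) \<partial>lborel) \<partial>?C)"
  proof (rule nn_integral_cong)
    fix m
    have "(\<integral>\<^sup>+ x. g x * ?I (x - z) * ?I (x + (2 * pi) *\<^sub>R freq m) \<partial>lborel)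
        = (\<integral>\<^sup>+ x. g (x + (2 * pi) *\<^sub>R freq (- m)) * ?I (x + (2 * pi) *\<^sub>R freq (- m) - z) * ?I (x + (2 * pi) *\<^sub>R freq (- m) + (2 * pi) *\<^sub>R freq m) \<partial>lborel)"
      by (rule nn_integral_lborel_translate[symmetric]) measurable
    also have "\<dots> = (\<integral>\<^sup>+ x. g x * ?I x * ?I (x - z - (2 * pi) *\<^sub>R freq m) \<partial>lborel)"
      unfolding periodicD[OF per] by (simp add: freq_minus algebra_simps)
    finally show "(\<integral>\<^sup>+ x. g x * ?I (x - z) * ?I (x + (2 * pi) *\<^sub>R freq m) \<partial>lborel)
       = (\<integral>\<^sup>+ x. g x * ?I x * ?I (x - z - (2 * pi) *\<^sub>R freq m) \<partial>lborel)" .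
  qed
  also have "\<dots> = (\<integral>\<^sup>+ x. (\<integral>\<^sup>+ m. g x * ?I x * ?I (x - z - (2 * pi) *\<^sub>R freq m) \<partial>?C) \<partial>lborel)"
  proof (rule P.Fubini')
    have [measurable]: "(\<lambda>(x, m). ?I (x - z - (2 * pi) *\<^sub>R freq m)) \<in> borel_measurable (borel \<Otimes>\<^sub>M ?C)"
      by (rule measurable_pair_countable) auto
    show "(\<lambda>(x, m). g x * ?I x * ?I (x - z - (2 * pi) *\<^sub>R freq m)) \<in> borel_measurable (lborel \<Otimes>\<^sub>M ?C)"
      by measurable
  qed
  also have "\<dots> = (\<integral>\<^sup>+ x. g x * ?I x \<partial>lborel)"
    by (subst nn_integral_cmult) (auto simp: one')
  finally show ?thesis by (simp add: nn_integral_box)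
qed

lemma box_reduce_measurable [measurable]: "box_reduce \<in> measurable borel borel"
proof -
  have "(\<lambda>x :: real ^ 'n. x $ i - 2 * pi * of_int \<lceil>(x $ i - pi) / (2 * pi)\<rceil>) \<in> borel_measurable borel" for i
  proof -
    have [measurable]: "(\<lambda>x :: real ^ 'n. x $ i) \<in> borel_measurable borel"
      by (intro borel_measurable_continuous_onI continuous_intros)
    show ?thesis by measurable
  qed
  then show ?thesis
    by (subst borel_measurable_euclidean_space) (auto simp: Basis_vec_def inner_axis box_reduce_def)
qed

text \<open>Stated for measures, translation invariance carries over to Bochner integrals with
  values in any Banach space and to integrability itself.\<close>

lemma distr_box_reduce_translate:
  "distr box_measure borel (\<lambda>x. box_reduce (x + z)) = distr box_measure borel (\<lambda>x. x :: real ^ 'n::finite)"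
proof (rule measure_eqI)
  fix A :: "(real ^ 'n) set" assume "A \<in> sets (distr box_measure borel (\<lambda>x. box_reduce (x + z)))"
  then have [measurable]: "A \<in> sets borel" by simp
  let ?g = "\<lambda>x. indicator A (box_reduce x) :: ennreal"
  have per: "periodic ?g"
    unfolding periodic_def
  proof (intro allI)
    fix x :: "real ^ 'n" and m
    have "box_reduce (x + (2 * pi) *\<^sub>R freq m) = box_reduce x"
    proof -
      have "\<lceil>(x $ i + 2 * pi * real_of_int (m $ i) - pi) / (2 * pi)\<rceil> = \<lceil>(x $ i - pi) / (2 * pi)\<rceil> + m $ i" for i
      proof -
        have "(x $ i + 2 * pi * real_of_int (m $ i) - pi) / (2 * pi) = (x $ i - pi) / (2 * pi) + of_int (m $ i)"
          by (simp add: field_simps)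
        then show ?thesis by simp
      qed
      then show ?thesis by (simp add: box_reduce_def vec_eq_iff algebra_simps)
    qed
    then show "?g (x + (2 * pi) *\<^sub>R freq m) = ?g x" by simp
  qed
  have red: "box_reduce x = x" if "x \<in> torus_box" for x :: "real ^ 'n"
  proof -
    have "\<lceil>(x $ i - pi) / (2 * pi)\<rceil> = 0" for i
      using that by (auto simp: torus_box_def ceiling_eq_iff field_simps)
    then show ?thesis by (simp add: box_reduce_def vec_eq_iff)
  qed
  have "emeasure (distr box_measure borel (\<lambda>x. box_reduce (x + z))) A = (\<integral>\<^sup>+ x. ?g (x + z) \<partial>box_measure)"
    by (subst nn_integral_distr[of _ _ borel "indicator A", symmetric]) auto
  also have "\<dots> = (\<integral>\<^sup>+ x. ?g x \<partial>box_measure)"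
    by (rule nn_integral_box_translate[OF _ per]) measurable
  also have "\<dots> = (\<integral>\<^sup>+ x. indicator A x \<partial>box_measure)"
    by (intro nn_integral_cong) (simp add: red)
  also have "\<dots> = emeasure (distr box_measure borel (\<lambda>x. x)) A"
    by (subst nn_integral_distr[of _ _ borel "indicator A", symmetric]) auto
  finally show "emeasure (distr box_measure borel (\<lambda>x. box_reduce (x + z))) A
    = emeasure (distr box_measure borel (\<lambda>x. x)) A" .
qed simp

lemma integral_box_translate:
  fixes f :: "real ^ 'n::finite \<Rightarrow> 'b::{banach, second_countable_topology}"
  assumes [measurable]: "f \<in> borel_measurable borel" and per: "periodic f"
  shows "(LINT x|box_measure. f (x + z)) = (LINT x|box_measure. f x)"
    and "integrable box_measure (\<lambda>x. f (x + z)) \<longleftrightarrow> integrable box_measure f"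
proof -
  have eq: "f (x + z) = f (box_reduce (x + z))" for x
    by (simp add: periodic_reduce[OF per])
  show "(LINT x|box_measure. f (x + z)) = (LINT x|box_measure. f x)"
    unfolding eq
    using integral_distr[of "\<lambda>x. box_reduce (x + z)" box_measure borel f]
      integral_distr[of "\<lambda>x. x" box_measure borel f]
    by (simp add: distr_box_reduce_translate)
  show "integrable box_measure (\<lambda>x. f (x + z)) \<longleftrightarrow> integrable box_measure f"
    unfolding eq
    using integrable_distr_eq[of "\<lambda>x. box_reduce (x + z)" box_measure borel f]
      integrable_distr_eq[of "\<lambda>x. x" box_measure borel f]
    by (simp add: distr_box_reduce_translate)
qed

subsection \<open>Ball averages and touching arguments\<close>

definition half_line :: "real measure" where
  "half_line = restrict_space lborel {0<..}"

definition ball_measure :: "(real ^ 'n::finite) measure" where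
  "ball_measure = restrict_space lborel (ball 0 1)"

text \<open>Not normalised: the mean value is this divided by \<open>ball_vol\<close>, which is why
  \<open>ball_vol\<close> multiplies \<open>u x\<close> in \<open>balanced\<close>.\<close>

definition ball_avg :: "(real ^ 'n::finite \<Rightarrow> 'b::{banach, second_countable_topology}) \<Rightarrow> real ^ 'n \<Rightarrow> real \<Rightarrow> 'b" where
  "ball_avg u x s = (LINT y|ball_measure. u (x + s *\<^sub>R y))"

abbreviation ball_vol :: "'n::finite itself \<Rightarrow> real" where
  "ball_vol _ \<equiv> unit_ball_vol (real CARD('n))"

text \<open>For a sufficiently regular \<open>u\<close> the integral is a constant multiple of the
  fractional Laplacian at \<open>x\<close>. Asking for \<open>has_bochner_integral\<close> includes
  absolute convergence at 0 and at infinity.\<close>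

definition balanced :: "real \<Rightarrow> (real ^ 'n::finite \<Rightarrow> real) \<Rightarrow> real ^ 'n \<Rightarrow> bool" where
  "balanced \<sigma> u x \<longleftrightarrow> has_bochner_integral half_line
     (\<lambda>s. (ball_avg u x s - ball_vol TYPE('n) * u x) * s powr (- 1 - 2 * \<sigma>)) 0"

lemma powr_add_two: "0 < t \<Longrightarrow> t powr (e + 2) = t\<^sup>2 * t powr e" for t e :: real
  by (simp add: powr_add mult.commute)

text \<open>The majorant used for balance integrals: near 0 a gained factor \<open>s\<^sup>2\<close>
  makes the weight integrable because \<open>\<sigma> < 1\<close>, and at infinity the weight is
  integrable because \<open>0 < \<sigma>\<close>.\<close>

lemma split_powr_has_integral:
  assumes \<sigma>: "0 < \<sigma>" "\<sigma> < 1" and \<rho>: "0 < \<rho>"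
  shows "((\<lambda>s::real. if s < \<rho> then A * s powr (1 - 2 * \<sigma>) else B * s powr (- 1 - 2 * \<sigma>)) has_integral
    A * (\<rho> powr (2 - 2 * \<sigma>) / (2 - 2 * \<sigma>)) + B * (\<rho> powr (- 2 * \<sigma>) / (2 * \<sigma>))) {0..}" (is "(?H has_integral _) _")
proof -
  define H where "H = ?H"
  have "((\<lambda>s. A * s powr (1 - 2 * \<sigma>)) has_integral A * (\<rho> powr (2 - 2 * \<sigma>) / (2 - 2 * \<sigma>))) {0..\<rho>}"
    using has_integral_powr_from_0[of "1 - 2 * \<sigma>" \<rho>] \<sigma> \<rho> by (intro has_integral_mult_right) auto
  then have H1: "(H has_integral A * (\<rho> powr (2 - 2 * \<sigma>) / (2 - 2 * \<sigma>))) {0..\<rho>}"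
    by (rule has_integral_spike_finite[of "{\<rho>}", rotated 2]) (auto simp: H_def)
  have "((\<lambda>s. B * s powr (- 1 - 2 * \<sigma>)) has_integral B * (\<rho> powr (- 2 * \<sigma>) / (2 * \<sigma>))) {\<rho>..}"
    using has_integral_powr_to_inf[of "- 1 - 2 * \<sigma>" \<rho>] \<sigma> \<rho> by (intro has_integral_mult_right) auto
  then have H2: "(H has_integral B * (\<rho> powr (- 2 * \<sigma>) / (2 * \<sigma>))) {\<rho>..}"
    by (rule has_integral_eq[rotated]) (simp add: H_def)
  have "(H has_integral A * (\<rho> powr (2 - 2 * \<sigma>) / (2 - 2 * \<sigma>)) + B * (\<rho> powr (- 2 * \<sigma>) / (2 * \<sigma>))) ({0..\<rho>} \<union> {\<rho>..})"
    by (rule has_integral_Un[OF H1 H2]) (use \<rho> in auto)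
  also have "{0..\<rho>} \<union> {\<rho>..} = {0..}" using \<rho> by auto
  finally show ?thesis unfolding H_def .
qed

text \<open>The vanishing integral lies below that of the majorant, and the common factor
  \<open>\<rho> powr (- 2 * \<sigma>)\<close> is divided out. In both touching arguments
  \<open>A\<close> comes from the touching function and \<open>B\<close> from averages over large
  balls.\<close>

lemma balance_bound:
  assumes \<sigma>: "0 < \<sigma>" "\<sigma> < 1" and \<rho>: "0 < \<rho>"
    and int: "has_bochner_integral half_line (\<lambda>s. F s * s powr (- 1 - 2 * \<sigma>)) 0"
    and small: "\<And>s. 0 < s \<Longrightarrow> s < \<rho> \<Longrightarrow> F s \<le> A * s\<^sup>2"
    and large: "\<And>s. \<rho> \<le> s \<Longrightarrow> F s \<le> B"
  shows "0 \<le> A * \<rho>\<^sup>2 / (2 - 2 * \<sigma>) + B / (2 * \<sigma>)"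
proof -
  define G where "G = (\<lambda>s::real. indicator {0<..} s * (F s * s powr (- 1 - 2 * \<sigma>)))"
  define H where "H = (\<lambda>s. if s < \<rho> then A * s powr (1 - 2 * \<sigma>) else B * s powr (- 1 - 2 * \<sigma>))"
  have "has_bochner_integral lborel G 0"
    using int by (simp add: half_line_def has_bochner_integral_restrict_space G_def)
  then have "(G has_integral 0) UNIV"
    using has_integral_integral_lborel[of G] by (auto simp: has_bochner_integral_iff)
  then have G: "(G has_integral 0) {0..}"
    by (subst has_integral_restrict_UNIV[symmetric], rule has_integral_eq[rotated]) (auto simp: G_def)
  have H: "(H has_integral A * (\<rho> powr (2 - 2 * \<sigma>) / (2 - 2 * \<sigma>)) + B * (\<rho> powr (- 2 * \<sigma>) / (2 * \<sigma>))) {0..}"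
    unfolding H_def by (rule split_powr_has_integral[OF \<sigma> \<rho>])
  have le: "G s \<le> H s" if "s \<in> {0..}" for s
  proof (cases "s = 0")
    \<comment> \<open>\<open>0 powr a\<close> is 0, so both functions vanish at the end
      point.\<close>
    case True then show ?thesis using \<rho> by (simp add: G_def H_def)
  next
    case False
    then have s: "s > 0" using that by simp
    have e: "s powr (1 - 2 * \<sigma>) = s\<^sup>2 * s powr (- 1 - 2 * \<sigma>)"
      using powr_add_two[OF s, of "- 1 - 2 * \<sigma>"] by simp
    have "(if s < \<rho> then A * s\<^sup>2 else B) * s powr (- 1 - 2 * \<sigma>) = (if s < \<rho> then A * s powr (1 - 2 * \<sigma>) else B * s powr (- 1 - 2 * \<sigma>))"
      by (simp add: e)
    moreover have "F s \<le> (if s < \<rho> then A * s\<^sup>2 else B)"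
      using small[of s] large[of s] s by auto
    then have "F s * s powr (- 1 - 2 * \<sigma>) \<le> (if s < \<rho> then A * s\<^sup>2 else B) * s powr (- 1 - 2 * \<sigma>)"
      by (rule mult_right_mono) simp
    ultimately show ?thesis using s by (simp add: G_def H_def)
  qed
  have "0 \<le> A * (\<rho> powr (2 - 2 * \<sigma>) / (2 - 2 * \<sigma>)) + B * (\<rho> powr (- 2 * \<sigma>) / (2 * \<sigma>))"
    by (rule has_integral_le[OF G H le])
  also have "\<rho> powr (2 - 2 * \<sigma>) = \<rho>\<^sup>2 * \<rho> powr (- 2 * \<sigma>)"
    using powr_add_two[OF \<rho>, of "- 2 * \<sigma>"] by simp
  finally have "0 \<le> \<rho> powr (- 2 * \<sigma>) * (A * \<rho>\<^sup>2 / (2 - 2 * \<sigma>) + B / (2 * \<sigma>))"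
    by (simp add: algebra_simps)
  then show ?thesis using \<rho> by (simp add: zero_le_mult_iff)
qed

section \<open>Ball averages of periodic functions\<close>

lemma space_ball_measure [simp]: "space ball_measure = ball 0 1"
  by (simp add: ball_measure_def space_restrict_space)

lemma measurable_ball_measureI [measurable (raw)]:
  "f \<in> measurable borel N \<Longrightarrow> f \<in> measurable ball_measure N"
  unfolding ball_measure_def by (intro measurable_restrict_space1) simp

lemma emeasure_ball_measure:
  "emeasure (ball_measure :: (real ^ 'n::finite) measure) (ball 0 1) = ennreal (ball_vol TYPE('n))"
  unfolding ball_measure_def by (subst emeasure_restrict_space) (auto simp: emeasure_ball)

interpretation ball_measure: finite_measure "ball_measure :: (real ^ 'n::finite) measure"
  by (rule finite_measureI) (simp add: emeasure_ball_measure)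

lemma measure_ball_measure:
  "measure (ball_measure :: (real ^ 'n::finite) measure) (ball 0 1) = ball_vol TYPE('n)"
  by (simp add: measure_def emeasure_ball_measure)

lemma nn_integral_ball: "(\<integral>\<^sup>+ x. f x \<partial>ball_measure) = (\<integral>\<^sup>+ x. f x * indicator (ball 0 1) x \<partial>lborel)"
  unfolding ball_measure_def by (subst nn_integral_restrict_space) auto

lemma norm_torus_box: "x \<in> torus_box \<Longrightarrow> norm (x :: real ^ 'n::finite) \<le> real CARD('n) * pi"
  using norm_le_l1_cart[of x] sum_bounded_above[of UNIV "\<lambda>i. \<bar>x $ i\<bar>" pi] torus_box_bounds[of x]
  by fastforce

text \<open>Both bounds come from averaging over all translations of the ball by points of the box, which
  changes its radius by at most the diameter and turns \<open>g\<close> into its mean.\<close>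

lemma ball_avg_nn_bounds:
  fixes g :: "real ^ 'n::finite \<Rightarrow> ennreal"
  assumes [measurable]: "g \<in> borel_measurable borel" and per: "periodic g" and s: "0 < s"
  defines "R \<equiv> real CARD('n) * pi"
  shows "(\<integral>\<^sup>+ y. g (x + s *\<^sub>R y) \<partial>ball_measure) * ennreal ((2 * pi) ^ CARD('n))
      \<le> (\<integral>\<^sup>+ z. g z \<partial>box_measure) * emeasure lborel (ball 0 (1 + R / s) :: (real ^ 'n) set)" (is "?L \<le> ?U")
    and "(\<integral>\<^sup>+ z. g z \<partial>box_measure) * emeasure lborel (ball 0 (1 - R / s) :: (real ^ 'n) set)
      \<le> (\<integral>\<^sup>+ y. g (x + s *\<^sub>R y) \<partial>ball_measure) * ennreal ((2 * pi) ^ CARD('n))" (is "?D \<le> _")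
proof -
  have swap: "(\<integral>\<^sup>+ z. (\<integral>\<^sup>+ y. g (x + s *\<^sub>R y + z) * indicator (ball 0 t) y \<partial>lborel) \<partial>box_measure)
      = (\<integral>\<^sup>+ z. g z \<partial>box_measure) * emeasure lborel (ball 0 t :: (real ^ 'n) set)" for t
  proof -
    have [measurable]: "(ball 0 t :: (real ^ 'n) set) \<in> sets borel" by simp
    have [measurable]: "(\<lambda>(z, y). g (x + s *\<^sub>R y + z) * indicator (ball 0 t) y) \<in> borel_measurable (borel \<Otimes>\<^sub>M borel)"
      by measurable
    have "(\<integral>\<^sup>+ z. (\<integral>\<^sup>+ y. g (x + s *\<^sub>R y + z) * indicator (ball 0 t) y \<partial>lborel) \<partial>box_measure)
       = (\<integral>\<^sup>+ y. (\<integral>\<^sup>+ z. g (x + s *\<^sub>R y + z) * indicator (ball 0 t) y \<partial>box_measure) \<partial>lborel)"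
    proof -
      have "(\<integral>\<^sup>+ z. (\<integral>\<^sup>+ y. g (x + s *\<^sub>R y + z) * indicator (ball 0 t) y \<partial>lborel) \<partial>box_measure)
        = (\<integral>\<^sup>+ z. (\<integral>\<^sup>+ y. g (x + s *\<^sub>R y + z) * indicator (ball 0 t) y * indicator torus_box z \<partial>lborel) \<partial>lborel)"
        unfolding nn_integral_box by (subst nn_integral_multc) auto
      also have "\<dots> = (\<integral>\<^sup>+ y. (\<integral>\<^sup>+ z. g (x + s *\<^sub>R y + z) * indicator (ball 0 t) y * indicator torus_box z \<partial>lborel) \<partial>lborel)"
        by (rule lborel_pair.Fubini'[symmetric]) measurable
      finally show ?thesis unfolding nn_integral_box .
    qed
    also have "\<dots> = (\<integral>\<^sup>+ y. (\<integral>\<^sup>+ z. g (z + (x + s *\<^sub>R y)) \<partial>box_measure) * indicator (ball 0 t) y \<partial>lborel)"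
      by (subst nn_integral_multc) (auto simp: add.commute)
    also have "\<dots> = (\<integral>\<^sup>+ y. (\<integral>\<^sup>+ z. g z \<partial>box_measure) * indicator (ball 0 t) (y :: real ^ 'n) \<partial>lborel)"
      by (simp only: nn_integral_box_translate[OF assms(1) per])
    also have "\<dots> = (\<integral>\<^sup>+ z. g z \<partial>box_measure) * emeasure lborel (ball 0 t :: (real ^ 'n) set)"
      by (subst nn_integral_cmult) auto
    finally show ?thesis .
  qed
  have const: "(\<integral>\<^sup>+ y. g (x + s *\<^sub>R y) \<partial>ball_measure) * ennreal ((2 * pi) ^ CARD('n))
     = (\<integral>\<^sup>+ z. (\<integral>\<^sup>+ y. g (x + s *\<^sub>R y) * indicator (ball 0 1) y \<partial>lborel) \<partial>(box_measure :: (real ^ 'n) measure))"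
    by (simp add: nn_integral_ball emeasure_box_measure)
  \<comment> \<open>The substitution moves the shift \<open>z\<close> from the argument of
    \<open>g\<close> to the ball; the shifted ball lies between two balls centred at 0 whose radii
    differ from 1 by \<open>R / s\<close>.\<close>
  have shift: "(\<integral>\<^sup>+ y. g (x + s *\<^sub>R y) * indicator (ball 0 1) y \<partial>lborel)
     = (\<integral>\<^sup>+ y. g (x + s *\<^sub>R y + z) * indicator (ball 0 1) (y + (1 / s) *\<^sub>R z) \<partial>lborel)" for z
  proof -
    have "x + s *\<^sub>R (y + (1 / s) *\<^sub>R z) = x + s *\<^sub>R y + z" for y
      using s by (simp add: scaleR_add_right)
    moreover have [measurable]: "(ball 0 1 :: (real ^ 'n) set) \<in> sets borel" by simp
    have "(\<lambda>y. g (x + s *\<^sub>R y) * indicator (ball 0 1) y) \<in> borel_measurable borel"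
      by measurable
    from nn_integral_lborel_translate[OF this, of "(1 / s) *\<^sub>R z"]
    have "(\<integral>\<^sup>+ y. g (x + s *\<^sub>R y) * indicator (ball 0 1) y \<partial>lborel)
      = (\<integral>\<^sup>+ y. g (x + s *\<^sub>R (y + (1 / s) *\<^sub>R z)) * indicator (ball 0 1) (y + (1 / s) *\<^sub>R z) \<partial>lborel)"
      by (rule sym)
    ultimately show ?thesis by (simp only:)
  qed
  show "?L \<le> ?U"
    unfolding const swap[symmetric]
  proof (rule nn_integral_mono)
    fix z :: "real ^ 'n" assume z: "z \<in> space box_measure"
    have "norm (y :: real ^ 'n) < 1 + R / s" if "norm (y + (1 / s) *\<^sub>R z) < 1" for y
    proof -
      have "norm y \<le> norm (y + (1 / s) *\<^sub>R z) + norm ((1 / s) *\<^sub>R z)"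
        using norm_triangle_ineq4[of "y + (1 / s) *\<^sub>R z" "(1 / s) *\<^sub>R z"] by simp
      also have "norm ((1 / s) *\<^sub>R z) \<le> R / s"
        using norm_torus_box[of z] z s by (simp add: R_def divide_right_mono)
      finally show ?thesis using that by simp
    qed
    then show "(\<integral>\<^sup>+ y. g (x + s *\<^sub>R y) * indicator (ball 0 1) y \<partial>lborel)
       \<le> (\<integral>\<^sup>+ y. g (x + s *\<^sub>R y + z) * indicator (ball 0 (1 + R / s)) y \<partial>lborel)"
      unfolding shift[of z] by (intro nn_integral_mono mult_left_mono) (auto simp: indicator_def)
  qed
  show "?D \<le> ?L"
    unfolding const swap[symmetric]
  proof (rule nn_integral_mono)
    fix z :: "real ^ 'n" assume z: "z \<in> space box_measure"
    have "norm (y + (1 / s) *\<^sub>R z) < 1" if "norm (y :: real ^ 'n) < 1 - R / s" for y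
    proof -
      have "norm (y + (1 / s) *\<^sub>R z) \<le> norm y + norm ((1 / s) *\<^sub>R z)"
        by (rule norm_triangle_ineq)
      also have "norm ((1 / s) *\<^sub>R z) \<le> R / s"
        using norm_torus_box[of z] z s by (simp add: R_def divide_right_mono)
      finally show ?thesis using that by simp
    qed
    then show "(\<integral>\<^sup>+ y. g (x + s *\<^sub>R y + z) * indicator (ball 0 (1 - R / s)) y \<partial>lborel)
      \<le> (\<integral>\<^sup>+ y. g (x + s *\<^sub>R y) * indicator (ball 0 1) y \<partial>lborel)"
      unfolding shift[of z] by (intro nn_integral_mono mult_left_mono) (auto simp: indicator_def)
  qed
qed


lemma periodic_bounded:
  fixes f :: "real ^ 'n::finite \<Rightarrow> 'b::real_normed_vector"
  assumes "continuous_on UNIV f" "periodic f"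
  obtains M where "0 \<le> M" "\<And>x. norm (f x) \<le> M"
proof -
  let ?B = "cbox (\<chi> i. - pi) (\<chi> i. pi) :: (real ^ 'n) set"
  have "compact (f ` ?B)"
    by (intro compact_continuous_image continuous_on_subset[OF assms(1)]) auto
  then obtain M where M: "\<And>x. x \<in> ?B \<Longrightarrow> norm (f x) \<le> M"
    using compact_imp_bounded[of "f ` ?B"] by (auto simp: bounded_iff)
  have "norm (f x) \<le> max M 0" for x
  proof -
    have "box_reduce x \<in> ?B"
      using box_reduce_in_box[of x] by (auto simp: torus_box_def mem_box_cart less_imp_le)
    from M[OF this] show ?thesis by (simp add: periodic_reduce[OF assms(2)])
  qed
  then show thesis using that[of "max M 0"] by simp
qed

lemma continuous_borel [intro]: "continuous_on UNIV f \<Longrightarrow> f \<in> borel_measurable borel"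
  by (rule borel_measurable_continuous_onI)

lemma integrable_box_periodic:
  fixes f :: "real ^ 'n::finite \<Rightarrow> 'b::{banach, second_countable_topology}"
  assumes "continuous_on UNIV f" "periodic f"
  shows "integrable box_measure f"
proof -
  obtain M where "\<And>x. norm (f x) \<le> M" using periodic_bounded[OF assms] by metis
  moreover have [measurable]: "f \<in> borel_measurable borel" using assms by blast
  ultimately show ?thesis by (intro box_measure.integrable_const_bound[of _ M]) auto
qed

lemma integrable_ball_continuous:
  fixes f :: "real ^ 'n::finite \<Rightarrow> 'b::{banach, second_countable_topology}"
  assumes "continuous_on UNIV f"
  shows "integrable ball_measure (\<lambda>y. f (x + s *\<^sub>R y))"
proof -
  have c: "continuous_on UNIV (\<lambda>y. f (x + s *\<^sub>R y))"
    by (intro continuous_on_compose2[OF assms] continuous_intros) auto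
  then have "bounded ((\<lambda>y. f (x + s *\<^sub>R y)) ` cball 0 1)"
    by (intro compact_imp_bounded compact_continuous_image) (auto intro: continuous_on_subset)
  then obtain M where M: "\<And>y. y \<in> cball 0 1 \<Longrightarrow> norm (f (x + s *\<^sub>R y)) \<le> M"
    unfolding bounded_iff by blast
  show ?thesis
    using M continuous_borel[OF c] by (intro ball_measure.integrable_const_bound[of _ M]) (auto intro!: AE_I2)
qed

lemma ball_vol_pos: "0 < ball_vol TYPE('n::finite)"
  by simp

text \<open>Real form of \<open>ball_avg_nn_bounds\<close>. The condition \<open>R \<le> s\<close>
  keeps the inner radius nonnegative, so that its power gives the volume of the inner ball.\<close>

lemma ball_avg_bounds:
  fixes u :: "real ^ 'n::finite \<Rightarrow> real"
  assumes cont: "continuous_on UNIV u" and per: "periodic u" and nonneg: "\<And>x. 0 \<le> u x" and s: "0 < s"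
  defines "R \<equiv> real CARD('n) * pi"
  shows "ball_avg u x s * (2 * pi) ^ CARD('n) \<le> (LINT z|box_measure. u z) * (ball_vol TYPE('n) * (1 + R / s) ^ CARD('n))"
    and "R \<le> s \<Longrightarrow> (LINT z|box_measure. u z) * (ball_vol TYPE('n) * (1 - R / s) ^ CARD('n)) \<le> ball_avg u x s * (2 * pi) ^ CARD('n)"
proof -
  have R: "0 \<le> R" by (simp add: R_def)
  have [measurable]: "(\<lambda>x. ennreal (u x)) \<in> borel_measurable borel"
    using continuous_borel[OF cont] by measurable
  have per': "periodic (\<lambda>x. ennreal (u x))" using per by (simp add: periodic_def)
  have 1: "(\<integral>\<^sup>+ y. ennreal (u (x + s *\<^sub>R y)) \<partial>ball_measure) = ennreal (ball_avg u x s)"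
    unfolding ball_avg_def by (intro nn_integral_eq_integral integrable_ball_continuous cont AE_I2 nonneg)
  have 2: "(\<integral>\<^sup>+ y. ennreal (u y) \<partial>box_measure) = ennreal (LINT z|box_measure. u z)"
    by (intro nn_integral_eq_integral integrable_box_periodic cont per AE_I2 nonneg)
  have nn: "0 \<le> ball_avg u x s" "0 \<le> (LINT z|box_measure. u z)"
    unfolding ball_avg_def by (intro integral_nonneg_AE AE_I2 nonneg)+
  show "ball_avg u x s * (2 * pi) ^ CARD('n) \<le> (LINT z|box_measure. u z) * (ball_vol TYPE('n) * (1 + R / s) ^ CARD('n))"
    using ball_avg_nn_bounds(1)[OF _ per' s, of x] nn s R
    by (simp add: 1 2 R_def[symmetric] emeasure_ball ennreal_mult[symmetric])
  show "(LINT z|box_measure. u z) * (ball_vol TYPE('n) * (1 - R / s) ^ CARD('n)) \<le> ball_avg u x s * (2 * pi) ^ CARD('n)" if "R \<le> s"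
    using ball_avg_nn_bounds(2)[OF _ per' s, of x] nn s R that
    by (simp add: 1 2 R_def[symmetric] emeasure_ball ennreal_mult[symmetric])
qed

section \<open>Rotation invariance of ball integrals\<close>

lemma orthogonal_transformation_measurable:
  fixes T :: "real ^ 'n::finite \<Rightarrow> real ^ 'n"
  assumes "orthogonal_transformation T" shows "T \<in> borel_measurable borel"
  using assms by (intro borel_measurable_continuous_onI linear_continuous_on)
    (simp add: orthogonal_transformation_linear linear_conv_bounded_linear[symmetric])

text \<open>\<open>measure_orthogonal_image\<close> requires a well-ordered index type. Here, with \<open>B\<close> the unit ball, the double
  integral of \<open>1\<^sub>A(T x) 1\<^sub>B(y - T x)\<close> is evaluated in both orders, using that \<open>T\<close> preserves \<open>B\<close>.\<close>

lemma lborel_distr_orthogonal: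
  fixes T :: "real ^ 'n::finite \<Rightarrow> real ^ 'n"
  assumes T: "orthogonal_transformation T"
  shows "distr lborel borel T = lborel"
proof (rule measure_eqI)
  obtain S where S: "orthogonal_transformation S" and ST: "\<And>x. S (T x) = x" "\<And>x. T (S x) = x"
    using orthogonal_transformation_inv[OF T] orthogonal_transformation_bij[OF T]
    by (metis bij_inv_eq_iff)
  have lin: "linear T" using T by (rule orthogonal_transformation_linear)
  have [measurable]: "T \<in> borel_measurable borel"
    by (rule orthogonal_transformation_measurable[OF T])
  fix A :: "(real ^ 'n) set" assume "A \<in> sets (distr lborel borel T)"
  then have [measurable]: "A \<in> sets borel" by simp
  let ?B = "ball 0 1 :: (real ^ 'n) set"
  have [measurable]: "?B \<in> sets borel" by simp
  have "emeasure lborel ?B * emeasure (distr lborel borel T) A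
      = (\<integral>\<^sup>+ x. indicator A (T x) * emeasure lborel ?B \<partial>lborel)"
  proof -
    have "emeasure (distr lborel borel T) A = (\<integral>\<^sup>+ x. indicator A (T x) \<partial>lborel)"
      by (subst nn_integral_distr[of _ _ borel "indicator A", symmetric]) auto
    then show ?thesis by (simp add: nn_integral_multc mult.commute)
  qed
  also have "\<dots> = (\<integral>\<^sup>+ x. (\<integral>\<^sup>+ y. indicator A (T x) * indicator ?B (y - T x) \<partial>lborel) \<partial>lborel)"
  proof (rule nn_integral_cong)
    fix x
    have "(\<integral>\<^sup>+ y. indicator ?B (y - T x) \<partial>lborel) = emeasure lborel ?B"
      using nn_integral_lborel_translate[of "indicator ?B" "- T x"] by simp
    then show "indicator A (T x) * emeasure lborel ?B
      = (\<integral>\<^sup>+ y. indicator A (T x) * indicator ?B (y - T x) \<partial>lborel)"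
      by (subst nn_integral_cmult) auto
  qed
  also have "\<dots> = (\<integral>\<^sup>+ y. (\<integral>\<^sup>+ x. indicator A (T x) * indicator ?B (y - T x) \<partial>lborel) \<partial>lborel)"
    by (rule lborel_pair.Fubini'[symmetric]) measurable
  also have "\<dots> = (\<integral>\<^sup>+ y. (\<integral>\<^sup>+ x. indicator A (T x + y) * indicator ?B x \<partial>lborel) \<partial>lborel)"
  proof (rule nn_integral_cong)
    fix y
    have "(\<integral>\<^sup>+ x. indicator A (T x) * indicator ?B (y - T x) \<partial>lborel)
      = (\<integral>\<^sup>+ x. indicator A (T (x + S y)) * indicator ?B (y - T (x + S y)) \<partial>lborel)"
      by (rule nn_integral_lborel_translate[symmetric]) measurable
    also have "\<dots> = (\<integral>\<^sup>+ x. indicator A (T x + y) * indicator ?B x \<partial>lborel)"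
      by (intro nn_integral_cong)
        (simp add: linear_add[OF lin] ST indicator_def orthogonal_transformation_norm[OF T])
    finally show "(\<integral>\<^sup>+ x. indicator A (T x) * indicator ?B (y - T x) \<partial>lborel)
      = (\<integral>\<^sup>+ x. indicator A (T x + y) * indicator ?B x \<partial>lborel)" .
  qed
  also have "\<dots> = (\<integral>\<^sup>+ x. (\<integral>\<^sup>+ y. indicator A (T x + y) * indicator ?B x \<partial>lborel) \<partial>lborel)"
    by (rule lborel_pair.Fubini') measurable
  also have "\<dots> = (\<integral>\<^sup>+ x. emeasure lborel A * indicator ?B x \<partial>lborel)"
  proof (rule nn_integral_cong)
    fix x
    have "(\<integral>\<^sup>+ y. indicator A (T x + y) \<partial>lborel) = emeasure lborel A"
      using nn_integral_lborel_translate[of "indicator A" "T x"] by (simp add: add.commute)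
    then show "(\<integral>\<^sup>+ y. indicator A (T x + y) * indicator ?B x \<partial>lborel) = emeasure lborel A * indicator ?B x"
      by (subst nn_integral_multc) auto
  qed
  also have "\<dots> = emeasure lborel ?B * emeasure lborel A"
    by (subst nn_integral_cmult) (auto simp: mult.commute)
  finally show "emeasure (distr lborel borel T) A = emeasure lborel A"
    using ball_vol_pos[where 'n = 'n] by (subst (asm) ennreal_mult_cancel_left) (auto simp: emeasure_ball)
qed simp

lemma integral_ball_orthogonal:
  fixes T :: "real ^ 'n::finite \<Rightarrow> real ^ 'n" and h :: "real ^ 'n \<Rightarrow> 'b::{banach, second_countable_topology}"
  assumes T: "orthogonal_transformation T" and [measurable]: "h \<in> borel_measurable borel"
  shows "(LINT y|ball_measure. h (T y)) = (LINT y|ball_measure. h y)"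
proof -
  have [measurable]: "T \<in> borel_measurable borel"
    by (rule orthogonal_transformation_measurable[OF T])
  have r: "(LINT y|ball_measure. k y) = (LINT y|lborel. indicator (ball 0 1) y *\<^sub>R k y)" for k :: "real ^ 'n \<Rightarrow> 'b"
    unfolding ball_measure_def by (subst integral_restrict_space) auto
  have "(LINT y|ball_measure. h (T y)) = (LINT y|lborel. indicator (ball 0 1) (T y) *\<^sub>R h (T y))"
    unfolding r by (simp add: indicator_def orthogonal_transformation_norm[OF T])
  also have "\<dots> = (LINT y|distr lborel borel T. indicator (ball 0 1) y *\<^sub>R h y)"
  proof -
    have [measurable]: "(ball 0 1 :: (real ^ 'n) set) \<in> sets borel" by simp
    show ?thesis by (subst integral_distr) auto
  qed
  finally show ?thesis by (simp add: lborel_distr_orthogonal[OF T] r)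
qed

section \<open>Touching arguments at balanced points\<close>

lemma ball_avg_symmetric:
  fixes u :: "real ^ 'n::finite \<Rightarrow> real"
  assumes cont: "continuous_on UNIV u"
  shows "ball_avg u x s = (LINT y|ball_measure. (u (x + s *\<^sub>R y) + u (x - s *\<^sub>R y)) / 2)"
proof -
  have i: "integrable ball_measure (\<lambda>y. u (x - s *\<^sub>R y))"
    using integrable_ball_continuous[OF cont, of x "- s"] by simp
  have [measurable]: "(\<lambda>y. u (x + s *\<^sub>R y)) \<in> borel_measurable borel"
    by (intro continuous_borel continuous_on_compose2[OF cont] continuous_intros) auto
  have "(LINT y|ball_measure. u (x - s *\<^sub>R y)) = ball_avg u x s"
    using integral_ball_orthogonal[of uminus "\<lambda>y. u (x + s *\<^sub>R y)"]
    by (simp add: ball_avg_def orthogonal_transformation_neg[symmetric] orthogonal_transformation_def linear_uminus)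
  then show ?thesis
    using integrable_ball_continuous[OF cont, of x s] i by (simp add: ball_avg_def)
qed

text \<open>Pairing \<open>y\<close> with \<open>- y\<close> cancels first-order terms, so contact
  with a smooth function from one side controls the average through the Hessian alone; no derivative
  of \<open>u\<close> is involved.\<close>

lemma ball_avg_second_difference:
  fixes u :: "real ^ 'n::finite \<Rightarrow> real"
  assumes cont: "continuous_on UNIV u"
    and le: "\<And>y. norm y < 1 \<Longrightarrow> u (x + s *\<^sub>R y) + u (x - s *\<^sub>R y) - 2 * u x \<le> 2 * K"
  shows "ball_avg u x s - ball_vol TYPE('n) * u x \<le> ball_vol TYPE('n) * K"
proof -
  have "ball_avg u x s \<le> (LINT y|(ball_measure :: (real ^ 'n) measure). u x + K)"
    unfolding ball_avg_symmetric[OF cont]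
  proof (intro integral_mono)
    show "integrable ball_measure (\<lambda>y. (u (x + s *\<^sub>R y) + u (x - s *\<^sub>R y)) / 2)"
      using integrable_ball_continuous[OF cont, of x s] integrable_ball_continuous[OF cont, of x "- s"] by simp
    fix y :: "real ^ 'n" assume "y \<in> space ball_measure"
    then show "(u (x + s *\<^sub>R y) + u (x - s *\<^sub>R y)) / 2 \<le> u x + K" using le[of y] by simp
  qed simp
  then show ?thesis by (simp add: measure_ball_measure algebra_simps)
qed

text \<open>A one-sided Taylor bound, used with \<open>q\<close> the relative decrease of the
  barrier. The linear term is kept exact because it almost cancels between opposite points.\<close>

lemma inverse_power_quadratic_bound:
  "\<exists>C\<ge>0. \<forall>q::real. \<bar>q\<bar> \<le> 1 / 2 \<longrightarrow> 1 / (1 - q) ^ m \<le> 1 + real m * q + C * q\<^sup>2"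
proof (induction m)
  case 0 show ?case by (intro exI[of _ 0]) simp
next
  case (Suc m)
  then obtain C where C: "0 \<le> C" "\<And>q. \<bar>q\<bar> \<le> 1 / 2 \<Longrightarrow> 1 / (1 - q) ^ m \<le> 1 + real m * q + C * q\<^sup>2"
    by blast
  have "1 / (1 - q) ^ Suc m \<le> 1 + real (Suc m) * q + (2 + 2 * real m + 2 * C) * q\<^sup>2" if q: "\<bar>q\<bar> \<le> 1 / 2" for q
  proof -
    have q1: "1 - q > 0" using q by linarith
    have q3: "q ^ 3 \<le> q\<^sup>2 / 2" "q ^ 4 \<le> q\<^sup>2 / 4"
    proof -
      have "q\<^sup>2 * q \<le> q\<^sup>2 * (1 / 2)" by (intro mult_left_mono) (use q in auto)
      then show "q ^ 3 \<le> q\<^sup>2 / 2" by (simp add: power3_eq_cube power2_eq_square)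
      have "q\<^sup>2 \<le> (1 / 2)\<^sup>2" using q by (metis abs_le_square_iff abs_of_nonneg divide_nonneg_nonneg zero_le_numeral zero_le_one)
      then have "q\<^sup>2 * q\<^sup>2 \<le> q\<^sup>2 * (1 / 2)\<^sup>2" by (intro mult_left_mono) auto
      then show "q ^ 4 \<le> q\<^sup>2 / 4" by (simp add: power2_eq_square power4_eq_xxxx)
    qed
    have p: "1 / (1 - q) \<le> 1 + q + 2 * q\<^sup>2"
    proof -
      have "(1 + q + 2 * q\<^sup>2) * (1 - q) - 1 = q\<^sup>2 - 2 * q ^ 3" by (simp add: algebra_simps power2_eq_square power3_eq_cube)
      also have "\<dots> \<ge> 0" using q3 by simp
      finally show ?thesis using q1 by (simp add: field_simps)
    qed
    have "1 / (1 - q) ^ Suc m = 1 / (1 - q) ^ m * (1 / (1 - q))" by simp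
    also have "\<dots> \<le> (1 + real m * q + C * q\<^sup>2) * (1 + q + 2 * q\<^sup>2)"
      using C(2)[OF q] p q1 by (intro mult_mono order.trans[OF _ C(2)[OF q]]) auto
    also have "\<dots> = 1 + real (Suc m) * q + (2 + real m + C) * q\<^sup>2 + (2 * real m + C) * q ^ 3 + 2 * C * q ^ 4"
      by (simp add: algebra_simps power2_eq_square power3_eq_cube power4_eq_xxxx)
    also have "\<dots> \<le> 1 + real (Suc m) * q + (2 + real m + C) * q\<^sup>2 + (2 * real m + C) * (q\<^sup>2 / 2) + 2 * C * (q\<^sup>2 / 4)"
      using q3 C(1) by (intro add_mono mult_left_mono) auto
    also have "\<dots> = 1 + real (Suc m) * q + (2 + 2 * real m + 2 * C) * q\<^sup>2" by (simp add: field_simps)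
    finally show ?thesis .
  qed
  then show ?case using C(1) by (intro exI[of _ "2 + 2 * real m + 2 * C"]) auto
qed


text \<open>At a maximum point \<open>x0\<close> of \<open>u * b ^ n\<close>, with \<open>b\<close>
  the distance weight, a multiple of \<open>b\<close> to the power \<open>- n\<close> touches
  \<open>u\<close> from above. With \<open>\<rho> = \<theta> * b0\<close>, averages at radii from
  \<open>\<rho>\<close> on are at most a constant times \<open>N / \<rho> ^ n\<close>, and balance
  yields \<open>u0 \<le> 2 * (D * N / \<rho> ^ n)\<close>. The exponent of the barrier is the
  dimension precisely so that \<open>u0 * b0 ^ n\<close> is then bounded independently of
  \<open>b0\<close>.\<close>

lemma balanced_upper_bound:
  assumes \<sigma>: "0 < \<sigma>" "\<sigma> < 1" and r: "0 < r" "r \<le> 1"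
  obtains C where "0 < C" "\<And>(u :: real ^ 'n::finite \<Rightarrow> real) z. continuous_on UNIV u \<Longrightarrow> periodic u \<Longrightarrow>
    (\<And>x. x \<in> ball z r \<Longrightarrow> balanced \<sigma> u x) \<Longrightarrow> u z \<le> C * (LINT x|box_measure. \<bar>u x\<bar>)"
proof -
  define n where "n = CARD('n)"
  define R where "R = real CARD('n) * pi"
  define \<omega> where "\<omega> = ball_vol TYPE('n)"
  define D where "D = (1 + R) ^ n / (2 * pi) ^ n"
  have R: "0 \<le> R" by (simp add: R_def)
  have \<omega>: "0 < \<omega>" unfolding \<omega>_def by (rule ball_vol_pos)
  have D: "0 < D" using R by (simp add: D_def)
  obtain C1 where C1: "0 \<le> C1"
    "\<And>q::real. \<bar>q\<bar> \<le> 1 / 2 \<Longrightarrow> 1 / (1 - q) ^ n \<le> 1 + real n * q + C1 * q\<^sup>2"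
    using inverse_power_quadratic_bound[of n] by blast
  \<comment> \<open>The linear parts of \<open>d w\<close> and \<open>d (- w)\<close> cancel and
    leave \<open>2 * (norm w)\<^sup>2\<close>, which accounts for \<open>n\<close>; the 9 comes from
    \<open>\<bar>d w\<bar> \<le> 3 * norm w\<close>, squared.\<close>
  define C2 where "C2 = real n + 9 * C1"
  have C2: "0 \<le> C2" using C1 by (simp add: C2_def)
  \<comment> \<open>Chosen so that the Hessian contributes at most
    \<open>u0 / (4 * \<sigma>)\<close>, half of the term \<open>u0 / (2 * \<sigma>)\<close> that the
    large radii contribute with the opposite sign.\<close>
  define \<kappa> where "\<kappa> = (2 - 2 * \<sigma>) / (4 * \<sigma> * (C2 + 1))"
  have \<kappa>: "0 < \<kappa>" using \<sigma> C2 by (simp add: \<kappa>_def)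
  \<comment> \<open>The bound \<open>1 / 8\<close> gives
    \<open>\<bar>d w\<bar> \<le> 3 * \<rho> \<le> b0 / 2\<close>, the range in which the Taylor
    bound is available.\<close>
  define \<theta> where "\<theta> = min (1 / 8) (sqrt \<kappa>)"
  have \<theta>: "0 < \<theta>" "\<theta> \<le> 1 / 8" using \<kappa> by (auto simp: \<theta>_def)
  have "\<theta>\<^sup>2 \<le> (sqrt \<kappa>)\<^sup>2" using \<theta>(1) by (intro power_mono) (auto simp: \<theta>_def)
  then have \<theta>\<kappa>: "\<theta>\<^sup>2 \<le> \<kappa>" using \<kappa> by simp
  have \<theta>2: "C2 * \<theta>\<^sup>2 / (2 - 2 * \<sigma>) \<le> 1 / (4 * \<sigma>)"
  proof -
    have "C2 * \<theta>\<^sup>2 \<le> C2 * \<kappa>" using \<theta>\<kappa> C2 by (rule mult_left_mono)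
    also have "\<dots> \<le> (C2 + 1) * \<kappa>" using \<kappa> by simp
    also have "\<dots> = (2 - 2 * \<sigma>) / (4 * \<sigma>)" using C2 \<sigma> by (simp add: \<kappa>_def divide_simps)
    finally have "C2 * \<theta>\<^sup>2 \<le> (2 - 2 * \<sigma>) / (4 * \<sigma>)" .
    then have "C2 * \<theta>\<^sup>2 / (2 - 2 * \<sigma>) \<le> (2 - 2 * \<sigma>) / (4 * \<sigma>) / (2 - 2 * \<sigma>)"
      by (rule divide_right_mono) (use \<sigma> in simp)
    then show ?thesis using \<sigma> by simp
  qed
  define C where "C = 2 * D / (\<theta> ^ n * (r\<^sup>2) ^ n)"
  have C: "0 < C" using D \<theta> r by (simp add: C_def)
  have "u z \<le> C * (LINT x|box_measure. \<bar>u x\<bar>)"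
    if cont: "continuous_on UNIV u" and per: "periodic u" and bal: "\<And>x. x \<in> ball z r \<Longrightarrow> balanced \<sigma> u x"
    for u :: "real ^ 'n \<Rightarrow> real" and z
  proof (cases "u z \<le> 0")
    case True
    have "0 \<le> (LINT x|box_measure. \<bar>u x\<bar>)" by (intro integral_nonneg_AE) auto
    then have "0 \<le> C * (LINT x|box_measure. \<bar>u x\<bar>)" using C by simp
    with True show ?thesis by linarith
  next
    case False
    define N where "N = (LINT x|box_measure. \<bar>u x\<bar>)"
    define b where "b = (\<lambda>x. r\<^sup>2 - (norm (x - z))\<^sup>2)"
    have bz: "b z = r\<^sup>2" by (simp add: b_def)
    have "continuous_on (cball z r) (\<lambda>x. u x * b x ^ n)"
      unfolding b_def by (intro continuous_intros continuous_on_subset[OF cont]) auto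
    then obtain x0 where x0: "x0 \<in> cball z r" and max: "\<And>x. x \<in> cball z r \<Longrightarrow> u x * b x ^ n \<le> u x0 * b x0 ^ n"
      using continuous_attains_sup[of "cball z r" "\<lambda>x. u x * b x ^ n"] r by fastforce
    define t where "t = u x0 * b x0 ^ n"
    have tz: "u z * (r\<^sup>2) ^ n \<le> t" using max[of z] r by (simp add: t_def bz)
    have t: "0 < t"
      using False r by (intro less_le_trans[OF _ tz]) (auto intro!: mult_pos_pos)
    have n0: "n > 0" by (simp add: n_def)
    have "norm (x0 - z) \<le> r" using x0 by (simp add: dist_norm norm_minus_commute)
    \<comment> \<open>The maximum \<open>t\<close> is positive while the weight vanishes on the
      sphere, so it is attained inside.\<close>
    moreover have "norm (x0 - z) \<noteq> r" using t n0 by (auto simp: t_def b_def zero_power)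
    ultimately have x0r: "norm (x0 - z) < r" by simp
    then have x0b: "x0 \<in> ball z r" by (simp add: dist_norm norm_minus_commute)
    define b0 where "b0 = b x0"
    have b0: "0 < b0" using x0r by (simp add: b0_def b_def power_strict_mono)
    have b01: "b0 \<le> 1"
    proof -
      have "r\<^sup>2 \<le> 1" using r by (simp add: power_le_one)
      then show ?thesis unfolding b0_def b_def using zero_le_power2[of "norm (x0 - z)"] by linarith
    qed
    define u0 where "u0 = u x0"
    have tu: "t = u0 * b0 ^ n" by (simp add: t_def u0_def b0_def)
    have u0: "0 < u0" using t b0 by (simp add: tu zero_less_mult_iff)
    define \<rho> where "\<rho> = \<theta> * b0"
    have \<rho>: "0 < \<rho>" "\<rho> \<le> b0 / 8" "\<rho> \<le> 1"
      using \<theta> b0 b01 mult_right_mono[of \<theta> "1/8" b0] mult_mono[of \<theta> 1 b0 1] by (auto simp: \<rho>_def)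
    \<comment> \<open>The amount by which \<open>b\<close> decreases from \<open>x0\<close> to
      \<open>x0 + w\<close>.\<close>
    define d where "d = (\<lambda>w. 2 * ((x0 - z) \<bullet> w) + (norm w)\<^sup>2)"
    have local: "u (x0 + w) \<le> u0 * (1 + real n * (d w / b0) + C1 * (d w / b0)\<^sup>2) \<and> \<bar>d w\<bar> \<le> 3 * norm w" if w: "norm w < \<rho>" for w
    proof -
      have bw: "b (x0 + w) = b0 - d w"
        by (simp add: b0_def b_def d_def power2_norm_eq_inner algebra_simps inner_commute)
      have "\<bar>(x0 - z) \<bullet> w\<bar> \<le> norm (x0 - z) * norm w" by (rule Cauchy_Schwarz_ineq2)
      also have "\<dots> \<le> 1 * norm w" using x0r r by (intro mult_right_mono) auto
      finally have 1: "\<bar>(x0 - z) \<bullet> w\<bar> \<le> norm w" by simp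
      have "(norm w)\<^sup>2 \<le> 1 * norm w" unfolding power2_eq_square
        using w \<rho> by (intro mult_right_mono) auto
      then have d3: "\<bar>d w\<bar> \<le> 3 * norm w" using 1 zero_le_power2[of "norm w"] norm_ge_zero[of w] unfolding d_def by linarith
      then have db: "\<bar>d w\<bar> \<le> b0 / 2" using w \<rho> b0 by linarith
      have q: "\<bar>d w / b0\<bar> \<le> 1 / 2" using db b0 by (simp add: abs_divide field_simps)
      have bpos: "0 < b (x0 + w)" unfolding bw using db b0 by linarith
      have "(norm (x0 + w - z))\<^sup>2 \<le> r\<^sup>2" using bpos by (simp add: b_def)
      then have "norm (x0 + w - z) \<le> r" using r by (simp add: power2_le_iff_abs_le)
      then have "x0 + w \<in> cball z r" by (simp add: dist_norm norm_minus_commute)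
      from max[OF this] have "u (x0 + w) \<le> t / b (x0 + w) ^ n"
        using bpos by (simp add: t_def field_simps)
      also have "b (x0 + w) = b0 * (1 - d w / b0)" unfolding bw using b0 by (simp add: field_simps)
      also have "t / (b0 * (1 - d w / b0)) ^ n = u0 * (1 / (1 - d w / b0) ^ n)"
        using b0 by (simp add: tu power_mult_distrib)
      also have "\<dots> \<le> u0 * (1 + real n * (d w / b0) + C1 * (d w / b0)\<^sup>2)"
        using C1(2)[OF q] u0 by (intro mult_left_mono) auto
      finally show ?thesis using d3 by simp
    qed
    have small: "ball_avg u x0 s - \<omega> * u x0 \<le> \<omega> * (u0 * C2 / b0\<^sup>2) * s\<^sup>2" if s: "0 < s" "s < \<rho>" for s
    proof -
      have "ball_avg u x0 s - \<omega> * u x0 \<le> \<omega> * (u0 * C2 / b0\<^sup>2 * s\<^sup>2)"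
        unfolding \<omega>_def
      proof (rule ball_avg_second_difference[OF cont])
        fix y :: "real ^ 'n" assume y: "norm y < 1"
        define w where "w = s *\<^sub>R y"
        have ws: "norm w \<le> s" using y s by (simp add: w_def)
        then have w: "norm w < \<rho>" "norm (- w) < \<rho>" using s by auto
        have sq: "(d v / b0)\<^sup>2 \<le> 9 * s\<^sup>2 / b0\<^sup>2" if "\<bar>d v\<bar> \<le> 3 * norm v" "norm v \<le> s" for v
        proof -
          have "\<bar>d v\<bar> \<le> 3 * s" using that by linarith
          then have "(d v)\<^sup>2 \<le> (3 * s)\<^sup>2" using s by (intro power2_le_iff_abs_le[THEN iffD2]) auto
          then show ?thesis by (simp add: power_divide divide_right_mono power_mult_distrib)
        qed
        have dd: "d w + d (- w) = 2 * (norm w)\<^sup>2" by (simp add: d_def)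
        have "(norm w)\<^sup>2 \<le> s\<^sup>2" using ws by (intro power_mono) auto
        then have "(d w + d (- w)) / b0 \<le> 2 * s\<^sup>2 / b0" unfolding dd using b0 by (simp add: divide_right_mono)
        also have "\<dots> \<le> 2 * s\<^sup>2 / b0\<^sup>2"
          using b0 b01 by (intro divide_left_mono) (auto simp: power2_eq_square)
        finally have dds: "(d w + d (- w)) / b0 \<le> 2 * s\<^sup>2 / b0\<^sup>2" .
        have "u (x0 + w) + u (x0 + - w) - 2 * u x0
          \<le> u0 * (real n * ((d w + d (- w)) / b0) + C1 * ((d w / b0)\<^sup>2 + (d (- w) / b0)\<^sup>2))"
          using local[OF w(1)] local[OF w(2)] by (simp add: u0_def algebra_simps add_divide_distrib)
        also have "\<dots> \<le> u0 * (real n * (2 * s\<^sup>2 / b0\<^sup>2) + C1 * (9 * s\<^sup>2 / b0\<^sup>2 + 9 * s\<^sup>2 / b0\<^sup>2))"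
          using sq[of w] sq[of "- w"] local[OF w(1)] local[OF w(2)] ws dds u0 C1
          by (intro mult_left_mono add_mono) auto
        also have "\<dots> = 2 * (u0 * C2 / b0\<^sup>2 * s\<^sup>2)"
          by (simp add: C2_def algebra_simps add_divide_distrib)
        finally show "u (x0 + s *\<^sub>R y) + u (x0 - s *\<^sub>R y) - 2 * u x0 \<le> 2 * (u0 * C2 / b0\<^sup>2 * s\<^sup>2)"
          by (simp add: w_def)
      qed
      then show ?thesis by (simp add: mult.assoc)
    qed
    have large: "ball_avg u x0 s - \<omega> * u x0 \<le> \<omega> * (D * N / \<rho> ^ n - u0)" if s: "\<rho> \<le> s" for s
    proof -
      have cabs: "continuous_on UNIV (\<lambda>x. \<bar>u x\<bar>)" by (intro continuous_intros cont)
      have pabs: "periodic (\<lambda>x. \<bar>u x\<bar>)" using per by (simp add: periodic_def)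
      have s0: "0 < s" using s \<rho> by simp
      have "1 + R / s \<le> 1 / \<rho> + R / \<rho>"
        using s \<rho> R s0 by (intro add_mono divide_left_mono) (auto simp: field_simps)
      then have Rs: "1 + R / s \<le> (1 + R) / \<rho>" by (simp add: add_divide_distrib)
      have N0: "0 \<le> N" unfolding N_def by (intro integral_nonneg_AE) auto
      have "ball_avg u x0 s \<le> ball_avg (\<lambda>x. \<bar>u x\<bar>) x0 s"
        unfolding ball_avg_def by (intro integral_mono integrable_ball_continuous cont cabs) auto
      also have "\<dots> = ball_avg (\<lambda>x. \<bar>u x\<bar>) x0 s * (2 * pi) ^ n / (2 * pi) ^ n" by simp
      also have "\<dots> \<le> N * (\<omega> * (1 + R / s) ^ n) / (2 * pi) ^ n"
        using ball_avg_bounds(1)[OF cabs pabs _ s0, of x0]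
        by (intro divide_right_mono) (auto simp: N_def \<omega>_def R_def n_def)
      also have "\<dots> \<le> N * (\<omega> * ((1 + R) / \<rho>) ^ n) / (2 * pi) ^ n"
        using Rs N0 \<omega> R s0 by (intro divide_right_mono mult_left_mono power_mono) auto
      also have "\<dots> = \<omega> * (D * N / \<rho> ^ n)"
        by (simp add: D_def power_divide mult_ac)
      finally show ?thesis by (simp add: u0_def algebra_simps)
    qed
    have "0 \<le> \<omega> * (u0 * C2 / b0\<^sup>2) * \<rho>\<^sup>2 / (2 - 2 * \<sigma>) + \<omega> * (D * N / \<rho> ^ n - u0) / (2 * \<sigma>)"
      by (rule balance_bound[OF \<sigma> \<rho>(1) _ small large])
        (use bal[OF x0b] in \<open>auto simp: balanced_def \<omega>_def\<close>)
    \<comment> \<open>Since \<open>\<rho>\<close> is proportional to \<open>b0\<close>, the singular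
      factor \<open>1 / b0\<^sup>2\<close> of the Hessian cancels and only
      \<open>\<theta>\<^sup>2\<close> is left.\<close>
    also have "\<dots> = \<omega> * (u0 * (C2 * \<theta>\<^sup>2 / (2 - 2 * \<sigma>)) + (D * N / \<rho> ^ n - u0) / (2 * \<sigma>))"
      using b0 by (simp add: \<rho>_def power_mult_distrib algebra_simps)
    finally have "0 \<le> u0 * (C2 * \<theta>\<^sup>2 / (2 - 2 * \<sigma>)) + (D * N / \<rho> ^ n - u0) / (2 * \<sigma>)"
      using \<omega> by (simp add: zero_le_mult_iff)
    also have "\<dots> \<le> u0 * (1 / (4 * \<sigma>)) + (D * N / \<rho> ^ n - u0) / (2 * \<sigma>)"
      using \<theta>2 u0 by (intro add_mono mult_left_mono) auto
    also have "\<dots> = (2 * (D * N / \<rho> ^ n) - u0) / (4 * \<sigma>)"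
      using \<sigma> by (simp add: field_simps)
    finally have "u0 \<le> 2 * (D * N / \<rho> ^ n)" using \<sigma> by (simp add: zero_le_divide_iff)
    then have "u0 * b0 ^ n \<le> 2 * (D * N / \<rho> ^ n) * b0 ^ n" using b0 by (intro mult_right_mono) auto
    also have "\<dots> = 2 * D * N / \<theta> ^ n" using b0 by (simp add: \<rho>_def power_mult_distrib)
    finally have "u z * (r\<^sup>2) ^ n \<le> 2 * D * N / \<theta> ^ n" using tz tu by simp
    then have "u z * (r\<^sup>2) ^ n / (r\<^sup>2) ^ n \<le> 2 * D * N / \<theta> ^ n / (r\<^sup>2) ^ n"
      by (intro divide_right_mono) auto
    then show ?thesis using r by (simp add: C_def N_def)
  qed
  then show thesis using that C by blast
qed

text \<open>If \<open>u z < c * N\<close>, a paraboloid of height \<open>c * N\<close> rises above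
  \<open>u\<close> at \<open>z\<close>; lowered until it touches, it meets \<open>u\<close> inside
  the ball at some \<open>x0\<close>. There \<open>u x0 \<le> c * N\<close>, while averages over
  balls of radius at least \<open>\<rho>\<close> are at least \<open>\<omega> * D * N\<close>. For
  small \<open>c\<close> this excess outweighs what the Hessian allows at small radii, contradicting
  balance.\<close>

lemma balanced_lower_bound:
  assumes \<sigma>: "0 < \<sigma>" "\<sigma> < 1" and r: "0 < r"
  obtains c where "0 < c" "\<And>(u :: real ^ 'n::finite \<Rightarrow> real) z. continuous_on UNIV u \<Longrightarrow> periodic u \<Longrightarrow>
    (\<And>x. 0 \<le> u x) \<Longrightarrow> (\<And>x. x \<in> ball z r \<Longrightarrow> balanced \<sigma> u x) \<Longrightarrow> c * (LINT x|box_measure. u x) \<le> u z"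
proof -
  define n where "n = CARD('n)"
  define R where "R = real CARD('n) * pi"
  define \<omega> where "\<omega> = ball_vol TYPE('n)"
  define D where "D = (1 / 2) ^ n / (2 * pi) ^ n"
  \<comment> \<open>Makes \<open>1 - R / s\<close> at least \<open>1 / 2\<close> from radius
    \<open>\<rho>\<close> on, whence the factor \<open>(1 / 2) ^ n\<close> in
    \<open>D\<close>.\<close>
  define \<rho> where "\<rho> = 2 * R"
  define E where "E = \<rho>\<^sup>2 / (r\<^sup>2 * (2 - 2 * \<sigma>)) + 1 / (2 * \<sigma>)"
  \<comment> \<open>\<open>E\<close> collects the coefficients of \<open>c * N\<close> in the
    balance inequality. The choice makes \<open>c * E\<close> half of
    \<open>D / (2 * \<sigma>)\<close>, so the inequality fails.\<close>
  define c where "c = D / (2 * \<sigma>) / (2 * E)"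
  have R: "0 < R" by (simp add: R_def)
  then have \<rho>: "0 < \<rho>" by (simp add: \<rho>_def)
  have \<omega>: "0 < \<omega>" unfolding \<omega>_def by (rule ball_vol_pos)
  have D: "0 < D" by (simp add: D_def)
  have E: "0 < E" using \<sigma> by (auto simp: E_def intro!: add_nonneg_pos)
  have c: "0 < c" using D E \<sigma> by (simp add: c_def)
  have "c * (LINT x|box_measure. u x) \<le> u z"
    if cont: "continuous_on UNIV u" and per: "periodic u" and nonneg: "\<And>x. 0 \<le> u x"
      and bal: "\<And>x. x \<in> ball z r \<Longrightarrow> balanced \<sigma> u x"
    for u :: "real ^ 'n \<Rightarrow> real" and z
  proof (rule ccontr)
    assume neg: "\<not> ?thesis"
    define N where "N = (LINT x|box_measure. u x)"
    have uz: "u z < c * N" using neg by (simp add: N_def)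
    then have N: "0 < N" using nonneg[of z] c by (smt (verit) mult_nonneg_nonpos)
    define \<tau> where "\<tau> = c * N / r\<^sup>2"
    have \<tau>: "0 < \<tau>" "\<tau> * r\<^sup>2 = c * N" using c N r by (auto simp: \<tau>_def)
    define g where "g = (\<lambda>x. u x - \<tau> * (r\<^sup>2 - (norm (x - z))\<^sup>2))"
    have "continuous_on (cball z r) g"
      unfolding g_def by (intro continuous_intros continuous_on_subset[OF cont]) auto
    then obtain x0 where x0: "x0 \<in> cball z r" and min: "\<And>x. x \<in> cball z r \<Longrightarrow> g x0 \<le> g x"
      using continuous_attains_inf[of "cball z r" g] r by fastforce
    have "g z < 0" using uz \<tau> by (simp add: g_def)
    then have g0: "g x0 < 0" using min[of z] r by simp
    have out: "0 \<le> g x" if "r \<le> norm (x - z)" for x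
    proof -
      have "r\<^sup>2 \<le> (norm (x - z))\<^sup>2" using that r by (intro power_mono) auto
      then have "\<tau> * (r\<^sup>2 - (norm (x - z))\<^sup>2) \<le> 0" using \<tau> by (simp add: mult_nonneg_nonpos)
      then show ?thesis using nonneg[of x] by (simp add: g_def)
    qed
    \<comment> \<open>Outside the ball the paraboloid is nonpositive and \<open>u\<close>
      nonnegative, so the negative minimum over the ball is global. Hence the second differences are
      controlled for every \<open>s\<close>, even when the points leave the ball, and
      \<open>\<rho>\<close> may exceed \<open>r\<close>.\<close>
    have gmin: "g x0 \<le> g x" for x
      using min[of x] out[of x] g0 by (cases "x \<in> cball z r") (auto simp: dist_norm norm_minus_commute)
    have "norm (x0 - z) < r" using out[of x0] g0 by (meson not_less)
    then have x0b: "x0 \<in> ball z r" by (simp add: dist_norm norm_minus_commute)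
    have ux0: "u x0 \<le> c * N"
    proof -
      have "u x0 \<le> \<tau> * (r\<^sup>2 - (norm (x0 - z))\<^sup>2)" using g0 by (simp add: g_def)
      also have "\<dots> \<le> \<tau> * r\<^sup>2" using \<tau> by (intro mult_left_mono) auto
      finally show ?thesis using \<tau> by simp
    qed
    \<comment> \<open>The sign is reversed because \<open>balance_bound\<close> takes upper
      bounds.\<close>
    define F where "F = (\<lambda>s. - (ball_avg u x0 s - \<omega> * u x0))"
    have int: "has_bochner_integral half_line (\<lambda>s. F s * s powr (- 1 - 2 * \<sigma>)) 0"
      using has_bochner_integral_minus[OF bal[OF x0b, unfolded balanced_def]] by (simp add: F_def \<omega>_def algebra_simps)
    have small: "F s \<le> \<omega> * \<tau> * s\<^sup>2" if s: "0 < s" for s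
    proof -
      have cm: "continuous_on UNIV (\<lambda>x. - u x)" by (intro continuous_intros cont)
      have "ball_avg (\<lambda>x. - u x) x0 s - ball_vol TYPE('n) * - u x0 \<le> ball_vol TYPE('n) * (\<tau> * s\<^sup>2)"
      proof (rule ball_avg_second_difference[OF cm])
        fix y :: "real ^ 'n" assume y: "norm y < 1"
        have "(norm (x0 + s *\<^sub>R y - z))\<^sup>2 + (norm (x0 - s *\<^sub>R y - z))\<^sup>2 - 2 * (norm (x0 - z))\<^sup>2 = 2 * (s\<^sup>2 * (norm y)\<^sup>2)"
        proof -
          have "(norm (a + v))\<^sup>2 + (norm (a - v))\<^sup>2 - 2 * (norm a)\<^sup>2 = 2 * (norm v)\<^sup>2" for a v :: "real ^ 'n"
            by (simp add: power2_norm_eq_inner inner_simps inner_commute)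
          from this[of "x0 - z" "s *\<^sub>R y"] show ?thesis
            by (simp add: power_mult_distrib add_diff_eq diff_diff_eq2 algebra_simps)
        qed
        also have "\<dots> \<le> 2 * (s\<^sup>2 * 1)" using y by (intro mult_left_mono) (auto simp: power_le_one)
        finally have "\<tau> * ((norm (x0 + s *\<^sub>R y - z))\<^sup>2 + (norm (x0 - s *\<^sub>R y - z))\<^sup>2 - 2 * (norm (x0 - z))\<^sup>2) \<le> \<tau> * (2 * (s\<^sup>2 * 1))"
          using \<tau> by (intro mult_left_mono) auto
        then show "- u (x0 + s *\<^sub>R y) + - u (x0 - s *\<^sub>R y) - 2 * - u x0 \<le> 2 * (\<tau> * s\<^sup>2)"
          using gmin[of "x0 + s *\<^sub>R y"] gmin[of "x0 - s *\<^sub>R y"] by (simp add: g_def algebra_simps)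
      qed
      then show ?thesis by (simp add: F_def \<omega>_def ball_avg_def algebra_simps)
    qed
    have large: "F s \<le> \<omega> * (c * N - D * N)" if s: "\<rho> \<le> s" for s
    proof -
      have s0: "0 < s" "R \<le> s" "R / s \<le> 1 / 2" using s \<rho> R by (auto simp: \<rho>_def field_simps)
      have "\<omega> * (D * N) = N * (\<omega> * (1 / 2) ^ n) / (2 * pi) ^ n" by (simp add: D_def)
      also have "\<dots> \<le> N * (\<omega> * (1 - R / s) ^ n) / (2 * pi) ^ n"
        using N \<omega> s0 by (intro divide_right_mono mult_left_mono power_mono) auto
      also have "\<dots> \<le> ball_avg u x0 s * (2 * pi) ^ n / (2 * pi) ^ n"
        using ball_avg_bounds(2)[OF cont per nonneg s0(1)] s0(2)
        by (intro divide_right_mono) (auto simp: N_def \<omega>_def R_def n_def)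
      finally have "\<omega> * (D * N) \<le> ball_avg u x0 s" by simp
      moreover have "\<omega> * u x0 \<le> \<omega> * (c * N)" using ux0 \<omega> by simp
      ultimately show ?thesis by (simp add: F_def algebra_simps)
    qed
    have "0 \<le> \<omega> * \<tau> * \<rho>\<^sup>2 / (2 - 2 * \<sigma>) + \<omega> * (c * N - D * N) / (2 * \<sigma>)"
      by (rule balance_bound[OF \<sigma> \<rho> int small large])
    also have "\<dots> = \<omega> * N * (c * E - D / (2 * \<sigma>))"
      unfolding \<tau>_def E_def using \<sigma> r by (simp add: algebra_simps diff_divide_distrib)
    finally have "0 \<le> c * E - D / (2 * \<sigma>)"
      using mult_pos_pos[OF \<omega> N] by (metis mult_less_cancel_left_pos mult_zero_right not_less)
    moreover have "c * E = D / (2 * \<sigma>) / 2" using E by (simp add: c_def)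
    moreover have "0 < D / (2 * \<sigma>)" using D \<sigma> by simp
    ultimately show False by (metis diff_ge_0_iff_ge half_gt_zero_iff linorder_not_le field_sum_of_halves less_add_same_cancel1)
  qed
  then show thesis using that c by blast
qed

subsection \<open>Fourier series\<close>

text \<open>Reduced to a series over \<open>nat\<close> by an enumeration of the index type, which
  exists because that type is countably infinite; absolute convergence identifies
  \<open>infsum\<close> with \<open>suminf\<close> along it.\<close>

lemma has_bochner_integral_infsum:
  fixes f :: "'k::countable \<Rightarrow> 'a \<Rightarrow> 'b::{banach, second_countable_topology}"
  assumes inf: "infinite (UNIV :: 'k set)"
    and int: "\<And>k. integrable M (f k)"
    and norms: "(\<lambda>k. LINT x|M. norm (f k x)) summable_on UNIV"
    and pointwise: "\<And>x. x \<in> space M \<Longrightarrow> (\<lambda>k. norm (f k x)) summable_on UNIV"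
  shows "has_bochner_integral M (\<lambda>x. \<Sum>\<^sub>\<infinity>k. f k x) (\<Sum>\<^sub>\<infinity>k. integral\<^sup>L M (f k))"
proof -
  obtain e :: "nat \<Rightarrow> 'k" where e: "bij_betw e UNIV UNIV"
    using bij_betw_from_nat_into[OF countableI_type inf] by blast
  have infsum_e: "(\<Sum>\<^sub>\<infinity>k. g k) = (\<Sum>i. g (e i))" if "(\<lambda>k. norm (g k)) summable_on UNIV" for g :: "'k \<Rightarrow> 'b"
  proof -
    have "(\<lambda>i. norm (g (e i))) summable_on UNIV"
      using that summable_on_reindex_bij_betw[OF e, of "\<lambda>k. norm (g k)"] by simp
    then have s: "summable (\<lambda>i. norm (g (e i)))" by (rule summable_on_imp_summable)
    have "((\<lambda>i. g (e i)) has_sum (\<Sum>i. g (e i))) UNIV"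
      by (rule norm_summable_imp_has_sum[OF s summable_sums[OF summable_norm_cancel[OF s]]])
    then have "(\<Sum>\<^sub>\<infinity>i. g (e i)) = (\<Sum>i. g (e i))" by (rule infsumI)
    then show ?thesis by (simp only: infsum_reindex_bij_betw[OF e, of g])
  qed
  have s1: "summable (\<lambda>i. LINT x|M. norm (f (e i) x))"
    using norms summable_on_reindex_bij_betw[OF e, of "\<lambda>k. LINT x|M. norm (f k x)"]
    by (intro summable_on_imp_summable) simp
  have s2: "summable (\<lambda>i. norm (f (e i) x))" if "x \<in> space M" for x
    using pointwise[OF that] summable_on_reindex_bij_betw[OF e, of "\<lambda>k. norm (f k x)"]
    by (intro summable_on_imp_summable) simp
  have "has_bochner_integral M (\<lambda>x. \<Sum>i. f (e i) x) (\<Sum>i. integral\<^sup>L M (f (e i)))"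
    unfolding has_bochner_integral_iff
    using integrable_suminf[of M "\<lambda>i. f (e i)"] integral_suminf[of M "\<lambda>i. f (e i)"] s1 s2 int AE_I2[of M]
    by simp
  moreover have "(\<lambda>k. norm (integral\<^sup>L M (f k))) summable_on UNIV"
    by (rule summable_on_comparison_test[OF norms]) (simp_all only: integral_norm_bound norm_ge_zero)
  then have "(\<Sum>\<^sub>\<infinity>k. integral\<^sup>L M (f k)) = (\<Sum>i. integral\<^sup>L M (f (e i)))" by (rule infsum_e)
  moreover have "has_bochner_integral M (\<lambda>x. \<Sum>i. f (e i) x) I \<longleftrightarrow> has_bochner_integral M (\<lambda>x. \<Sum>\<^sub>\<infinity>k. f k x) I" for I
    by (rule has_bochner_integral_cong) (simp_all only: infsum_e[OF pointwise])
  ultimately show ?thesis by simp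
qed

lemma infinite_UNIV_int_vec: "infinite (UNIV :: (int ^ 'n::finite) set)"
proof
  assume "finite (UNIV :: (int ^ 'n) set)"
  then have "finite (range (\<lambda>j::int. \<chi> i::'n. j))" by (rule finite_subset[rotated]) simp
  moreover have "inj (\<lambda>j::int. \<chi> i::'n. j)" by (auto simp: inj_def vec_eq_iff)
  ultimately show False using finite_imageD infinite_UNIV_int by blast
qed

section \<open>Characters and uniqueness of Fourier coefficients\<close>

definition echar :: "int ^ 'n::finite \<Rightarrow> real ^ 'n \<Rightarrow> complex" where
  "echar k x = exp (\<i> * complex_of_real (freq k \<bullet> x))"

lemma fourier_char_proj: "fourier_char k (torus_proj x) = echar k x"
  by (simp add: fourier_char.abs_eq echar_def)

lemma torus_proj_periodic: "torus_proj (x + (2 * pi) *\<^sub>R freq m) = torus_proj x"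
proof -
  have "torus_rel (x + (2 * pi) *\<^sub>R freq m) x"
    unfolding torus_rel_def by (intro exI[of _ m]) simp
  then show ?thesis by (simp add: torus.abs_eq_iff)
qed

lemma periodic_proj: "periodic (\<lambda>x. f (torus_proj x))"
  by (simp add: periodic_def torus_proj_periodic)

lemma echar_periodic: "periodic (echar k)"
  using periodic_proj[of "fourier_char k"] by (simp add: fourier_char_proj[abs_def])

lemma norm_echar [simp]: "norm (echar k x) = 1"
  by (simp add: echar_def)

lemma echar_continuous [continuous_intros]: "continuous_on S (echar k)"
  unfolding echar_def by (intro continuous_intros)

lemma echar_measurable [measurable]: "echar k \<in> borel_measurable borel"
  by (intro continuous_borel continuous_intros)

lemma echar_add: "echar k (x + y) = echar k x * echar k y"
  by (simp add: echar_def inner_add_right exp_add[symmetric] distrib_left)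

lemma echar_plus: "echar (j + k) x = echar j x * echar k x"
proof -
  have "freq (j + k) = freq j + freq k" by (simp add: vec_eq_iff)
  then show ?thesis by (simp add: echar_def inner_add_left exp_add[symmetric] distrib_left)
qed

lemma echar_0 [simp]: "echar 0 x = 1" "echar k 0 = 1"
proof -
  have "freq (0 :: int ^ 'a) = 0" by (simp add: vec_eq_iff)
  then show "echar 0 x = 1" by (simp add: echar_def)
  show "echar k 0 = 1" by (simp add: echar_def)
qed

lemma echar_uminus_mult [simp]: "echar (- k) x * echar k x = 1" "echar k x * echar (- k) x = 1"
  by (simp_all add: echar_plus[symmetric])

text \<open>For nonzero \<open>k\<close> a translation by \<open>h\<close> with
  \<open>freq k \<bullet> h = pi\<close> changes the sign of the character but not the
  integral.\<close>

lemma integral_echar: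
  "(LINT x|box_measure. echar k x) = (if k = 0 then complex_of_real ((2 * pi) ^ CARD('n::finite)) else 0)"
  for k :: "int ^ 'n::finite"
proof (cases "k = 0")
  case True then show ?thesis by (simp add: measure_box_measure scaleR_conv_of_real)
next
  case False
  then obtain i where i: "k $ i \<noteq> 0" by (auto simp: vec_eq_iff)
  define h :: "real ^ 'n" where "h = axis i (pi / of_int (k $ i))"
  have "freq k \<bullet> h = pi" using i by (simp add: h_def inner_axis)
  then have "echar k h = -1" by (simp add: echar_def)
  then have "(LINT x|box_measure. echar k (x + h)) = - (LINT x|box_measure. echar k x)"
    by (simp add: echar_add)
  then show ?thesis using False integral_box_translate(1)[OF echar_measurable echar_periodic, of k h] by simp
qed

text \<open>Peak kernel: the powers of \<open>1 - one_sub_cos / (2n)\<close> are non-negative trigonometric polynomials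
  that concentrate at the origin.\<close>

definition one_sub_cos :: "real ^ 'n::finite \<Rightarrow> real" where
  "one_sub_cos x = (\<Sum>i\<in>UNIV. 1 - cos (x $ i))"

lemma one_sub_cos_nonneg: "0 \<le> one_sub_cos x"
  unfolding one_sub_cos_def by (intro sum_nonneg) simp

lemma one_sub_cos_continuous [continuous_intros]: "continuous_on S one_sub_cos"
  unfolding one_sub_cos_def by (intro continuous_intros)

lemma one_sub_cos_periodic: "periodic (one_sub_cos :: real ^ 'n::finite \<Rightarrow> real)"
proof -
  have "cos (x $ i + 2 * pi * of_int (m $ i)) = cos (x $ i)" for x :: "real ^ 'n" and m :: "int ^ 'n" and i
    by (simp add: cos_add)
  then show ?thesis
    unfolding periodic_def one_sub_cos_def by (intro allI sum.cong refl) (simp only: vector_add_component vector_scaleR_component freq_nth real_scaleR_def mult.assoc)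
qed

lemma one_sub_cos_0 [simp]: "one_sub_cos 0 = 0"
  by (simp add: one_sub_cos_def)

text \<open>\<open>one_sub_cos\<close> replaces the squared distance to the lattice by something
  smooth and periodic. By compactness it has a positive minimum over the closed box minus a ball;
  that set is empty when \<open>\<eta>\<close> is large.\<close>

lemma one_sub_cos_separates:
  fixes \<eta> :: real
  assumes "0 < \<eta>"
  obtains \<delta> where "0 < \<delta>" "\<And>x :: real ^ 'n::finite. x \<in> torus_box \<Longrightarrow> one_sub_cos x < \<delta> \<Longrightarrow> norm x < \<eta>"
proof -
  let ?S = "cbox (\<chi> i. - pi) (\<chi> i. pi) - ball 0 \<eta> :: (real ^ 'n) set"
  have pos: "0 < one_sub_cos x" if x: "x \<in> ?S" for x
  proof -
    have "x \<noteq> 0" using x assms by auto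
    then obtain i where i: "x $ i \<noteq> 0" by (auto simp: vec_eq_iff)
    have b: "- pi \<le> x $ i" "x $ i \<le> pi" using x by (auto simp: mem_box_cart)
    have "cos (x $ i) < 1"
    proof -
      have "cos \<bar>x $ i\<bar> < cos 0" using i b by (intro cos_monotone_0_pi) auto
      then show ?thesis by simp
    qed
    then show ?thesis unfolding one_sub_cos_def
      by (intro sum_pos2[of _ i]) auto
  qed
  show thesis
  proof (cases "?S = {}")
    case True
    have "norm x < \<eta>" if "x \<in> torus_box" for x :: "real ^ 'n"
    proof -
      have "x \<in> cbox (\<chi> i. - pi) (\<chi> i. pi)" using that by (auto simp: torus_box_def mem_box_cart less_imp_le)
      then show ?thesis using True by auto
    qed
    then show thesis using that[of 1] by simp
  next
    case False
    have "compact ?S" by (rule compact_diff[OF compact_cbox open_ball])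
    from continuous_attains_inf[OF this False one_sub_cos_continuous] obtain x0 where x0: "x0 \<in> ?S" "\<And>x. x \<in> ?S \<Longrightarrow> one_sub_cos x0 \<le> one_sub_cos x"
      by metis
    have "norm x < \<eta>" if "x \<in> torus_box" "one_sub_cos x < one_sub_cos x0" for x :: "real ^ 'n"
    proof -
      have "x \<in> cbox (\<chi> i. - pi) (\<chi> i. pi)" using that by (auto simp: torus_box_def mem_box_cart less_imp_le)
      then show ?thesis using x0(2)[of x] that by force
    qed
    then show thesis using that[of "one_sub_cos x0"] pos[OF x0(1)] by blast
  qed
qed

text \<open>All integrals of \<open>g\<close> against powers of the peak kernel \<open>Q\<close>
  vanish. If \<open>g 0\<close> were not 0, the mass of \<open>Q ^ N\<close> near the origin would
  have to be balanced by its mass elsewhere; but the former is at least of order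
  \<open>q' ^ N\<close> and the latter at most of order \<open>q ^ N\<close> with
  \<open>q < q'\<close>.\<close>

lemma fourier_uniqueness_at_0:
  fixes g :: "real ^ 'n::finite \<Rightarrow> complex"
  assumes cont: "continuous_on UNIV g" and per: "periodic g"
    and zero: "\<And>k. (LINT x|box_measure. g x * echar k x) = 0"
  shows "g 0 = 0"
proof (rule ccontr)
  assume g0: "g 0 \<noteq> 0"
  define n where "n = real CARD('n)"
  have n: "n > 0" by (simp add: n_def)
  \<comment> \<open>Since \<open>one_sub_cos\<close> is at most \<open>2 * n\<close>, this lies
    between 0 and 1.\<close>
  define Q where "Q = (\<lambda>x :: real ^ 'n. 1 - one_sub_cos x / (2 * n))"
  have Qc: "continuous_on UNIV Q" unfolding Q_def using n by (intro continuous_intros) auto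
  have Qp: "periodic Q" by (simp add: Q_def periodic_def periodicD[OF one_sub_cos_periodic])
  have Q0: "0 \<le> Q x" for x
  proof -
    have "one_sub_cos x \<le> (\<Sum>i\<in>(UNIV :: 'n set). 2)"
      unfolding one_sub_cos_def by (intro sum_mono) (smt (verit) cos_ge_minus_one)
    then show ?thesis using n by (simp add: Q_def n_def field_simps)
  qed
  have Q1: "Q x \<le> 1" for x using one_sub_cos_nonneg[of x] n by (simp add: Q_def)
  \<comment> \<open>Each further factor \<open>Q\<close> is a combination of 1 and the characters of
    frequencies plus and minus \<open>axis i 1\<close>, which shift \<open>k\<close>; hence the
    induction is over all \<open>k\<close> at once.\<close>
  have zeroQ: "(LINT x|box_measure. g x * of_real (Q x) ^ N * echar k x) = 0" for N k
  proof (induction N arbitrary: k)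
    case 0 then show ?case using zero by simp
  next
    case (Suc N)
    let ?G = "\<lambda>x. g x * of_real (Q x) ^ N"
    have Gc: "continuous_on UNIV (\<lambda>x. ?G x * echar k x)" for k by (intro continuous_intros cont Qc)
    have Gp: "periodic (\<lambda>x. ?G x * echar k x)" for k
      using per Qp echar_periodic[of k] by (simp add: periodic_def)
    have Gi: "integrable box_measure (\<lambda>x. ?G x * echar k x)" for k
      by (rule integrable_box_periodic[OF Gc Gp])
    have cosE: "of_real (cos (x $ i)) = (echar (axis i 1) x + echar (axis i (-1)) x) / 2" for x :: "real ^ 'n" and i
    proof -
      have "freq (axis i 1) = axis i 1" "freq (axis i (-1)) = - axis i 1"
        by (auto simp: vec_eq_iff axis_def)
      then show ?thesis
        by (simp add: echar_def inner_axis' cos_exp_eq cos_of_real[symmetric] del: cos_of_real)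
    qed
    have expand: "?G x * of_real (Q x) * echar k x
       = ?G x * echar k x - (\<Sum>i\<in>UNIV. ?G x * echar k x
           - (?G x * echar (axis i 1 + k) x + ?G x * echar (axis i (-1) + k) x) / 2) / (2 * of_real n)" for x
    proof -
      have "?G x * echar k x - (?G x * echar (axis i 1 + k) x + ?G x * echar (axis i (-1) + k) x) / 2
        = ?G x * echar k x * of_real (1 - cos (x $ i))" for i
        by (simp add: echar_plus cosE algebra_simps add_divide_distrib)
      then have "(\<Sum>i\<in>UNIV. ?G x * echar k x - (?G x * echar (axis i 1 + k) x + ?G x * echar (axis i (-1) + k) x) / 2)
        = ?G x * echar k x * of_real (one_sub_cos x)"
        by (simp only: one_sub_cos_def of_real_sum sum_distrib_left)
      moreover have "c * of_real (Q x) = c - c * of_real (one_sub_cos x) / (2 * of_real n)" for c :: complex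
        by (simp add: Q_def algebra_simps)
      from this[of "?G x * echar k x"]
      have "?G x * of_real (Q x) * echar k x = ?G x * echar k x - ?G x * echar k x * of_real (one_sub_cos x) / (2 * of_real n)"
        by (simp only: mult_ac)
      ultimately show ?thesis by (simp only:)
    qed
    have "(LINT x|box_measure. g x * of_real (Q x) ^ Suc N * echar k x)
       = (LINT x|box_measure. ?G x * of_real (Q x) * echar k x)"
      by (simp add: mult_ac)
    also have "\<dots> = 0"
      unfolding expand using Gi Suc.IH by (simp add: Bochner_Integration.integral_sum)
    finally show ?case .
  qed
  define e where "e = norm (g 0) / 2"
  have e: "0 < e" using g0 by (simp add: e_def)
  obtain M where M: "\<And>x. norm (g x) \<le> M" "0 \<le> M" using periodic_bounded[OF cont per] by metis
  obtain \<eta> where \<eta>: "0 < \<eta>" "\<And>x. norm x < \<eta> \<Longrightarrow> norm (g x - g 0) < e"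
    using cont e by (auto simp: continuous_on_iff dist_norm) (metis UNIV_I diff_zero)
  obtain \<delta>0 where \<delta>0: "0 < \<delta>0" "\<And>x :: real ^ 'n. x \<in> torus_box \<Longrightarrow> one_sub_cos x < \<delta>0 \<Longrightarrow> norm x < \<eta>"
    using one_sub_cos_separates[OF \<eta>(1)] by metis
  \<comment> \<open>The minimum with \<open>n\<close> keeps \<open>q\<close> at least
    \<open>1 / 2\<close>.\<close>
  define \<delta> where "\<delta> = min \<delta>0 n"
  have \<delta>: "0 < \<delta>" "\<delta> \<le> n" "\<And>x :: real ^ 'n. x \<in> torus_box \<Longrightarrow> one_sub_cos x < \<delta> \<Longrightarrow> norm x < \<eta>"
    using \<delta>0 n by (auto simp: \<delta>_def)
  define q where "q = 1 - \<delta> / (2 * n)"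
  \<comment> \<open>\<open>q\<close> bounds \<open>Q\<close> from above where
    \<open>one_sub_cos\<close> is at least \<open>\<delta>\<close>, and \<open>q'\<close> bounds it
    from below where \<open>one_sub_cos\<close> is less than \<open>\<delta> / 2\<close>; the gap
    between the two levels decides the limit.\<close>
  define q' where "q' = 1 - \<delta> / (4 * n)"
  have q: "0 < q" "q < q'" using \<delta> n by (simp_all add: q_def q'_def field_simps)
  define V where "V = (2 * pi) ^ CARD('n)"
  define K where "K = M + norm (g 0)"
  have upper: "e * (LINT x|box_measure. Q x ^ N) \<le> K * V * q ^ N" for N
  proof -
    have QNi: "integrable box_measure (\<lambda>x. Q x ^ N)"
      using Qp by (intro integrable_box_periodic continuous_intros Qc) (simp add: periodic_def)
    have gi: "integrable box_measure (\<lambda>x. g x * of_real (Q x ^ N))"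
      using Qp per by (intro integrable_box_periodic continuous_intros Qc cont) (simp add: periodic_def)
    have gz: "(LINT x|box_measure. g x * of_real (Q x ^ N)) = 0" using zeroQ[of N 0] by simp
    have "norm (g 0) * (LINT x|box_measure. Q x ^ N) = norm (g 0 * of_real (LINT x|box_measure. Q x ^ N))"
      using Q0 by (simp add: norm_mult integral_nonneg_AE)
    also have "g 0 * of_real (LINT x|box_measure. Q x ^ N) = (LINT x|box_measure. (g 0 - g x) * of_real (Q x ^ N))"
    proof -
      have "(LINT x|box_measure. (g 0 - g x) * of_real (Q x ^ N))
        = (LINT x|box_measure. g 0 * of_real (Q x ^ N)) - (LINT x|box_measure. g x * of_real (Q x ^ N))"
        unfolding left_diff_distrib using QNi gi by (intro Bochner_Integration.integral_diff integrable_mult_right integrable_of_real)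
      also have "(LINT x|box_measure. g 0 * of_real (Q x ^ N)) = g 0 * of_real (LINT x|box_measure. Q x ^ N)"
        by (subst integral_mult_right_zero) (subst integral_complex_of_real, rule refl)
      finally show ?thesis using gz by simp
    qed
    also have "norm \<dots> \<le> (LINT x|box_measure. norm ((g 0 - g x) * of_real (Q x ^ N)))"
      by (rule integral_norm_bound)
    also have "\<dots> \<le> (LINT x|(box_measure :: (real ^ 'n) measure). e * Q x ^ N + K * q ^ N)"
    proof (rule integral_mono)
      show "integrable box_measure (\<lambda>x. norm ((g 0 - g x) * of_real (Q x ^ N)))"
        using Qp per by (intro integrable_norm integrable_box_periodic continuous_intros Qc cont) (simp add: periodic_def)
      show "integrable box_measure (\<lambda>x. e * Q x ^ N + K * q ^ N)" using QNi by simp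
      fix x :: "real ^ 'n" assume x: "x \<in> space box_measure"
      have eq: "norm ((g 0 - g x) * of_real (Q x ^ N)) = norm (g x - g 0) * Q x ^ N"
        using Q0[of x] by (simp add: norm_mult norm_power norm_minus_commute)
      have K0: "0 \<le> K" using M by (simp add: K_def)
      show "norm ((g 0 - g x) * of_real (Q x ^ N)) \<le> e * Q x ^ N + K * q ^ N"
      proof (cases "one_sub_cos x < \<delta>")
        case True
        then have "norm (g x - g 0) \<le> e" using \<eta>(2)[of x] \<delta>(3)[of x] x by simp
        then have "norm (g x - g 0) * Q x ^ N \<le> e * Q x ^ N" using Q0[of x] by (intro mult_right_mono) auto
        moreover have "0 \<le> K * q ^ N" using K0 q by simp
        ultimately show ?thesis unfolding eq by linarith
      next
        case False
        then have "Q x \<le> q" using n by (simp add: Q_def q_def divide_right_mono)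
        moreover have "norm (g x - g 0) \<le> K"
          unfolding K_def using norm_triangle_ineq4[of "g x" "g 0"] M(1)[of x] by linarith
        ultimately have "norm (g x - g 0) * Q x ^ N \<le> K * q ^ N"
          using K0 Q0[of x] by (intro mult_mono power_mono) auto
        moreover have "0 \<le> e * Q x ^ N" using e Q0[of x] by simp
        ultimately show ?thesis unfolding eq by linarith
      qed
    qed
    also have "\<dots> = e * (LINT x|box_measure. Q x ^ N) + K * V * q ^ N"
      using QNi by (simp add: measure_box_measure V_def)
    finally have "(norm (g 0) - e) * (LINT x|box_measure. Q x ^ N) \<le> K * V * q ^ N" by (simp add: left_diff_distrib)
    then show ?thesis by (simp add: e_def)
  qed
  have "open (one_sub_cos -` {..< \<delta> / 2} \<inter> box (\<chi> i. - pi) (\<chi> i. pi) :: (real ^ 'n) set)"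
    by (intro open_Int open_vimage one_sub_cos_continuous) auto
  moreover have "0 \<in> (one_sub_cos -` {..< \<delta> / 2} \<inter> box (\<chi> i. - pi) (\<chi> i. pi) :: (real ^ 'n) set)"
    using \<delta> by (simp add: mem_box_cart)
  ultimately obtain \<epsilon> where \<epsilon>: "0 < \<epsilon>" "ball 0 \<epsilon> \<subseteq> (one_sub_cos -` {..< \<delta> / 2} \<inter> box (\<chi> i. - pi) (\<chi> i. pi) :: (real ^ 'n) set)"
    by (metis open_contains_ball)
  have \<epsilon>box: "ball 0 \<epsilon> \<subseteq> (torus_box :: (real ^ 'n) set)"
    using \<epsilon>(2) by (force simp: torus_box_def mem_box_cart subset_iff less_imp_le)
  define \<mu> where "\<mu> = measure lborel (ball 0 \<epsilon> :: (real ^ 'n) set)"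
  have \<mu>: "0 < \<mu>" unfolding \<mu>_def by (rule content_ball_pos[OF \<epsilon>(1)])
  have lower: "\<mu> * q' ^ N \<le> (LINT x|box_measure. Q x ^ N)" for N
  proof -
    have [measurable]: "(ball 0 \<epsilon> :: (real ^ 'n) set) \<in> sets borel" by simp
    have "\<mu> = measure box_measure (ball 0 \<epsilon> :: (real ^ 'n) set)"
      unfolding \<mu>_def box_measure_def by (subst measure_restrict_space) (use \<epsilon>box in auto)
    then have "\<mu> * q' ^ N = (LINT x|(box_measure :: (real ^ 'n) measure). indicator (ball 0 \<epsilon>) x * q' ^ N)"
      using \<epsilon>box by (simp add: Int_absorb2)
    also have "\<dots> \<le> (LINT x|box_measure. Q x ^ N)"
    proof (rule integral_mono)
      show "integrable box_measure (\<lambda>x. Q x ^ N)"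
        using Qp by (intro integrable_box_periodic continuous_intros Qc) (simp add: periodic_def)
      show "integrable box_measure (\<lambda>x :: real ^ 'n. indicator (ball 0 \<epsilon>) x * q' ^ N)"
        by (intro box_measure.integrable_const_bound[of _ "\<bar>q' ^ N\<bar>"]) (auto simp: indicator_def)
      fix x :: "real ^ 'n"
      show "indicator (ball 0 \<epsilon>) x * q' ^ N \<le> Q x ^ N"
      proof (cases "x \<in> ball 0 \<epsilon>")
        case True
        then have "one_sub_cos x < \<delta> / 2" using \<epsilon>(2) by auto
        then have "q' \<le> Q x" using n by (simp add: Q_def q'_def field_simps)
        then show ?thesis using True q by (simp add: power_mono)
      next
        case False then show ?thesis using Q0[of x] by simp
      qed
    qed
    finally show ?thesis .
  qed
  have "e * \<mu> \<le> K * V * (q / q') ^ N" for N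
  proof -
    have "e * (\<mu> * q' ^ N) \<le> K * V * q ^ N"
      using upper[of N] lower[of N] e by (meson mult_left_mono less_imp_le order_trans)
    then show ?thesis using q by (simp add: power_divide field_simps)
  qed
  moreover have "(\<lambda>N. K * V * (q / q') ^ N) \<longlonglongrightarrow> K * V * 0"
    using q by (intro tendsto_intros LIMSEQ_power_zero) auto
  ultimately have "e * \<mu> \<le> K * V * 0"
    by (intro LIMSEQ_le_const) auto
  then show False using mult_pos_pos[OF e \<mu>] by simp
qed

lemma fourier_uniqueness:
  fixes g :: "real ^ 'n::finite \<Rightarrow> complex"
  assumes cont: "continuous_on UNIV g" and per: "periodic g"
    and zero: "\<And>k. (LINT x|box_measure. g x * echar k x) = 0"
  shows "g z = 0"
proof -
  have "(LINT x|box_measure. g (x + z) * echar k x) = 0" for k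
  proof -
    have p: "periodic (\<lambda>x. g x * echar k x)" using per echar_periodic[of k] by (simp add: periodic_def)
    have [measurable]: "g \<in> borel_measurable borel" using cont by blast
    have "g (x + z) * echar k x = echar (- k) z * (g (x + z) * echar k (x + z))" for x
      by (simp add: echar_add mult.left_commute)
    then have "(LINT x|box_measure. g (x + z) * echar k x)
       = echar (- k) z * (LINT x|box_measure. g (x + z) * echar k (x + z))"
      by (simp only: integral_mult_right_zero)
    also have "(LINT x|box_measure. g (x + z) * echar k (x + z)) = (LINT x|box_measure. g x * echar k x)"
      by (rule integral_box_translate(1)[OF _ p]) measurable
    finally show ?thesis using zero by simp
  qed
  moreover have "continuous_on UNIV (\<lambda>x. g (x + z))"
    by (intro continuous_on_compose2[OF cont] continuous_intros) auto
  ultimately have "g (0 + z) = 0"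
    using fourier_uniqueness_at_0[of "\<lambda>x. g (x + z)"] periodic_translate[OF per] by blast
  then show ?thesis by simp
qed

section \<open>Absolutely convergent Fourier series\<close>

lemma fourier_series_continuous:
  fixes a :: "int ^ 'n::finite \<Rightarrow> complex"
  assumes "(\<lambda>k. norm (a k)) summable_on UNIV"
  shows "continuous_on UNIV (\<lambda>x. \<Sum>\<^sub>\<infinity>k. a k * echar (- k) x)"
proof (rule uniform_limit_theorem)
  show "uniform_limit UNIV (\<lambda>X y. \<Sum>k\<in>X. a k * echar (- k) y) (\<lambda>x. \<Sum>\<^sub>\<infinity>k. a k * echar (- k) x) (finite_subsets_at_top UNIV)"
    by (rule Weierstrass_m_test_general[OF _ assms]) (simp add: norm_mult)
  show "\<forall>\<^sub>F X in finite_subsets_at_top UNIV. continuous_on UNIV (\<lambda>y. \<Sum>k\<in>X. a k * echar (- k) y)"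
    by (intro always_eventually allI continuous_intros)
qed simp

text \<open>Coefficients are taken against \<open>echar k\<close>, hence the series run over
  \<open>echar (- k)\<close>: the opposite sign convention to that of
  \<open>fourier_coeff\<close>.\<close>

lemma fourier_series_coeff:
  fixes a :: "int ^ 'n::finite \<Rightarrow> complex"
  assumes a: "(\<lambda>k. norm (a k)) summable_on UNIV"
  shows "(LINT x|box_measure. (\<Sum>\<^sub>\<infinity>k. a k * echar (- k) x) * echar j x) = a j * (2 * pi) ^ CARD('n)"
proof -
  have i: "integrable box_measure (\<lambda>x. a k * echar (- k) x * echar j x)" for k
    using echar_periodic[of "- k"] echar_periodic[of j]
    by (intro integrable_box_periodic continuous_intros) (simp add: periodic_def)
  have coef: "(LINT x|box_measure. a k * echar (- k) x * echar j x) = (if k = j then a j * (2 * pi) ^ CARD('n) else 0)" for k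
  proof -
    have "(LINT x|box_measure. a k * echar (- k) x * echar j x) = a k * (LINT x|box_measure. echar (j - k) x)"
      using echar_plus[of "- k" j] by (simp add: mult.assoc)
    then show ?thesis by (simp add: integral_echar)
  qed
  have "(LINT x|box_measure. (\<Sum>\<^sub>\<infinity>k. a k * echar (- k) x * echar j x))
    = (\<Sum>\<^sub>\<infinity>k. LINT x|box_measure. a k * echar (- k) x * echar j x)"
    using a i by (intro has_bochner_integral_integral_eq has_bochner_integral_infsum infinite_UNIV_int_vec)
      (auto simp: norm_mult measure_box_measure intro!: summable_on_cmult_right)
  also have "\<dots> = (\<Sum>\<^sub>\<infinity>k. if k = j then a j * (2 * pi) ^ CARD('n) else 0)"
    by (simp only: coef)
  also have "(\<Sum>\<^sub>\<infinity>k. if k = j then a j * (2 * pi) ^ CARD('n) else 0) = a j * (2 * pi) ^ CARD('n)"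
  proof -
    have "(\<Sum>\<^sub>\<infinity>k. if k = j then a j * (2 * pi) ^ CARD('n) else 0)
       = (\<Sum>\<^sub>\<infinity>k\<in>{j}. if k = j then a j * (2 * pi) ^ CARD('n) else 0)"
      by (rule infsum_cong_neutral) auto
    then show ?thesis by simp
  qed
  finally have "(LINT x|box_measure. (\<Sum>\<^sub>\<infinity>k. a k * echar (- k) x * echar j x)) = a j * (2 * pi) ^ CARD('n)" .
  then show ?thesis by (subst infsum_cmult_left'[symmetric]) 
qed

text \<open>The series converges to a continuous periodic function with the same coefficients as
  \<open>g\<close>, so uniqueness applies to the difference.\<close>

lemma fourier_inversion:
  fixes g :: "real ^ 'n::finite \<Rightarrow> complex"
  assumes cont: "continuous_on UNIV g" and per: "periodic g"
    and sum: "(\<lambda>k. norm (LINT x|box_measure. g x * echar k x)) summable_on UNIV"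
  shows "g z = (\<Sum>\<^sub>\<infinity>k. (LINT x|box_measure. g x * echar k x) / (2 * pi) ^ CARD('n) * echar (- k) z)"
proof -
  define a where "a = (\<lambda>k. (LINT x|box_measure. g x * echar k x) / (2 * pi) ^ CARD('n))"
  have a: "(\<lambda>k. norm (a k)) summable_on UNIV"
  proof -
    have "norm (a k) = norm (LINT x|box_measure. g x * echar k x) * inverse ((2 * pi) ^ CARD('n))" for k
      by (simp add: a_def norm_divide norm_power norm_mult norm_inverse divide_inverse)
    then show ?thesis using summable_on_cmult_left[OF sum] by simp
  qed
  define h where "h = (\<lambda>x. \<Sum>\<^sub>\<infinity>k. a k * echar (- k) x)"
  have hc: "continuous_on UNIV h" unfolding h_def by (rule fourier_series_continuous[OF a])
  have hp: "periodic h" unfolding h_def periodic_def by (simp add: periodicD[OF echar_periodic])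
  have i: "integrable box_measure (\<lambda>x. f x * echar k x)" if "continuous_on UNIV f" "periodic f" for f k
    using that echar_periodic[of k] by (intro integrable_box_periodic continuous_intros) (simp_all add: periodic_def)
  have "g z - h z = 0"
  proof (rule fourier_uniqueness[of "\<lambda>x. g x - h x"])
    show "continuous_on UNIV (\<lambda>x. g x - h x)" by (intro continuous_intros cont hc)
    show "periodic (\<lambda>x. g x - h x)" using per hp by (simp add: periodic_def)
    fix k
    have "(LINT x|box_measure. h x * echar k x) = (LINT x|box_measure. g x * echar k x)"
      unfolding h_def fourier_series_coeff[OF a] by (simp add: a_def)
    then show "(LINT x|box_measure. (g x - h x) * echar k x) = 0"
      using i[OF cont per, of k] i[OF hc hp, of k] by (simp add: left_diff_distrib)
  qed
  then show ?thesis by (simp add: h_def a_def)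
qed


subsection \<open>The fractional Laplacian through ball averages\<close>

text \<open>\<open>undefined\<close> stands for some fixed index; by rotation invariance every unit
  vector gives the same \<open>radial_mult\<close>.\<close>

definition unit_axis :: "real ^ 'n::finite" where
  "unit_axis = axis undefined 1"

text \<open>The Fourier transform of the indicator of the unit ball, as a function of the length of
  the frequency.\<close>

definition radial_mult :: "'n::finite itself \<Rightarrow> real \<Rightarrow> real" where
  "radial_mult _ t = (LINT y|(ball_measure :: (real ^ 'n) measure). cos (t * (unit_axis \<bullet> y)))"

abbreviation radial_defect :: "'n::finite itself \<Rightarrow> real \<Rightarrow> real" where
  "radial_defect T t \<equiv> ball_vol T - radial_mult T t"

text \<open>A rotation takes \<open>\<xi>\<close> to a multiple of \<open>unit_axis\<close>, and
  averaging over \<open>y\<close> and \<open>- y\<close> removes the sine.\<close>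

lemma integral_ball_exp:
  fixes \<xi> :: "real ^ 'n::finite"
  shows "(LINT y|ball_measure. exp (\<i> * complex_of_real (\<xi> \<bullet> y))) = complex_of_real (radial_mult TYPE('n) (norm \<xi>))"
proof -
  define h where "h = (\<lambda>y :: real ^ 'n. exp (\<i> * complex_of_real (norm \<xi> * (unit_axis \<bullet> y))))"
  have hc: "continuous_on UNIV h" unfolding h_def by (intro continuous_intros)
  then have [measurable]: "h \<in> borel_measurable borel" by blast
  have hi: "integrable ball_measure h" "integrable ball_measure (\<lambda>y. h (- y))"
    using integrable_ball_continuous[OF hc, of 0 1] integrable_ball_continuous[OF hc, of 0 "- 1"] by simp_all
  have nn: "norm \<xi> = norm (norm \<xi> *\<^sub>R (unit_axis :: real ^ 'n))" by (simp add: unit_axis_def)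
  have "\<exists>T :: real ^ 'n \<Rightarrow> real ^ 'n. orthogonal_transformation T \<and> T \<xi> = norm \<xi> *\<^sub>R unit_axis"
    by (rule orthogonal_transformation_exists[OF nn]) (intro exI conjI)
  then obtain T :: "real ^ 'n \<Rightarrow> real ^ 'n" where T: "orthogonal_transformation T" "T \<xi> = norm \<xi> *\<^sub>R unit_axis" by blast
  have "\<xi> \<bullet> y = norm \<xi> * (unit_axis \<bullet> T y)" for y
  proof -
    have "\<xi> \<bullet> y = T \<xi> \<bullet> T y" using T(1) by (simp add: orthogonal_transformation_def)
    then show ?thesis by (simp add: T(2))
  qed
  then have "(LINT y|ball_measure. exp (\<i> * complex_of_real (\<xi> \<bullet> y))) = (LINT y|ball_measure. h (T y))"
    by (simp add: h_def)
  also have "\<dots> = (LINT y|ball_measure. h y)"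
    by (rule integral_ball_orthogonal[OF T(1)]) simp
  also have "\<dots> = ((LINT y|ball_measure. h y) + (LINT y|ball_measure. h (- y))) / 2"
    using integral_ball_orthogonal[of uminus h]
    by (simp add: orthogonal_transformation_def linear_uminus)
  also have "\<dots> = (LINT y|ball_measure. (h y + h (- y)) / 2)"
    using hi by simp
  also have "\<dots> = (LINT y|(ball_measure :: (real ^ 'n) measure). complex_of_real (cos (norm \<xi> * (unit_axis \<bullet> y))))"
    by (simp add: h_def cos_exp_eq cos_of_real[symmetric] del: cos_of_real)
  finally show ?thesis by (simp add: radial_mult_def integral_complex_of_real)
qed

text \<open>The quadratic bound gives integrability against the weight at 0, the constant one at
  infinity; the sign turns absolute values into plain integrals in
  \<open>balanced_fourier_series\<close>.\<close>

lemma radial_defect_bounds: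
  "0 \<le> radial_defect TYPE('n::finite) t"
  "radial_defect TYPE('n) t \<le> ball_vol TYPE('n) * 2"
  "radial_defect TYPE('n) t \<le> ball_vol TYPE('n) * (t\<^sup>2 / 2)"
proof -
  have c: "continuous_on UNIV (\<lambda>y :: real ^ 'n. 1 - cos (t * (unit_axis \<bullet> y)))" by (intro continuous_intros)
  have c': "continuous_on UNIV (\<lambda>y :: real ^ 'n. cos (t * (unit_axis \<bullet> y)))" by (intro continuous_intros)
  have i: "integrable ball_measure (\<lambda>y :: real ^ 'n. 1 - cos (t * (unit_axis \<bullet> y)))"
    "integrable ball_measure (\<lambda>y :: real ^ 'n. cos (t * (unit_axis \<bullet> y)))"
    using integrable_ball_continuous[OF c, of 0 1] integrable_ball_continuous[OF c', of 0 1] by simp_all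
  have eq: "radial_defect TYPE('n) t = (LINT y|(ball_measure :: (real ^ 'n) measure). 1 - cos (t * (unit_axis \<bullet> y)))"
    using i by (simp add: radial_mult_def measure_ball_measure)
  show "0 \<le> radial_defect TYPE('n) t"
    unfolding eq by (intro integral_nonneg_AE AE_I2) simp
  have "(LINT y|(ball_measure :: (real ^ 'n) measure). 1 - cos (t * (unit_axis \<bullet> y))) \<le> (LINT y|(ball_measure :: (real ^ 'n) measure). 2)"
  proof (intro integral_mono i)
    fix y :: "real ^ 'n"
    show "1 - cos (t * (unit_axis \<bullet> y)) \<le> 2" using cos_ge_minus_one[of "t * (unit_axis \<bullet> y)"] by linarith
  qed simp
  then show "radial_defect TYPE('n) t \<le> ball_vol TYPE('n) * 2"
    unfolding eq by (simp add: measure_ball_measure)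
  have "(LINT y|(ball_measure :: (real ^ 'n) measure). 1 - cos (t * (unit_axis \<bullet> y))) \<le> (LINT y|(ball_measure :: (real ^ 'n) measure). t\<^sup>2 / 2)"
  proof (intro integral_mono i)
    fix y :: "real ^ 'n" assume "y \<in> space ball_measure"
    then have "norm y < 1" by simp
    have "\<bar>unit_axis \<bullet> y\<bar> \<le> norm (unit_axis :: real ^ 'n) * norm y" by (rule Cauchy_Schwarz_ineq2)
    also have "\<dots> \<le> 1" using \<open>norm y < 1\<close> by (simp add: unit_axis_def)
    finally have y: "(unit_axis \<bullet> y)\<^sup>2 \<le> 1" by (simp add: abs_square_le_1)
    define \<theta> where "\<theta> = t * (unit_axis \<bullet> y)"
    have "1 - cos \<theta> = 2 * (sin (\<theta> / 2))\<^sup>2" using cos_double_sin[of "\<theta> / 2"] by simp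
    also have "(sin (\<theta> / 2))\<^sup>2 \<le> (\<theta> / 2)\<^sup>2" using abs_sin_x_le_abs_x[of "\<theta> / 2"] by (simp only: abs_le_square_iff)
    also have "2 * (\<theta> / 2)\<^sup>2 = t\<^sup>2 * (unit_axis \<bullet> y)\<^sup>2 / 2" by (simp add: \<theta>_def power2_eq_square)
    also have "\<dots> \<le> t\<^sup>2 * 1 / 2" using y by (intro divide_right_mono mult_left_mono) auto
    finally show "1 - cos (t * (unit_axis \<bullet> y)) \<le> t\<^sup>2 / 2" by (simp add: \<theta>_def)
  qed simp
  then show "radial_defect TYPE('n) t \<le> ball_vol TYPE('n) * (t\<^sup>2 / 2)"
    unfolding eq by (simp add: measure_ball_measure)
qed

lemma radial_mult_continuous: "continuous_on UNIV (radial_mult TYPE('n::finite))"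
proof -
  have "(\<lambda>j. radial_mult TYPE('n) (X j)) \<longlonglongrightarrow> radial_mult TYPE('n) t" if "X \<longlonglongrightarrow> t" for X t
    unfolding radial_mult_def
  proof (rule integral_dominated_convergence[where w = "\<lambda>_. 1"])
    have [measurable]: "(\<lambda>y :: real ^ 'n. cos (t * (unit_axis \<bullet> y))) \<in> borel_measurable borel" for t
      by (intro continuous_borel continuous_intros)
    show "(\<lambda>y :: real ^ 'n. cos (t * (unit_axis \<bullet> y))) \<in> borel_measurable ball_measure"
      "\<And>j. (\<lambda>y :: real ^ 'n. cos (X j * (unit_axis \<bullet> y))) \<in> borel_measurable ball_measure"
      by measurable
    show "AE y :: real ^ 'n in ball_measure. (\<lambda>j. cos (X j * (unit_axis \<bullet> y))) \<longlonglongrightarrow> cos (t * (unit_axis \<bullet> y))"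
      using that by (intro AE_I2 tendsto_intros)
  qed auto
  then show ?thesis by (auto simp: continuous_on_sequentially o_def)
qed

text \<open>The factor between the balance integral of a character and the power of its
  frequency.\<close>

definition radial_const :: "'n::finite itself \<Rightarrow> real \<Rightarrow> real" where
  "radial_const _ \<sigma> = (LINT s|half_line. radial_defect TYPE('n) s * s powr (- 1 - 2 * \<sigma>))"

lemma has_bochner_integral_half_line:
  fixes f :: "real \<Rightarrow> 'b::{banach, second_countable_topology}"
  shows "has_bochner_integral half_line f I \<longleftrightarrow> has_bochner_integral lborel (\<lambda>s. indicator {0<..} s *\<^sub>R f s) I"
  unfolding half_line_def by (rule has_bochner_integral_restrict_space) simp

text \<open>The weight is homogeneous, so substituting \<open>s * \<kappa>\<close> pulls out
  \<open>\<kappa> powr (2 * \<sigma>)\<close>. This is how the symbol of the fractional Laplacian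
  arises from ball averages.\<close>

lemma radial_defect_integral:
  assumes \<sigma>: "0 < \<sigma>" "\<sigma> < 1" and \<kappa>: "0 \<le> \<kappa>"
  shows "has_bochner_integral half_line (\<lambda>s. radial_defect TYPE('n::finite) (s * \<kappa>) * s powr (- 1 - 2 * \<sigma>))
    (radial_const TYPE('n) \<sigma> * \<kappa> powr (2 * \<sigma>))"
proof -
  define f where "f = (\<lambda>s. indicator {0<..} s *\<^sub>R (radial_defect TYPE('n) s * s powr (- 1 - 2 * \<sigma>)))"
  have [measurable]: "radial_mult TYPE('n) \<in> borel_measurable borel"
    by (intro continuous_borel radial_mult_continuous)
  have fm [measurable]: "f \<in> borel_measurable borel" unfolding f_def by measurable
  let ?\<omega> = "ball_vol TYPE('n)"
  have "integrable lborel f"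
  proof -
    define H where "H = (\<lambda>s::real. if s < 1 then ?\<omega> / 2 * s powr (1 - 2 * \<sigma>) else ?\<omega> * 2 * s powr (- 1 - 2 * \<sigma>))"
    define H' where "H' = (\<lambda>s. if s \<in> {0..} then H s else 0)"
    have \<omega>: "0 \<le> ?\<omega>" by simp
    obtain I where "(H has_integral I) {0..}"
      using split_powr_has_integral[OF \<sigma>, of 1] unfolding H_def by fastforce
    then have "(H' has_integral I) UNIV" unfolding H'_def by (simp only: has_integral_restrict_UNIV)
    moreover have H0: "0 \<le> H' s" for s using \<omega> by (auto simp: H'_def H_def)
    moreover have [measurable]: "H' \<in> borel_measurable borel" unfolding H'_def H_def by measurable
    ultimately have "(\<integral>\<^sup>+ s. H' s \<partial>lborel) = I"
      by (intro nn_integral_has_integral_lborel)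
    then have "integrable lborel H'"
      using H0 by (intro integrableI_nonneg) auto
    then show ?thesis
    proof (rule Bochner_Integration.integrable_bound)
      show "AE s in lborel. norm (f s) \<le> norm (H' s)"
      proof (intro AE_I2)
        fix s :: real
        show "norm (f s) \<le> norm (H' s)"
        proof (cases "s > 0")
          case True
          have e: "s powr (1 - 2 * \<sigma>) = s\<^sup>2 * s powr (- 1 - 2 * \<sigma>)"
            using powr_add_two[OF True, of "- 1 - 2 * \<sigma>"] by simp
          have "radial_defect TYPE('n) s * s powr (- 1 - 2 * \<sigma>) \<le> H s"
            using mult_right_mono[OF radial_defect_bounds(2)[of s, where 'n = 'n], of "s powr (- 1 - 2 * \<sigma>)"]
              mult_right_mono[OF radial_defect_bounds(3)[of s, where 'n = 'n], of "s powr (- 1 - 2 * \<sigma>)"]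
            by (auto simp: H_def e)
          then show ?thesis using True radial_defect_bounds(1)[of s, where 'n = 'n] H0[of s]
            by (simp add: f_def H'_def abs_mult)
        qed (simp add: f_def)
      qed
    qed measurable
  qed
  moreover have "integral\<^sup>L lborel f = radial_const TYPE('n) \<sigma>"
    unfolding radial_const_def f_def half_line_def by (subst integral_restrict_space) auto
  ultimately have f: "has_bochner_integral lborel f (radial_const TYPE('n) \<sigma>)"
    by (simp add: has_bochner_integral_iff)
  show ?thesis
  proof (cases "\<kappa> = 0")
    \<comment> \<open>Frequency 0 cannot be rescaled; there the defect vanishes, and so does
      \<open>0 powr (2 * \<sigma>)\<close>.\<close>
    case True
    have "radial_mult TYPE('n) 0 = ?\<omega>" by (simp add: radial_mult_def measure_ball_measure)
    then show ?thesis using True by (simp add: has_bochner_integral_zero)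
  next
    case False
    then have \<kappa>: "0 < \<kappa>" using \<kappa> by simp
    have "has_bochner_integral lborel (\<lambda>s. f (0 + \<kappa> * s)) (radial_const TYPE('n) \<sigma> /\<^sub>R \<bar>\<kappa>\<bar>)"
      using f lborel_has_bochner_integral_real_affine_iff[of \<kappa> f _ 0] \<kappa> by simp
    then have "has_bochner_integral lborel (\<lambda>s. \<kappa> powr (1 + 2 * \<sigma>) * f (0 + \<kappa> * s))
        (\<kappa> powr (1 + 2 * \<sigma>) * (radial_const TYPE('n) \<sigma> /\<^sub>R \<bar>\<kappa>\<bar>))"
      by (rule has_bochner_integral_mult_right)
    moreover have "\<kappa> powr (1 + 2 * \<sigma>) * f (0 + \<kappa> * s)
      = indicator {0<..} s *\<^sub>R (radial_defect TYPE('n) (s * \<kappa>) * s powr (- 1 - 2 * \<sigma>))" for s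
    proof (cases "s > 0")
      case True
      have "\<kappa> powr (1 + 2 * \<sigma>) * (\<kappa> * s) powr (- 1 - 2 * \<sigma>) = (\<kappa> powr (1 + 2 * \<sigma>) * \<kappa> powr (- 1 - 2 * \<sigma>)) * s powr (- 1 - 2 * \<sigma>)"
        using True \<kappa> by (simp add: powr_mult)
      also have "\<kappa> powr (1 + 2 * \<sigma>) * \<kappa> powr (- 1 - 2 * \<sigma>) = 1"
        using \<kappa> by (simp add: powr_add[symmetric])
      finally show ?thesis using True \<kappa> by (simp add: f_def mult.commute mult.left_commute)
    next
      case False
      then show ?thesis using \<kappa> by (simp add: f_def zero_less_mult_iff)
    qed
    moreover have "\<kappa> powr (1 + 2 * \<sigma>) * (radial_const TYPE('n) \<sigma> /\<^sub>R \<bar>\<kappa>\<bar>) = radial_const TYPE('n) \<sigma> * \<kappa> powr (2 * \<sigma>)"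
      using \<kappa> by (simp add: powr_add divide_inverse)
    ultimately show ?thesis unfolding has_bochner_integral_half_line by (simp only:)
  qed
qed

section \<open>Ball averages of Fourier series\<close>

lemma infsum_minus:
  fixes f g :: "'a \<Rightarrow> 'b::banach"
  assumes "f summable_on A" "g summable_on A"
  shows "(\<Sum>\<^sub>\<infinity>x\<in>A. f x - g x) = (\<Sum>\<^sub>\<infinity>x\<in>A. f x) - (\<Sum>\<^sub>\<infinity>x\<in>A. g x)"
  using infsum_add[of f A "\<lambda>x. - g x"] assms by (simp add: infsum_uminus summable_on_uminus)

text \<open>Each character is an eigenfunction of averaging over balls of radius \<open>s\<close>,
  with eigenvalue \<open>radial_mult\<close> at \<open>s * norm (freq k)\<close>.\<close>

lemma ball_avg_fourier_series:
  fixes a :: "int ^ 'n::finite \<Rightarrow> complex" and u :: "real ^ 'n \<Rightarrow> real"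
  assumes a: "(\<lambda>k. norm (a k)) summable_on UNIV"
    and u: "\<And>x. complex_of_real (u x) = (\<Sum>\<^sub>\<infinity>k. a k * echar (- k) x)"
  shows "complex_of_real (ball_avg u x s) = (\<Sum>\<^sub>\<infinity>k. a k * echar (- k) x * radial_mult TYPE('n) (s * norm (freq k)))"
proof -
  have coef: "(LINT y|ball_measure. a k * echar (- k) (x + s *\<^sub>R y))
      = a k * echar (- k) x * radial_mult TYPE('n) (s * norm (freq k))" for k
  proof -
    have "(LINT y|ball_measure. a k * echar (- k) (x + s *\<^sub>R y)) = a k * echar (- k) x * (LINT y|ball_measure. echar (- k) (s *\<^sub>R y))"
      by (simp add: echar_add mult.assoc)
    also have "(LINT y|ball_measure. echar (- k) (s *\<^sub>R y)) = (LINT y|ball_measure. exp (\<i> * complex_of_real ((s *\<^sub>R freq (- k)) \<bullet> y)))"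
      by (simp add: echar_def)
    also have "\<dots> = radial_mult TYPE('n) (norm (s *\<^sub>R freq (- k)))" by (rule integral_ball_exp)
    also have "radial_mult TYPE('n) (norm (s *\<^sub>R freq (- k))) = radial_mult TYPE('n) (s * norm (freq k))"
      by (simp add: freq_minus abs_mult radial_mult_def abs_if)
    finally show ?thesis .
  qed
  have "complex_of_real (ball_avg u x s) = (LINT y|ball_measure. complex_of_real (u (x + s *\<^sub>R y)))"
    by (simp add: ball_avg_def integral_complex_of_real)
  also have "\<dots> = (LINT y|ball_measure. (\<Sum>\<^sub>\<infinity>k. a k * echar (- k) (x + s *\<^sub>R y)))"
    by (simp add: u)
  also have "\<dots> = (\<Sum>\<^sub>\<infinity>k. LINT y|ball_measure. a k * echar (- k) (x + s *\<^sub>R y))"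
  proof (intro has_bochner_integral_integral_eq has_bochner_integral_infsum infinite_UNIV_int_vec)
    show "integrable ball_measure (\<lambda>y. a k * echar (- k) (x + s *\<^sub>R y))" for k
      by (rule integrable_ball_continuous) (intro continuous_intros)
    show "(\<lambda>k. LINT y|ball_measure. norm (a k * echar (- k) (x + s *\<^sub>R y))) summable_on UNIV"
      using a by (simp add: norm_mult measure_ball_measure summable_on_cmult_right)
    show "(\<lambda>k. norm (a k * echar (- k) (x + s *\<^sub>R y))) summable_on UNIV" for y
      using a by (simp add: norm_mult)
  qed
  also have "\<dots> = (\<Sum>\<^sub>\<infinity>k. a k * echar (- k) x * radial_mult TYPE('n) (s * norm (freq k)))"
    by (simp only: coef)
  finally show ?thesis .
qed

text \<open>Termwise integration in \<open>s\<close>: the term of index \<open>k\<close> integrates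
  to a constant times \<open>norm (freq k) powr (2 * \<sigma>)\<close> times its coefficient.
  Assumption \<open>a\<close> gives pointwise convergence in \<open>s\<close>, and \<open>a2\<close>
  the summability of the integrals of the norms.\<close>

lemma balanced_fourier_series:
  fixes a :: "int ^ 'n::finite \<Rightarrow> complex" and u :: "real ^ 'n \<Rightarrow> real"
  assumes \<sigma>: "0 < \<sigma>" "\<sigma> < 1"
    and a: "(\<lambda>k. norm (a k)) summable_on UNIV"
    and a2: "(\<lambda>k. norm (a k) * norm (freq k) powr (2 * \<sigma>)) summable_on UNIV"
    and u: "\<And>x. complex_of_real (u x) = (\<Sum>\<^sub>\<infinity>k. a k * echar (- k) x)"
    and zero: "(\<Sum>\<^sub>\<infinity>k. norm (freq k) powr (2 * \<sigma>) * a k * echar (- k) x) = 0"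
  shows "balanced \<sigma> u x"
proof -
  let ?\<omega> = "ball_vol TYPE('n)" and ?c = "radial_const TYPE('n) \<sigma>"
  define d where "d = (\<lambda>k s. radial_defect TYPE('n) (s * norm (freq (k :: int ^ 'n))) * s powr (- 1 - 2 * \<sigma>))"
  define f where "f = (\<lambda>k s. - (a k * echar (- k) x) * complex_of_real (d k s))"
  have d0: "0 \<le> d k s" for k s unfolding d_def using radial_defect_bounds(1) by (intro mult_nonneg_nonneg) auto
  have d: "has_bochner_integral half_line (d k) (?c * norm (freq k) powr (2 * \<sigma>))" for k
    unfolding d_def by (rule radial_defect_integral[OF \<sigma>]) simp
  have fi: "has_bochner_integral half_line (f k) (- (a k * echar (- k) x) * complex_of_real (?c * norm (freq k) powr (2 * \<sigma>)))" for k
    unfolding f_def using has_bochner_integral_of_real[OF d] by (rule has_bochner_integral_mult_right)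
  have nf: "norm (f k s) = norm (a k) * d k s" for k s using d0 by (simp add: f_def norm_mult)
  have abs_f: "(\<lambda>k. norm (f k s)) summable_on UNIV" for s
  proof (rule summable_on_comparison_test)
    show "(\<lambda>k. norm (a k) * (?\<omega> * 2 * s powr (- 1 - 2 * \<sigma>))) summable_on UNIV"
      by (rule summable_on_cmult_left[OF a])
    show "norm (f k s) \<le> norm (a k) * (?\<omega> * 2 * s powr (- 1 - 2 * \<sigma>))" for k
      unfolding nf d_def by (intro mult_left_mono mult_right_mono radial_defect_bounds) auto
  qed simp
  have "has_bochner_integral half_line (\<lambda>s. \<Sum>\<^sub>\<infinity>k. f k s) (\<Sum>\<^sub>\<infinity>k. integral\<^sup>L half_line (f k))"
  proof (rule has_bochner_integral_infsum[OF infinite_UNIV_int_vec _ _ abs_f])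
    show "integrable half_line (f k)" for k using fi by (rule integrable.intros)
    have "(LINT s|half_line. norm (f k s)) = norm (a k) * (?c * norm (freq k) powr (2 * \<sigma>))" for k
      unfolding nf using has_bochner_integral_mult_right[OF d, of "norm (a k)" k] by (rule has_bochner_integral_integral_eq)
    then have "(LINT s|half_line. norm (f k s)) = ?c * (norm (a k) * norm (freq k) powr (2 * \<sigma>))" for k
      by simp
    then show "(\<lambda>k. LINT s|half_line. norm (f k s)) summable_on UNIV"
      by (simp only: summable_on_cmult_right[OF a2])
  qed
  moreover have "(\<Sum>\<^sub>\<infinity>k. integral\<^sup>L half_line (f k)) = 0"
  proof -
    have "integral\<^sup>L half_line (f k) = - complex_of_real ?c * (norm (freq k) powr (2 * \<sigma>) * a k * echar (- k) x)" for k
      using has_bochner_integral_integral_eq[OF fi, of k] by simp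
    then have "(\<Sum>\<^sub>\<infinity>k. integral\<^sup>L half_line (f k)) = (\<Sum>\<^sub>\<infinity>k. - complex_of_real ?c * (norm (freq k) powr (2 * \<sigma>) * a k * echar (- k) x))"
      by (simp only:)
    then show ?thesis unfolding infsum_cmult_right' zero by simp
  qed
  moreover have "(\<Sum>\<^sub>\<infinity>k. f k s) = complex_of_real ((ball_avg u x s - ?\<omega> * u x) * s powr (- 1 - 2 * \<sigma>))" for s
  proof -
    let ?w = "complex_of_real (s powr (- 1 - 2 * \<sigma>))"
    have s1: "(\<lambda>k. a k * echar (- k) x * radial_mult TYPE('n) (s * norm (freq k))) summable_on UNIV"
    proof (rule abs_summable_summable, rule summable_on_comparison_test)
      show "(\<lambda>k. norm (a k) * (?\<omega> * 3)) summable_on UNIV" by (rule summable_on_cmult_left[OF a])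
      show "norm (a k * echar (- k) x * radial_mult TYPE('n) (s * norm (freq k))) \<le> norm (a k) * (?\<omega> * 3)" for k
      proof -
        have "\<bar>radial_mult TYPE('n) (s * norm (freq k))\<bar> \<le> ?\<omega> * 3"
          using radial_defect_bounds(1,2)[of "s * norm (freq k)", where 'n = 'n] by linarith
        then show ?thesis by (simp add: norm_mult mult_left_mono)
      qed
    qed simp
    have s2: "(\<lambda>k. ?\<omega> * (a k * echar (- k) x)) summable_on UNIV"
      by (rule summable_on_cmult_right, rule abs_summable_summable) (use a in \<open>simp add: norm_mult\<close>)
    have "f k s = (a k * echar (- k) x * radial_mult TYPE('n) (s * norm (freq k)) - ?\<omega> * (a k * echar (- k) x)) * ?w" for k
      by (simp add: f_def d_def algebra_simps)
    then have "(\<Sum>\<^sub>\<infinity>k. f k s) = (\<Sum>\<^sub>\<infinity>k. a k * echar (- k) x * radial_mult TYPE('n) (s * norm (freq k)) - ?\<omega> * (a k * echar (- k) x)) * ?w"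
      by (simp only: infsum_cmult_left')
    also have "(\<Sum>\<^sub>\<infinity>k. a k * echar (- k) x * radial_mult TYPE('n) (s * norm (freq k)) - ?\<omega> * (a k * echar (- k) x))
       = complex_of_real (ball_avg u x s) - ?\<omega> * complex_of_real (u x)"
      unfolding ball_avg_fourier_series[OF a u] u
      using infsum_cmult_right'[of "complex_of_real ?\<omega>" "\<lambda>k. a k * echar (- k) x" UNIV]
      by (simp only: infsum_minus[OF s1 s2])
    finally show ?thesis by simp
  qed
  ultimately have "has_bochner_integral half_line (\<lambda>s. complex_of_real ((ball_avg u x s - ?\<omega> * u x) * s powr (- 1 - 2 * \<sigma>))) 0"
    by (simp only:)
  from has_bochner_integral_bounded_linear[OF bounded_linear_Re this] show ?thesis
    unfolding balanced_def Re_complex_of_real by (simp only: zero_complex.sel)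
qed

subsection \<open>Smooth bumps and decay of Fourier coefficients\<close>

lemma Ck_SucI:
  assumes "\<And>x. (f has_derivative f' x) (at x)" "\<And>h. Ck m (\<lambda>x. f' x h)"
  shows "Ck (Suc m) f"
proof -
  have "frechet_derivative f (at x) = f' x" for x
    using frechet_derivative_at[OF assms(1)] by simp
  then show ?thesis using assms by (auto simp: differentiable_def)
qed

lemma Ck_Suc_derivative:
  assumes "Ck (Suc m) f"
  shows "(f has_derivative frechet_derivative f (at x)) (at x)" "Ck m (\<lambda>x. frechet_derivative f (at x) h)"
  using assms by (auto simp: frechet_derivative_works)

lemma Ck_lower: "Ck (Suc m) f \<Longrightarrow> Ck m f"
proof (induction m arbitrary: f)
  case 0
  then show ?case by (auto intro!: differentiable_imp_continuous_on simp: differentiable_on_def differentiable_at_withinI)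
next
  case (Suc m)
  have "\<And>x. f differentiable (at x)" "\<And>h. Ck (Suc m) (\<lambda>x. frechet_derivative f (at x) h)"
    using Suc.prems unfolding Ck.simps(2)[of "Suc m"] by blast+
  then show ?case using Suc.IH unfolding Ck.simps(2)[of m f] by blast
qed

lemma Ck_const: "Ck m (\<lambda>_. c)"
proof (induction m arbitrary: c)
  case (Suc m)
  show ?case by (rule Ck_SucI[where f' = "\<lambda>_ _. 0"]) (use Suc in auto)
qed simp

lemma Ck_add: "Ck m f \<Longrightarrow> Ck m g \<Longrightarrow> Ck m (\<lambda>x. f x + g x)"
proof (induction m arbitrary: f g)
  case 0 then show ?case by (simp add: continuous_on_add)
next
  case (Suc m)
  show ?case
  proof (rule Ck_SucI)
    show "((\<lambda>x. f x + g x) has_derivative (\<lambda>h. frechet_derivative f (at x) h + frechet_derivative g (at x) h)) (at x)" for x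
      by (intro has_derivative_add Ck_Suc_derivative(1)[OF Suc.prems(1)] Ck_Suc_derivative(1)[OF Suc.prems(2)])
    show "Ck m (\<lambda>x. frechet_derivative f (at x) h + frechet_derivative g (at x) h)" for h
      by (intro Suc.IH Ck_Suc_derivative(2)[OF Suc.prems(1)] Ck_Suc_derivative(2)[OF Suc.prems(2)])
  qed
qed

lemma Ck_mult:
  fixes f g :: "'a::real_normed_vector \<Rightarrow> real"
  shows "Ck m f \<Longrightarrow> Ck m g \<Longrightarrow> Ck m (\<lambda>x. f x * g x)"
proof (induction m arbitrary: f g)
  case 0 then show ?case by (simp add: continuous_on_mult)
next
  case (Suc m)
  show ?case
  proof (rule Ck_SucI)
    show "((\<lambda>x. f x * g x) has_derivative (\<lambda>h. f x * frechet_derivative g (at x) h + frechet_derivative f (at x) h * g x)) (at x)" for x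
      by (intro has_derivative_mult Ck_Suc_derivative(1)[OF Suc.prems(1)] Ck_Suc_derivative(1)[OF Suc.prems(2)])
    show "Ck m (\<lambda>x. f x * frechet_derivative g (at x) h + frechet_derivative f (at x) h * g x)" for h
      by (intro Ck_add Suc.IH Ck_Suc_derivative(2)[OF Suc.prems(1)] Ck_Suc_derivative(2)[OF Suc.prems(2)]
          Ck_lower[OF Suc.prems(1)] Ck_lower[OF Suc.prems(2)])
  qed
qed

lemma Ck_sum: "(\<And>i. i \<in> I \<Longrightarrow> Ck m (f i)) \<Longrightarrow> Ck m (\<lambda>x. \<Sum>i\<in>I. f i x)"
  by (induction I rule: infinite_finite_induct) (auto intro: Ck_const Ck_add)

text \<open>Differentiation only changes the amplitude and adds \<open>pi / 2\<close> to the phase,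
  so the family is closed under derivatives when \<open>a\<close> and \<open>c\<close> are
  arbitrary.\<close>

lemma Ck_cos: "Ck m (\<lambda>z :: real ^ 'n::finite. a * cos (z $ i + c))"
proof (induction m arbitrary: a c)
  case 0 show ?case by (auto intro!: continuous_intros)
next
  case (Suc m)
  show ?case
  proof (rule Ck_SucI)
    show "((\<lambda>z :: real ^ 'n. a * cos (z $ i + c)) has_derivative (\<lambda>h. (a * h $ i) * cos (x $ i + (c + pi / 2)))) (at x)" for x
    proof -
      have "sin (x $ i + c) = - cos (x $ i + c + pi / 2)" by (simp add: cos_add)
      then show ?thesis
        by (auto intro!: derivative_eq_intros bounded_linear.has_derivative[OF bounded_linear_vec_nth] simp: add.assoc)
    qed
    show "Ck m (\<lambda>x :: real ^ 'n. (a * h $ i) * cos (x $ i + (c + pi / 2)))" for h by (rule Suc)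
  qed
qed

text \<open>A whole chain of derivatives is carried along because differentiating
  \<open>\<beta> j (g x)\<close> brings in \<open>\<beta> (Suc j)\<close>.\<close>

lemma Ck_compose_derivatives:
  fixes g :: "'a::real_normed_vector \<Rightarrow> real"
  assumes \<beta>: "\<And>j t. (\<beta> j has_real_derivative \<beta> (Suc j) t) (at t)" and g: "\<And>m. Ck m g"
  shows "Ck m (\<lambda>x. \<beta> j (g x))"
proof (induction m arbitrary: j)
  case 0
  have "continuous_on UNIV (\<beta> j)"
    using \<beta>[THEN DERIV_isCont] by (auto simp: continuous_on_eq_continuous_at)
  moreover have "continuous_on UNIV g" using g[of 0] by simp
  ultimately show ?case by (simp add: continuous_on_compose2)
next
  case (Suc m)
  show ?case
  proof (rule Ck_SucI)
    show "((\<lambda>x. \<beta> j (g x)) has_derivative (\<lambda>h. \<beta> (Suc j) (g x) * frechet_derivative g (at x) h)) (at x)" for x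
      using has_derivative_compose[OF Ck_Suc_derivative(1)[OF g[of "Suc 0"]] \<beta>[unfolded has_field_derivative_def]]
      by simp
    show "Ck m (\<lambda>x. \<beta> (Suc j) (g x) * frechet_derivative g (at x) h)" for h
      by (intro Ck_mult Suc Ck_Suc_derivative(2)[OF g])
  qed
qed

text \<open>With \<open>p = 1\<close> this is the classical flat function
  \<open>exp (- (1 / t))\<close>, extended by 0; polynomial factors in \<open>1 / t\<close> make the
  family closed under derivatives.\<close>

definition exp_poly :: "real poly \<Rightarrow> real \<Rightarrow> real" where
  "exp_poly p t = (if t > 0 then poly p (1 / t) * exp (- (1 / t)) else 0)"

lemma exp_poly_tendsto_0: "(exp_poly p \<longlongrightarrow> 0) (at 0)"
proof -
  \<comment> \<open>The extra power is needed for the induction over coefficients, where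
    \<open>pCons\<close> multiplies the remaining polynomial by \<open>x\<close>.\<close>
  have "((\<lambda>x. x ^ k * poly p x * exp (- x)) \<longlongrightarrow> 0) at_top" for k
  proof (induction p arbitrary: k)
    case (pCons a p)
    have "((\<lambda>x. a * (x ^ k / exp x) + x ^ Suc k * poly p x * exp (- x)) \<longlongrightarrow> a * 0 + 0) at_top"
      by (intro tendsto_intros tendsto_power_div_exp_0 pCons.IH)
    moreover have "x ^ k * poly (pCons a p) x * exp (- x) = a * (x ^ k / exp x) + x ^ Suc k * poly p x * exp (- x)" for x
      by (simp add: algebra_simps exp_minus divide_inverse)
    ultimately show ?case by simp
  qed simp
  from this[of 0] have "((\<lambda>x. poly p x * exp (- x)) \<longlongrightarrow> 0) at_top" by simp
  from filterlim_compose[OF this filterlim_inverse_at_top_right]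
  have "((\<lambda>t. poly p (1 / t) * exp (- (1 / t))) \<longlongrightarrow> 0) (at_right 0)" by (simp add: inverse_eq_divide)
  moreover have "eventually (\<lambda>t. poly p (1 / t) * exp (- (1 / t)) = exp_poly p t) (at_right 0)"
    by (auto simp: exp_poly_def eventually_at_filter)
  ultimately have r: "(exp_poly p \<longlongrightarrow> 0) (at_right 0)" by (rule Lim_transform_eventually)
  have "eventually (\<lambda>t. 0 = exp_poly p t) (at_left 0)"
    by (auto simp: exp_poly_def eventually_at_filter)
  then have "(exp_poly p \<longlongrightarrow> 0) (at_left 0)" by (rule Lim_transform_eventually[OF tendsto_const])
  with r show ?thesis by (simp add: filterlim_split_at)
qed

text \<open>Differentiating in \<open>1 / t\<close> produces the factor
  \<open>1 / t\<^sup>2\<close>, encoded by \<open>[:0, 0, 1:]\<close>, and the difference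
  \<open>p - pderiv p\<close> from the exponential and the polynomial.\<close>

lemma exp_poly_derivative:
  "(exp_poly p has_real_derivative exp_poly ([:0, 0, 1:] * (p - pderiv p)) t) (at t)"
proof -
  consider "t > 0" | "t < 0" | "t = 0" by linarith
  then show ?thesis
  proof cases
    case 1
    have "((\<lambda>t. poly p (1 / t) * exp (- (1 / t))) has_real_derivative
        exp_poly ([:0, 0, 1:] * (p - pderiv p)) t) (at t)"
      using 1 by (auto intro!: derivative_eq_intros DERIV_chain'[OF _ poly_DERIV]
          simp: exp_poly_def field_simps power2_eq_square)
    then show ?thesis
      by (rule has_field_derivative_transform_within_open[of _ _ _ "{0<..}"]) (use 1 in \<open>auto simp: exp_poly_def\<close>)
  next
    case 2
    have "((\<lambda>t. 0) has_real_derivative 0) (at t)" by simp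
    then have "(exp_poly p has_real_derivative 0) (at t)"
      by (rule has_field_derivative_transform_within_open[of _ _ _ "{..<0}"]) (use 2 in \<open>auto simp: exp_poly_def\<close>)
    then show ?thesis using 2 by (simp add: exp_poly_def)
  next
    case 3
    \<comment> \<open>Dividing by \<open>h\<close> raises the degree by one, so the difference
      quotient at 0 is again in the family and tends to 0. At \<open>h = 0\<close> both sides are 0,
      the left one by division by zero.\<close>
    have "(\<lambda>h. (exp_poly p (0 + h) - exp_poly p 0) / h) = exp_poly ([:0, 1:] * p)"
      by (auto simp: exp_poly_def fun_eq_iff)
    then have "(exp_poly p has_real_derivative 0) (at 0)"
      using exp_poly_tendsto_0[of "[:0, 1:] * p"] by (simp only: DERIV_def)
    then show ?thesis using 3 by (simp add: exp_poly_def)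
  qed
qed

text \<open>Using \<open>one_sub_cos\<close> in place of a squared norm makes the bump periodic and
  smooth at once, so that it descends to the torus.\<close>

definition bump :: "real \<Rightarrow> real ^ 'n::finite \<Rightarrow> real" where
  "bump \<delta> x = exp_poly 1 (\<delta> - one_sub_cos x)"

lemma bump_nonneg: "0 \<le> bump \<delta> x"
  by (simp add: bump_def exp_poly_def)

lemma bump_pos_iff: "0 < bump \<delta> x \<longleftrightarrow> one_sub_cos x < \<delta>"
  by (simp add: bump_def exp_poly_def)

lemma bump_periodic: "periodic (bump \<delta>)"
  by (simp add: bump_def periodic_def periodicD[OF one_sub_cos_periodic])

lemma bump_Ck: "Ck m (\<lambda>z :: real ^ 'n::finite. bump \<delta> (z - x))"
proof -
  define \<beta> where "\<beta> = (\<lambda>j. exp_poly (((\<lambda>p. [:0, 0, 1:] * (p - pderiv p)) ^^ j) 1))"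
  \<comment> \<open>The argument \<open>\<delta> - one_sub_cos (z - x)\<close>, rewritten as a sum
    of shifted cosines to which \<open>Ck_cos\<close> applies; \<open>\<beta> j\<close> is the
    \<open>j\<close>-th derivative of \<open>exp_poly 1\<close>.\<close>
  define g where "g = (\<lambda>z :: real ^ 'n. (\<delta> + - real CARD('n)) + (\<Sum>i\<in>UNIV. 1 * cos (z $ i + - x $ i)))"
  have "Ck m (\<lambda>z. \<beta> 0 (g z))"
  proof (rule Ck_compose_derivatives[of \<beta> g])
    show "(\<beta> j has_real_derivative \<beta> (Suc j) t) (at t)" for j t
      using exp_poly_derivative by (simp add: \<beta>_def)
    show "Ck m g" for m
      unfolding g_def by (intro Ck_add Ck_const Ck_sum Ck_cos)
  qed
  moreover have "\<beta> 0 (g z) = bump \<delta> (z - x)" for z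
    by (simp add: \<beta>_def g_def bump_def one_sub_cos_def sum_subtractf algebra_simps)
  ultimately show ?thesis by simp
qed

section \<open>Fourier coefficients of smooth periodic functions\<close>

definition partial :: "'n::finite \<Rightarrow> (real ^ 'n \<Rightarrow> real) \<Rightarrow> real ^ 'n \<Rightarrow> real" where
  "partial i f x = frechet_derivative f (at x) (axis i 1)"

lemma partial_Ck: "(\<And>m. Ck m f) \<Longrightarrow> Ck m (partial i f)"
  unfolding partial_def[abs_def] by (rule Ck_Suc_derivative(2))

lemma partial_periodic:
  assumes f: "\<And>m. Ck m f" and per: "periodic f"
  shows "periodic (partial i f)"
  unfolding periodic_def
proof (intro allI)
  fix x :: "real ^ 'a" and m
  let ?a = "(2 * pi) *\<^sub>R freq m :: real ^ 'a"
  have "(f has_derivative frechet_derivative f (at (x + ?a))) (at (x + ?a))"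
    by (rule Ck_Suc_derivative(1)[OF f])
  then have "((\<lambda>y. f (y + ?a)) has_derivative frechet_derivative f (at (x + ?a))) (at x)"
    by (rule has_derivative_compose[rotated, of _ _ "\<lambda>y. y + ?a", simplified]) (auto intro!: derivative_eq_intros)
  then have "(f has_derivative frechet_derivative f (at (x + ?a))) (at x)"
    using per by (simp add: periodic_def)
  then show "partial i f (x + ?a) = partial i f x"
    unfolding partial_def using frechet_derivative_at by metis
qed

lemma partial_has_derivative:
  assumes "Ck (Suc 0) f"
  shows "((\<lambda>s. f (x + s *\<^sub>R axis i 1)) has_real_derivative partial i f (x + t *\<^sub>R axis i 1)) (at t)"
proof -
  have "((\<lambda>s. f (x + s *\<^sub>R axis i 1)) has_derivative
     (\<lambda>h. frechet_derivative f (at (x + t *\<^sub>R axis i 1)) (h *\<^sub>R axis i 1))) (at t)"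
    by (rule has_derivative_compose[OF _ Ck_Suc_derivative(1)[OF assms]]) (auto intro!: derivative_eq_intros)
  moreover have "frechet_derivative f (at y) (h *\<^sub>R axis i 1) = partial i f y * h" for y h
    using Ck_Suc_derivative(1)[OF assms, of y, THEN has_derivative_linear]
    by (simp add: partial_def linear_scale mult.commute)
  ultimately show ?thesis by (simp add: has_field_derivative_def)
qed

text \<open>Unnormalised and with the opposite sign of the frequency: dividing its value at
  \<open>- k\<close> by \<open>(2 * pi) ^ CARD('n)\<close> gives the usual coefficient of index
  \<open>k\<close>.\<close>

definition box_coeff :: "(real ^ 'n::finite \<Rightarrow> real) \<Rightarrow> int ^ 'n \<Rightarrow> complex" where
  "box_coeff f k = (LINT x|box_measure. complex_of_real (f x) * echar k x)"

lemma box_coeff_integrable: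
  assumes "continuous_on UNIV f" "periodic f"
  shows "integrable box_measure (\<lambda>x. complex_of_real (f x) * echar k x)"
  using assms echar_periodic[of k] by (intro integrable_box_periodic continuous_intros) (simp_all add: periodic_def)

lemma norm_box_coeff_le:
  fixes f :: "real ^ 'n::finite \<Rightarrow> real"
  assumes "continuous_on UNIV f" "periodic f" "\<And>x. \<bar>f x\<bar> \<le> M"
  shows "norm (box_coeff f k) \<le> M * (2 * pi) ^ CARD('n)"
proof -
  have "norm (box_coeff f k) \<le> (LINT x|box_measure. norm (complex_of_real (f x) * echar k x))"
    unfolding box_coeff_def by (rule integral_norm_bound)
  also have "\<dots> \<le> (LINT x|(box_measure :: (real ^ 'n) measure). M)"
    using assms(3) by (intro integral_mono integrable_norm box_coeff_integrable assms) (auto simp: norm_mult)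
  finally show ?thesis by (simp add: measure_box_measure mult.commute)
qed

lemma box_coeff_translate:
  assumes cont: "continuous_on UNIV f" and per: "periodic f"
  shows "box_coeff (\<lambda>x. f (x + h)) k = echar (- k) h * box_coeff f k"
proof -
  have p: "periodic (\<lambda>x. complex_of_real (f x) * echar k x)"
    using per echar_periodic[of k] by (simp add: periodic_def)
  have [measurable]: "f \<in> borel_measurable borel" using cont by blast
  have "complex_of_real (f (x + h)) * echar k x = echar (- k) h * (complex_of_real (f (x + h)) * echar k (x + h))" for x
    by (simp add: echar_add mult.left_commute)
  then have "box_coeff (\<lambda>x. f (x + h)) k = echar (- k) h * (LINT x|box_measure. complex_of_real (f (x + h)) * echar k (x + h))"
    unfolding box_coeff_def by (simp only: integral_mult_right_zero)
  also have "(LINT x|box_measure. complex_of_real (f (x + h)) * echar k (x + h)) = box_coeff f k"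
    unfolding box_coeff_def by (rule integral_box_translate(1)[OF _ p]) measurable
  finally show ?thesis .
qed

text \<open>Instead of integrating by parts, the coefficients of difference quotients are computed
  from \<open>box_coeff_translate\<close> and the step tends to 0; the mean value theorem supplies
  the dominating constant.\<close>

lemma box_coeff_partial:
  fixes f :: "real ^ 'n::finite \<Rightarrow> real"
  assumes f: "\<And>m. Ck m f" and per: "periodic f"
  shows "box_coeff (partial i f) k = - \<i> * of_int (k $ i) * box_coeff f k"
proof -
  have cont: "continuous_on UNIV f" using f[of 0] by simp
  have pc: "continuous_on UNIV (partial i f)" using partial_Ck[OF f, of 0 i] by simp
  obtain M where M: "\<And>x. norm (partial i f x) \<le> M"
    using periodic_bounded[OF pc partial_periodic[OF f per]] by metis
  define \<tau> where "\<tau> = (\<lambda>j::nat. 1 / real (Suc j))"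
  have \<tau>0: "\<tau> j > 0" for j by (simp add: \<tau>_def)
  have \<tau>: "filterlim \<tau> (at 0) sequentially"
    unfolding filterlim_at using \<tau>0 LIMSEQ_inverse_real_of_nat by (auto simp: \<tau>_def inverse_eq_divide less_imp_neq intro!: always_eventually)
  define D where "D = (\<lambda>j x. (f (x + \<tau> j *\<^sub>R axis i 1) - f x) / \<tau> j)"
  have Dlim: "(\<lambda>j. D j x) \<longlonglongrightarrow> partial i f x" for x
  proof -
    have "((\<lambda>h. (f (x + h *\<^sub>R axis i 1) - f x) / h) \<longlongrightarrow> partial i f x) (at 0)"
      using partial_has_derivative[OF f, of x i 0] by (simp add: DERIV_def)
    from filterlim_compose[OF this \<tau>] show ?thesis by (simp add: D_def)
  qed
  have Dbound: "\<bar>D j x\<bar> \<le> M" for j x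
  proof -
    have "\<exists>s>0. s < \<tau> j \<and> f (x + \<tau> j *\<^sub>R axis i 1) - f (x + 0 *\<^sub>R axis i 1) = (\<tau> j - 0) * partial i f (x + s *\<^sub>R axis i 1)"
      using \<tau>0[of j] by (intro MVT2 partial_has_derivative[OF f]) auto
    then obtain s where "f (x + \<tau> j *\<^sub>R axis i 1) - f x = \<tau> j * partial i f (x + s *\<^sub>R axis i 1)" by auto
    then have "D j x = partial i f (x + s *\<^sub>R axis i 1)" using \<tau>0[of j] by (simp add: D_def)
    then show ?thesis using M[of "x + s *\<^sub>R axis i 1"] by simp
  qed
  have "(\<lambda>j. box_coeff (D j) k) \<longlonglongrightarrow> box_coeff (partial i f) k"
    unfolding box_coeff_def
  proof (rule integral_dominated_convergence[where w = "\<lambda>_. M"])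
    have [measurable]: "f \<in> borel_measurable borel" "partial i f \<in> borel_measurable borel" using cont pc by blast+
    show "(\<lambda>x. complex_of_real (partial i f x) * echar k x) \<in> borel_measurable box_measure" by measurable
    show "(\<lambda>x. complex_of_real (D j x) * echar k x) \<in> borel_measurable box_measure" for j unfolding D_def by measurable
    show "AE x in box_measure. (\<lambda>j. complex_of_real (D j x) * echar k x) \<longlonglongrightarrow> complex_of_real (partial i f x) * echar k x"
      by (intro AE_I2 tendsto_intros Dlim)
    show "AE x in box_measure. norm (complex_of_real (D j x) * echar k x) \<le> M" for j
      by (intro AE_I2) (simp add: norm_mult Dbound)
  qed simp
  moreover have "(\<lambda>j. box_coeff (D j) k) \<longlonglongrightarrow> - \<i> * of_int (k $ i) * box_coeff f k"
  proof -
    have "box_coeff (D j) k = (echar (- k) (\<tau> j *\<^sub>R axis i 1) - 1) / \<tau> j * box_coeff f k" for j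
    proof -
      have c: "continuous_on UNIV (\<lambda>x. f (x + \<tau> j *\<^sub>R axis i 1))"
        by (intro continuous_on_compose2[OF cont] continuous_intros) auto
      have "box_coeff (D j) k = (LINT x|box_measure. (complex_of_real (f (x + \<tau> j *\<^sub>R axis i 1)) * echar k x - complex_of_real (f x) * echar k x) / \<tau> j)"
        by (simp add: box_coeff_def D_def left_diff_distrib diff_divide_distrib)
      also have "\<dots> = (box_coeff (\<lambda>x. f (x + \<tau> j *\<^sub>R axis i 1)) k - box_coeff f k) / \<tau> j"
        unfolding box_coeff_def
        by (subst integral_divide_zero, subst Bochner_Integration.integral_diff)
          (auto intro!: box_coeff_integrable c cont per periodic_translate)
      finally show ?thesis by (simp add: box_coeff_translate[OF cont per] left_diff_distrib diff_divide_distrib)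
    qed
    moreover have "echar (- k) (t *\<^sub>R axis i 1) = exp (of_real t * (- \<i> * of_int (k $ i)))" for t
      by (simp add: echar_def freq_minus inner_axis mult_ac)
    moreover have "((\<lambda>t. (exp (of_real t * (- \<i> * of_int (k $ i))) - 1) / complex_of_real t) \<longlongrightarrow> - \<i> * of_int (k $ i)) (at 0)"
    proof -
      have "((\<lambda>z. exp (z * (- \<i> * of_int (k $ i)))) has_field_derivative (- \<i> * of_int (k $ i))) (at (complex_of_real 0))"
        by (auto intro!: derivative_eq_intros)
      then have "((\<lambda>z. (exp (z * (- \<i> * of_int (k $ i))) - 1) / z) \<longlongrightarrow> - \<i> * of_int (k $ i)) (at 0)"
        by (simp add: DERIV_def)
      moreover have "filterlim complex_of_real (at 0) (at 0)"
        by (auto simp: filterlim_at eventually_at_filter intro!: tendsto_eq_intros)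
      ultimately show ?thesis by (rule filterlim_compose)
    qed
    from tendsto_mult_right[OF filterlim_compose[OF this \<tau>], of "box_coeff f k"]
    have "(\<lambda>j. (exp (of_real (\<tau> j) * (- \<i> * of_int (k $ i))) - 1) / complex_of_real (\<tau> j) * box_coeff f k) \<longlonglongrightarrow> - \<i> * of_int (k $ i) * box_coeff f k" .
    ultimately show ?thesis by simp
  qed
  ultimately show ?thesis by (rule LIMSEQ_unique)
qed

text \<open>\<open>1 - \<partial>\<^sub>i\<^sup>2\<close> multiplies the \<open>k\<close>-th coefficient by \<open>1 + k\<^sub>i\<^sup>2\<close>; it is applied twice in each direction.\<close>

lemma smooth_coeff_decay:
  fixes f :: "real ^ 'n::finite \<Rightarrow> real"
  assumes f: "\<And>m. Ck m f" and per: "periodic f"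
  obtains M where "0 \<le> M" "\<And>k. norm (box_coeff f k) * (\<Prod>i\<in>UNIV. (1 + (real_of_int (k $ i))\<^sup>2)\<^sup>2) \<le> M"
proof -
  have step: "\<exists>g. (\<forall>m. Ck m g) \<and> periodic g \<and> (\<forall>k. box_coeff g k = (1 + (real_of_int (k $ i))\<^sup>2) * box_coeff f k)"
    if f: "\<And>m. Ck m f" and per: "periodic f" for f :: "real ^ 'n \<Rightarrow> real" and i
  proof (intro exI[of _ "\<lambda>x. f x + - 1 * partial i (partial i f) x"] conjI allI)
    note pf = partial_Ck[OF f] partial_periodic[OF f per]
    note ppf = partial_Ck[OF pf(1)] partial_periodic[OF pf]
    show "Ck m (\<lambda>x. f x + - 1 * partial i (partial i f) x)" for m
      by (intro Ck_add Ck_mult Ck_const f ppf)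
    show "periodic (\<lambda>x. f x + - 1 * partial i (partial i f) x)"
      using per ppf(2)[of i i] by (simp add: periodic_def)
    fix k
    have "box_coeff (\<lambda>x. f x + - 1 * partial i (partial i f) x) k = box_coeff f k - box_coeff (partial i (partial i f)) k"
      using box_coeff_integrable[of f k] box_coeff_integrable[of "partial i (partial i f)" k] f[of 0] ppf(1)[of 0 i i] per ppf(2)[of i i]
      by (simp add: box_coeff_def left_diff_distrib)
    also have "box_coeff (partial i (partial i f)) k = - \<i> * of_int (k $ i) * (- \<i> * of_int (k $ i) * box_coeff f k)"
      by (simp only: box_coeff_partial[OF pf] box_coeff_partial[OF f per])
    finally show "box_coeff (\<lambda>x. f x + - 1 * partial i (partial i f) x) k = (1 + (real_of_int (k $ i))\<^sup>2) * box_coeff f k"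
      by (simp add: algebra_simps power2_eq_square)
  qed
  have "\<exists>g. (\<forall>m. Ck m g) \<and> periodic g \<and> (\<forall>k. box_coeff g k = (\<Prod>i\<in>A. (1 + (real_of_int (k $ i))\<^sup>2)\<^sup>2) * box_coeff f k)" for A :: "'n set"
  proof (induction A rule: infinite_finite_induct)
    case (insert i A)
    then obtain g where g: "\<And>m. Ck m g" "periodic g"
      "\<And>k. box_coeff g k = (\<Prod>i\<in>A. (1 + (real_of_int (k $ i))\<^sup>2)\<^sup>2) * box_coeff f k" by blast
    obtain g1 where g1: "\<And>m. Ck m g1" "periodic g1" "\<And>k. box_coeff g1 k = (1 + (real_of_int (k $ i))\<^sup>2) * box_coeff g k"
      using step[OF g(1,2), of i] by blast
    obtain g2 where g2: "\<And>m. Ck m g2" "periodic g2" "\<And>k. box_coeff g2 k = (1 + (real_of_int (k $ i))\<^sup>2) * box_coeff g1 k"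
      using step[OF g1(1,2), of i] by blast
    show ?case
      using g2 insert.hyps by (intro exI[of _ g2]) (simp add: g1(3) g(3) power2_eq_square[of "1 + _"] mult.assoc)
  qed (use f per in auto)
  from this[of UNIV] obtain g where g: "\<And>m. Ck m g" "periodic g"
    "\<And>k. box_coeff g k = (\<Prod>i\<in>UNIV. (1 + (real_of_int (k $ i))\<^sup>2)\<^sup>2) * box_coeff f k" by blast
  have gc: "continuous_on UNIV g" using g(1)[of 0] by simp
  obtain M where M: "0 \<le> M" "\<And>x. norm (g x) \<le> M" using periodic_bounded[OF gc g(2)] by metis
  have "norm (box_coeff f k) * (\<Prod>i\<in>UNIV. (1 + (real_of_int (k $ i))\<^sup>2)\<^sup>2) \<le> M * (2 * pi) ^ CARD('n)" for k
  proof -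
    have "0 \<le> (\<Prod>i\<in>UNIV. (1 + (real_of_int (k $ i))\<^sup>2)\<^sup>2)" by (intro prod_nonneg) auto
    then have "norm (box_coeff f k) * (\<Prod>i\<in>UNIV. (1 + (real_of_int (k $ i))\<^sup>2)\<^sup>2) = norm (box_coeff g k)"
      unfolding g(3) norm_mult norm_of_real by (simp add: mult.commute)
    also have "\<dots> \<le> M * (2 * pi) ^ CARD('n)" using M(2) by (intro norm_box_coeff_le gc g(2)) simp
    finally show ?thesis .
  qed
  then show thesis using that[of "M * (2 * pi) ^ CARD('n)"] M(1) by simp
qed

lemma summable_on_int_inverse_square: "(\<lambda>j::int. 1 / (1 + (real_of_int j)\<^sup>2)) summable_on UNIV"
proof -
  have "summable (\<lambda>n. 1 / (1 + (real n)\<^sup>2))"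
  proof (rule summable_comparison_test')
    show "summable (\<lambda>n. inverse ((real n)\<^sup>2))" by (rule inverse_power_summable) simp
    show "norm (1 / (1 + (real n)\<^sup>2)) \<le> inverse ((real n)\<^sup>2)" if "n \<ge> 1" for n
      using that by (auto simp: inverse_eq_divide intro!: divide_left_mono mult_pos_pos add_pos_nonneg)
  qed
  then have s: "(\<lambda>n::nat. 1 / (1 + (real n)\<^sup>2)) summable_on UNIV"
    by (subst summable_on_UNIV_nonneg_real_iff) auto
  have "(\<lambda>j::int. 1 / (1 + (real_of_int j)\<^sup>2)) summable_on (range int \<union> range (\<lambda>n. - int n))"
  proof (rule summable_on_union)
    show "(\<lambda>j::int. 1 / (1 + (real_of_int j)\<^sup>2)) summable_on range int"
      using s by (subst summable_on_reindex) (auto simp: inj_on_def o_def)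
    show "(\<lambda>j::int. 1 / (1 + (real_of_int j)\<^sup>2)) summable_on range (\<lambda>n. - int n)"
      using s by (subst summable_on_reindex) (auto simp: inj_on_def o_def)
  qed
  moreover have "range int \<union> range (\<lambda>n. - int n) = UNIV"
    by (auto simp: image_iff) (metis int_cases2)
  ultimately show ?thesis by simp
qed

text \<open>The sum factors over the coordinates into convergent one-dimensional sums, after passing
  from vectors to functions on the index type.\<close>

lemma summable_on_lattice_product:
  "(\<lambda>k :: int ^ 'n::finite. \<Prod>i\<in>UNIV. 1 / (1 + (real_of_int (k $ i))\<^sup>2)) summable_on UNIV"
proof -
  have "Infinite_Set_Sum.abs_summable_on (\<lambda>g. \<Prod>i\<in>(UNIV :: 'n set). 1 / (1 + (real_of_int (g i))\<^sup>2)) (PiE UNIV (\<lambda>_. UNIV))"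
  proof (rule abs_summable_on_prod_PiE)
    show "Infinite_Set_Sum.abs_summable_on (\<lambda>j::int. 1 / (1 + (real_of_int j)\<^sup>2)) UNIV" for i :: 'n
      using summable_on_int_inverse_square by (subst abs_summable_equivalent[symmetric]) simp
  qed auto
  then have "(\<lambda>g. norm (\<Prod>i\<in>(UNIV :: 'n set). 1 / (1 + (real_of_int (g i))\<^sup>2))) summable_on UNIV"
    by (subst (asm) abs_summable_equivalent[symmetric]) (simp add: PiE_UNIV_domain)
  then have "(\<lambda>g. \<Prod>i\<in>(UNIV :: 'n set). 1 / (1 + (real_of_int (g i))\<^sup>2)) summable_on UNIV"
    by (rule abs_summable_summable)
  moreover have "bij_betw (\<lambda>k :: int ^ 'n. ($) k) UNIV UNIV"
    by (rule bij_betwI[of _ _ _ vec_lambda]) auto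
  ultimately show ?thesis
    using summable_on_reindex_bij_betw[of "\<lambda>k :: int ^ 'n. ($) k" UNIV UNIV "\<lambda>g. \<Prod>i\<in>UNIV. 1 / (1 + (real_of_int (g i))\<^sup>2)"] by simp
qed

text \<open>Applied to the squares of the entries of \<open>k\<close>, it bounds
  \<open>1 + (norm (freq k))\<^sup>2\<close> by the product that governs the decay.\<close>

lemma one_plus_sum_le_prod:
  fixes a :: "'i \<Rightarrow> real"
  assumes "finite A" "\<And>i. i \<in> A \<Longrightarrow> 0 \<le> a i"
  shows "1 + (\<Sum>i\<in>A. a i) \<le> (\<Prod>i\<in>A. 1 + a i)"
  using assms
proof (induction A rule: finite_induct)
  case (insert i A)
  have "1 + (\<Sum>i\<in>insert i A. a i) \<le> (1 + a i) * (1 + (\<Sum>i\<in>A. a i))"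
    using insert by (simp add: algebra_simps sum_nonneg)
  also have "\<dots> \<le> (1 + a i) * (\<Prod>i\<in>A. 1 + a i)"
    using insert by (intro mult_left_mono) auto
  finally show ?case using insert by simp
qed simp

text \<open>With \<open>P\<close> the product of the \<open>1 + k_i\<^sup>2\<close>, coefficients
  decay like \<open>1 / P\<^sup>2\<close>. One factor absorbs the weight, which is at most
  \<open>2 * P\<close>; the other is summable over the lattice. This is why the decay is proved with
  squares.\<close>

lemma smooth_coeff_summable:
  fixes f :: "real ^ 'n::finite \<Rightarrow> real"
  assumes f: "\<And>m. Ck m f" and per: "periodic f" and \<sigma>: "0 < \<sigma>" "\<sigma> < 1"
  shows "(\<lambda>k. norm (box_coeff f k) * (1 + norm (freq k) powr (2 * \<sigma>))) summable_on UNIV"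
proof -
  obtain M where M: "0 \<le> M" "\<And>k. norm (box_coeff f k) * (\<Prod>i\<in>UNIV. (1 + (real_of_int (k $ i))\<^sup>2)\<^sup>2) \<le> M"
    using smooth_coeff_decay[OF f per] by metis
  show ?thesis
  proof (rule summable_on_comparison_test)
    show "(\<lambda>k :: int ^ 'n. 2 * M * (\<Prod>i\<in>UNIV. 1 / (1 + (real_of_int (k $ i))\<^sup>2))) summable_on UNIV"
      by (rule summable_on_cmult_right[OF summable_on_lattice_product])
    fix k :: "int ^ 'n"
    define P where "P = (\<Prod>i\<in>UNIV. 1 + (real_of_int (k $ i))\<^sup>2)"
    have P: "1 + (norm (freq k))\<^sup>2 \<le> P"
      using one_plus_sum_le_prod[of UNIV "\<lambda>i. (real_of_int (k $ i))\<^sup>2"]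
      by (simp add: P_def norm_vec_def L2_set_def sum_nonneg)
    have "norm (freq k) powr (2 * \<sigma>) \<le> 1 + (norm (freq k))\<^sup>2"
    proof (cases "norm (freq k) \<le> 1")
      case True
      then have "norm (freq k) powr (2 * \<sigma>) \<le> 1" using \<sigma> by (simp add: powr_le1)
      then show ?thesis by (simp add: add_increasing2)
    next
      case False
      then have "norm (freq k) powr (2 * \<sigma>) \<le> norm (freq k) powr 2" using \<sigma> by (intro powr_mono) auto
      also have "\<dots> = (norm (freq k))\<^sup>2" using False by (simp add: powr_numeral)
      finally show ?thesis by simp
    qed
    then have w: "1 + norm (freq k) powr (2 * \<sigma>) \<le> 2 * P" using P zero_le_power2[of "norm (freq k)"] by linarith
    have P0: "0 < P" using P zero_le_power2[of "norm (freq k)"] by linarith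
    have "norm (box_coeff f k) * (1 + norm (freq k) powr (2 * \<sigma>)) \<le> norm (box_coeff f k) * (2 * P)"
      using w by (rule mult_left_mono) simp
    also have "\<dots> = 2 * (norm (box_coeff f k) * P\<^sup>2) * (1 / P)" using P0 by (simp add: power2_eq_square)
    also have "\<dots> \<le> 2 * M * (1 / P)"
      using M(2)[of k] P0 by (intro mult_right_mono) (auto simp: P_def prod_power_distrib)
    also have "1 / P = (\<Prod>i\<in>UNIV. 1 / (1 + (real_of_int (k $ i))\<^sup>2))" by (simp add: P_def prod_dividef)
    finally show "norm (box_coeff f k) * (1 + norm (freq k) powr (2 * \<sigma>)) \<le> 2 * M * (\<Prod>i\<in>UNIV. 1 / (1 + (real_of_int (k $ i))\<^sup>2))" .
  qed (auto intro!: mult_nonneg_nonneg add_nonneg_nonneg)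
qed

subsection \<open>Mollification\<close>

lemma integral_lborel_translate:
  fixes f :: "'a::euclidean_space \<Rightarrow> 'b::{banach, second_countable_topology}"
  assumes [measurable]: "f \<in> borel_measurable borel"
  shows "(LINT x|lborel. f (x + y)) = (LINT x|lborel. f x)"
    and "integrable lborel (\<lambda>x. f (x + y)) \<longleftrightarrow> integrable lborel f"
proof -
  show "(LINT x|lborel. f (x + y)) = (LINT x|lborel. f x)"
    using integral_distr[of "(+) y" lborel borel f] by (simp add: lborel_distr_plus add.commute)
  show "integrable lborel (\<lambda>x. f (x + y)) \<longleftrightarrow> integrable lborel f"
    using integrable_distr_eq[of "(+) y" lborel borel f] by (simp add: lborel_distr_plus add.commute)
qed

definition shift_distance :: "('a::euclidean_space \<Rightarrow> real) \<Rightarrow> 'a \<Rightarrow> real" where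
  "shift_distance f y = (LINT x|lborel. \<bar>f (x + y) - f x\<bar>)"

lemma shift_distance_perturb:
  fixes f g :: "'a::euclidean_space \<Rightarrow> real"
  assumes f: "integrable lborel f" and g: "integrable lborel g"
  shows "shift_distance f y \<le> shift_distance g y + 2 * (LINT x|lborel. \<bar>f x - g x\<bar>)"
proof -
  have [measurable]: "f \<in> borel_measurable borel" "g \<in> borel_measurable borel"
    using f g by (auto dest: borel_measurable_integrable)
  have fy: "integrable lborel (\<lambda>x. f (x + y))" and gy: "integrable lborel (\<lambda>x. g (x + y))"
    using f g by (simp_all add: integral_lborel_translate(2))
  have "shift_distance f y \<le> (LINT x|lborel. \<bar>f (x + y) - g (x + y)\<bar> + \<bar>g (x + y) - g x\<bar> + \<bar>f x - g x\<bar>)"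
    unfolding shift_distance_def using f g fy gy by (intro integral_mono) auto
  also have "\<dots> = (LINT x|lborel. \<bar>f (x + y) - g (x + y)\<bar>) + shift_distance g y + (LINT x|lborel. \<bar>f x - g x\<bar>)"
    unfolding shift_distance_def using f g fy gy by simp
  also have "(LINT x|lborel. \<bar>f (x + y) - g (x + y)\<bar>) = (LINT x|lborel. \<bar>f x - g x\<bar>)"
    by (rule integral_lborel_translate(1)) measurable
  finally show ?thesis by simp
qed

text \<open>Induction over integrable functions. For an indicator, \<open>A\<close> is enclosed
  between a compact \<open>K\<close> and an open \<open>U\<close> that differ little in measure; a
  shift by less than the gap between \<open>K\<close> and the outside of \<open>U\<close> changes
  the indicator only near \<open>U - K\<close>. Limits are handled by
  \<open>shift_distance_perturb\<close>.\<close>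

lemma shift_distance_tendsto_0:
  fixes f :: "'a::euclidean_space \<Rightarrow> real"
  assumes "integrable lborel f" "0 < e"
  shows "\<exists>\<eta>>0. \<forall>y. norm y < \<eta> \<longrightarrow> shift_distance f y < e"
  using assms
proof (induction f arbitrary: e rule: integrable_induct)
  case (base A c)
  then have A: "A \<in> sets borel" "emeasure lborel A < \<infinity>" by auto
  have [measurable]: "A \<in> sets borel" by (rule A(1))
  \<comment> \<open>The final bound is \<open>2 * \<bar>c\<bar> * (2 * d)\<close>; the added 1 makes
    it strictly less than \<open>e\<close> and covers \<open>c = 0\<close>.\<close>
  define d where "d = e / (4 * (\<bar>c\<bar> + 1))"
  have d: "0 < d" using base by (simp add: d_def)
  obtain U where U: "open U" "A \<subseteq> U" "emeasure lborel (U - A) \<le> ennreal (d / 2)"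
    using outer_regular_lborel_le[OF A(1), of "d / 2"] d by auto
  obtain K where K: "compact K" "K \<subseteq> A" "emeasure lborel A < emeasure lborel K + ennreal (d / 2)"
  proof -
    \<comment> \<open>Inner regularity is applied to a finite measure, so \<open>lborel\<close> is
      cut down to \<open>A\<close>.\<close>
    define M where "M = density lborel (indicator A :: 'a \<Rightarrow> ennreal)"
    have M: "emeasure M B = emeasure lborel (A \<inter> B)" if [measurable]: "B \<in> sets borel" for B
      unfolding M_def by (simp add: emeasure_density indicator_inter_arith[symmetric])
    have sup: "emeasure M A = (SUP K\<in>{K. K \<subseteq> A \<and> compact K}. emeasure M K)"
      by (rule inner_regular) (use A M[of UNIV] in \<open>auto simp: M_def\<close>)
    have "\<exists>K\<in>{K. K \<subseteq> A \<and> compact K}. emeasure M A < emeasure M K + ennreal (d / 2)"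
    proof -
      \<comment> \<open>In \<open>ennreal\<close> subtraction truncates at 0, so a set of measure 0
        is treated apart, with the empty set as \<open>K\<close>.\<close>
      have "emeasure M A - ennreal (d / 2) < emeasure M A \<or> emeasure M A = 0"
      proof -
        obtain t where t: "0 \<le> t" "emeasure M A = ennreal t"
          using A M[of A] by (cases "emeasure M A") auto
        then show ?thesis using d by (cases "t = 0") (auto simp: ennreal_minus intro!: ennreal_lessI)
      qed
      then show ?thesis
      proof
        assume "emeasure M A - ennreal (d / 2) < emeasure M A"
        then obtain K where K: "K \<subseteq> A" "compact K" "emeasure M A - ennreal (d / 2) < emeasure M K"
          using sup by (auto simp: less_SUP_iff)
        have "emeasure M A < emeasure M K + ennreal (d / 2)"
        proof (rule ccontr)
          assume "\<not> ?thesis"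
          then have le: "emeasure M K + ennreal (d / 2) \<le> emeasure M A" by simp
          then have "emeasure M K + ennreal (d / 2) - ennreal (d / 2) \<le> emeasure M A - ennreal (d / 2)"
            by (rule ennreal_minus_mono) simp
          then show False using K(3) by (simp add: ennreal_add_diff_cancel_right)
        qed
        then show ?thesis using K by blast
      next
        assume "emeasure M A = 0"
        then show ?thesis using d by (intro bexI[of _ "{}"]) auto
      qed
    qed
    then obtain K where K: "K \<subseteq> A" "compact K" "emeasure M A < emeasure M K + ennreal (d / 2)" by blast
    then show thesis using that[of K] M[of A] M[of K] by (simp add: Int_absorb1 borel_compact)
  qed
  obtain \<eta> where \<eta>: "0 < \<eta>" "(\<Union>x\<in>K. ball x \<eta>) \<subseteq> U"
    using compact_subset_open_imp_ball_epsilon_subset[OF K(1) U(1)] K(2) U(2) by blast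
  have Kb [measurable]: "K \<in> sets borel" and Ub [measurable]: "U \<in> sets borel"
    using K(1) U(1) by (auto intro: compact_imp_closed borel_closed)
  define G where "G = (\<lambda>x. indicator (U - K) x :: real)"
  have UK: "emeasure lborel (U - K) \<le> ennreal d"
  proof -
    have "emeasure lborel (A - K) < ennreal (d / 2)"
    proof -
      have Kf: "emeasure lborel K < \<infinity>" using le_less_trans[OF emeasure_mono[of K A lborel]] K(2) A by simp
      have "emeasure lborel (A - K) = emeasure lborel A - emeasure lborel K"
        using Kf K(2) by (intro emeasure_Diff) auto
      then show ?thesis using K(3) Kf A d by (cases "emeasure lborel A"; cases "emeasure lborel K")
        (auto simp: ennreal_minus ennreal_less_iff ennreal_plus[symmetric] simp del: ennreal_plus intro!: ennreal_lessI)
    qed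
    moreover have "U - K = (U - A) \<union> (A - K)" using U(2) K(2) by auto
    then have "emeasure lborel (U - K) \<le> emeasure lborel (U - A) + emeasure lborel (A - K)"
      by (simp only:) (intro emeasure_subadditive, auto)
    ultimately have "emeasure lborel (U - K) \<le> ennreal (d / 2) + ennreal (d / 2)"
      using add_mono[OF U(3) less_imp_le] by (meson order_trans)
    also have "\<dots> = ennreal d" using d by (simp flip: ennreal_plus)
    finally show ?thesis .
  qed
  have m: "measure lborel (U - K) < 2 * d"
  proof -
    have "ennreal (measure lborel (U - K)) \<le> ennreal d"
      using UK by (subst emeasure_eq_ennreal_measure[symmetric]) (auto simp: top_unique)
    then show ?thesis using d by simp
  qed
  have "emeasure lborel (U - K) < \<infinity>" using UK by (rule le_less_trans) simp
  then have Gi: "integrable lborel G" unfolding G_def by (intro integrable_real_indicator) auto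
  have [measurable]: "G \<in> borel_measurable borel" unfolding G_def by measurable
  have Gy: "integrable lborel (\<lambda>x. G (x + y))" "(LINT x|lborel. G (x + y)) = (LINT x|lborel. G x)" for y
    using Gi by (simp_all add: integral_lborel_translate)
  have fi: "integrable lborel (\<lambda>x. indicator A x *\<^sub>R c)" using base by simp
  have "shift_distance (\<lambda>x. indicator A x *\<^sub>R c) y < e" if y: "norm y < \<eta>" for y
  proof -
    have nbr: "x + z \<in> U" if "x \<in> K" "norm z < \<eta>" for x z
    proof -
      have "x + z \<in> ball x \<eta>" using that(2) by (simp add: dist_norm)
      then show ?thesis using \<eta>(2) that(1) by blast
    qed
    \<comment> \<open>If only one of the two points is in \<open>A\<close>, then either it lies in
      \<open>A - K\<close>, or it lies in \<open>K\<close> and the other lies in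
      \<open>U - K\<close>.\<close>
    have "\<bar>indicator A (x + y) *\<^sub>R c - indicator A x *\<^sub>R c\<bar> \<le> \<bar>c\<bar> * (G x + G (x + y))" for x
      using nbr[of x y] nbr[of "x + y" "- y"] y U(2) K(2) by (auto simp: G_def indicator_def)
    moreover have fy: "integrable lborel (\<lambda>x. indicator A (x + y) *\<^sub>R c)"
      using fi by (subst integral_lborel_translate(2)[of "\<lambda>x. indicator A x *\<^sub>R c"]) auto
    ultimately have "shift_distance (\<lambda>x. indicator A x *\<^sub>R c) y \<le> (LINT x|lborel. \<bar>c\<bar> * (G x + G (x + y)))"
      unfolding shift_distance_def using Gi Gy
      by (intro integral_mono integrable_abs Bochner_Integration.integrable_diff fy fi) auto
    also have "\<dots> = 2 * \<bar>c\<bar> * measure lborel (U - K)"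
      using Gi Gy by (simp add: G_def)
    also have "\<dots> \<le> 2 * \<bar>c\<bar> * (2 * d)" using m by (intro mult_left_mono) auto
    also have "\<dots> < e" using base(3) by (simp add: d_def field_simps)
    finally show ?thesis .
  qed
  then show ?case using \<eta>(1) by blast
next
  case (add f g)
  obtain \<eta>1 where \<eta>1: "0 < \<eta>1" "\<And>y. norm y < \<eta>1 \<Longrightarrow> shift_distance f y < e / 2" using add.IH(1)[of "e / 2"] add.prems by auto
  obtain \<eta>2 where \<eta>2: "0 < \<eta>2" "\<And>y. norm y < \<eta>2 \<Longrightarrow> shift_distance g y < e / 2" using add.IH(2)[of "e / 2"] add.prems by auto
  have "shift_distance (\<lambda>x. f x + g x) y < e" if y: "norm y < min \<eta>1 \<eta>2" for y
  proof -
    have [measurable]: "f \<in> borel_measurable borel" "g \<in> borel_measurable borel"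
      using add.hyps by (auto dest: borel_measurable_integrable)
    have i: "integrable lborel (\<lambda>x. f (x + y))" "integrable lborel (\<lambda>x. g (x + y))"
      using add.hyps by (simp_all add: integral_lborel_translate(2))
    have "shift_distance (\<lambda>x. f x + g x) y \<le> (LINT x|lborel. \<bar>f (x + y) - f x\<bar> + \<bar>g (x + y) - g x\<bar>)"
      unfolding shift_distance_def using add.hyps i by (intro integral_mono) auto
    also have "\<dots> = shift_distance f y + shift_distance g y"
      unfolding shift_distance_def using add.hyps i by simp
    finally show ?thesis using \<eta>1(2)[of y] \<eta>2(2)[of y] y by simp
  qed
  then show ?case using \<eta>1(1) \<eta>2(1) by (intro exI[of _ "min \<eta>1 \<eta>2"]) auto
next
  case (lim f s)
  have "(\<lambda>i. LINT x|lborel. \<bar>f x - s i x\<bar>) \<longlonglongrightarrow> (LINT x|(lborel :: 'a measure). 0)"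
  proof (rule integral_dominated_convergence[where w = "\<lambda>x. 3 * \<bar>f x\<bar>"])
    show "(\<lambda>x. \<bar>f x - s i x\<bar>) \<in> borel_measurable lborel" for i
      using lim.hyps by (auto dest!: borel_measurable_integrable)
    show "integrable lborel (\<lambda>x. 3 * \<bar>f x\<bar>)" using lim.hyps by simp
    show "AE x in lborel. (\<lambda>i. \<bar>f x - s i x\<bar>) \<longlonglongrightarrow> 0"
    proof (rule AE_I2)
      fix x :: 'a
      have "(\<lambda>i. \<bar>f x - s i x\<bar>) \<longlonglongrightarrow> \<bar>f x - f x\<bar>" by (intro tendsto_intros lim.hyps) auto
      then show "(\<lambda>i. \<bar>f x - s i x\<bar>) \<longlonglongrightarrow> 0" by simp
    qed
    show "AE x in lborel. norm \<bar>f x - s i x\<bar> \<le> 3 * \<bar>f x\<bar>" for i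
    proof (rule AE_I2)
      fix x :: 'a
      have "\<bar>s i x\<bar> \<le> 2 * \<bar>f x\<bar>" using lim.hyps(3)[of x i] by simp
      then show "norm \<bar>f x - s i x\<bar> \<le> 3 * \<bar>f x\<bar>" by simp
    qed
  qed simp
  then have "(\<lambda>i. LINT x|lborel. \<bar>f x - s i x\<bar>) \<longlonglongrightarrow> 0" by simp
  from order_tendstoD(2)[OF this, of "e / 4"] obtain i where i: "(LINT x|lborel. \<bar>f x - s i x\<bar>) < e / 4"
    using lim.prems by (auto simp: eventually_sequentially)
  obtain \<eta> where \<eta>: "0 < \<eta>" "\<And>y. norm y < \<eta> \<Longrightarrow> shift_distance (s i) y < e / 2"
    using lim.IH[of "e / 2" i] lim.prems by auto
  have "shift_distance f y < e" if "norm y < \<eta>" for y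
    using shift_distance_perturb[OF lim.hyps(4) lim.hyps(1)[of i], of y] i \<eta>(2)[OF that] by simp
  then show ?case using \<eta>(1) by blast
qed

text \<open>The averaging bound \<open>ball_avg_nn_bounds\<close> for \<open>\<bar>V\<bar>\<close>,
  rescaled to radius \<open>\<rho>\<close>, replaces a covering of the ball by boxes.\<close>

lemma integrable_ball_periodic:
  fixes V :: "real ^ 'n::finite \<Rightarrow> real"
  assumes [measurable]: "V \<in> borel_measurable borel" and per: "periodic V" and int: "integrable box_measure V"
    and \<rho>: "0 < \<rho>"
  shows "integrable lborel (\<lambda>x. indicator (ball 0 \<rho>) x * V x)"
proof (rule integrableI_bounded)
  have [measurable]: "(ball 0 \<rho> :: (real ^ 'n) set) \<in> sets borel" "(ball 0 1 :: (real ^ 'n) set) \<in> sets borel" by simp_all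
  show "(\<lambda>x. indicator (ball 0 \<rho>) x * V x) \<in> borel_measurable lborel" by measurable
  define g where "g = (\<lambda>x. ennreal \<bar>V x\<bar>)"
  have [measurable]: "g \<in> borel_measurable borel" unfolding g_def by measurable
  have gp: "periodic g" using per by (simp add: g_def periodic_def)
  have "(\<integral>\<^sup>+ z. g z \<partial>box_measure) < \<infinity>"
    using int by (simp add: g_def integrable_iff_bounded)
  then have "(\<integral>\<^sup>+ z. g z \<partial>box_measure) * emeasure lborel (ball 0 (1 + real CARD('n) * pi / \<rho>) :: (real ^ 'n) set) < \<infinity>"
    using \<rho> by (simp add: emeasure_ball ennreal_mult_less_top)
  then have "(\<integral>\<^sup>+ y. g (0 + \<rho> *\<^sub>R y) \<partial>ball_measure) * ennreal ((2 * pi) ^ CARD('n)) < \<infinity>"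
    using ball_avg_nn_bounds(1)[of g \<rho> 0] gp \<rho> by (meson le_less_trans \<open>g \<in> borel_measurable borel\<close>)
  then have fin: "(\<integral>\<^sup>+ y. g (\<rho> *\<^sub>R y) \<partial>ball_measure) < \<infinity>"
    by (auto simp: ennreal_mult_less_top)
  have "(\<integral>\<^sup>+ x. g x * indicator (ball 0 \<rho>) x \<partial>lborel)
     = (\<integral>\<^sup>+ x. ennreal (\<bar>\<rho>\<bar> ^ DIM(real ^ 'n)) * (g (0 + \<rho> *\<^sub>R x) * indicator (ball 0 \<rho>) (0 + \<rho> *\<^sub>R x)) \<partial>lborel)"
    using \<rho> by (subst lborel_affine[of \<rho> 0]) (auto simp: nn_integral_density nn_integral_distr)
  also have "\<dots> = ennreal (\<rho> ^ DIM(real ^ 'n)) * (\<integral>\<^sup>+ x. g (\<rho> *\<^sub>R x) * indicator (ball 0 1) x \<partial>lborel)"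
  proof -
    have "indicator (ball 0 \<rho>) (\<rho> *\<^sub>R x) = (indicator (ball 0 1) x :: ennreal)" for x :: "real ^ 'n"
      using \<rho> by (simp add: indicator_def)
    then show ?thesis using \<rho> by (subst nn_integral_cmult) auto
  qed
  also have "\<dots> < \<infinity>" using fin by (simp add: nn_integral_ball ennreal_mult_less_top)
  finally show "(\<integral>\<^sup>+ x. ennreal (norm (indicator (ball 0 \<rho>) x * V x)) \<partial>lborel) < \<infinity>"
    by (rule le_less_trans[rotated]) (auto intro!: nn_integral_mono simp: g_def indicator_def)
qed

text \<open>Reduced to the whole space by a cutoff: the radius \<open>real CARD('n) * pi + 2\<close>
  leaves room for the box and its shifts by less than 1, on which cutoff and \<open>V\<close>
  agree.\<close>

lemma box_shift_continuous:
  fixes V :: "real ^ 'n::finite \<Rightarrow> real"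
  assumes [measurable]: "V \<in> borel_measurable borel" and per: "periodic V" and int: "integrable box_measure V"
    and e: "0 < e"
  shows "\<exists>\<eta>>0. \<forall>y. norm y < \<eta> \<longrightarrow> (\<integral>\<^sup>+ x. ennreal \<bar>V (x + y) - V x\<bar> \<partial>box_measure) \<le> ennreal e"
proof -
  define \<rho> where "\<rho> = real CARD('n) * pi + 2"
  have \<rho>: "0 < \<rho>" unfolding \<rho>_def by (intro add_nonneg_pos) auto
  define f where "f = (\<lambda>x :: real ^ 'n. indicator (ball 0 \<rho>) x * V x)"
  have f: "integrable lborel f" unfolding f_def by (rule integrable_ball_periodic[OF assms(1-3) \<rho>])
  then have [measurable]: "f \<in> borel_measurable borel" by (auto dest: borel_measurable_integrable)
  obtain \<eta> where \<eta>: "0 < \<eta>" "\<And>y. norm y < \<eta> \<Longrightarrow> shift_distance f y < e"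
    using shift_distance_tendsto_0[OF f e] by blast
  have "(\<integral>\<^sup>+ x. ennreal \<bar>V (x + y) - V x\<bar> \<partial>box_measure) \<le> ennreal e" if y: "norm y < min \<eta> 1" for y
  proof -
    have "(\<integral>\<^sup>+ x. ennreal \<bar>V (x + y) - V x\<bar> \<partial>box_measure) \<le> (\<integral>\<^sup>+ x. ennreal \<bar>f (x + y) - f x\<bar> \<partial>lborel)"
      unfolding nn_integral_box
    proof (intro nn_integral_mono)
      fix x :: "real ^ 'n"
      show "ennreal \<bar>V (x + y) - V x\<bar> * indicator torus_box x \<le> ennreal \<bar>f (x + y) - f x\<bar>"
      proof (cases "x \<in> torus_box")
        case True
        have "norm x < \<rho>" "norm (x + y) < \<rho>"
          using norm_torus_box[OF True] norm_triangle_ineq[of x y] y by (auto simp: \<rho>_def)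
        then show ?thesis by (simp add: f_def True)
      qed simp
    qed
    also have "\<dots> = ennreal (shift_distance f y)"
      unfolding shift_distance_def using f
      by (intro nn_integral_eq_integral) (auto simp: integral_lborel_translate(2))
    also have "\<dots> \<le> ennreal e" using \<eta>(2)[of y] y by (intro ennreal_leI) auto
    finally show ?thesis .
  qed
  then show ?thesis using \<eta>(1) by (intro exI[of _ "min \<eta> 1"]) auto
qed


section \<open>Mollifiers and their Fourier series\<close>

definition mollifier :: "real \<Rightarrow> real ^ 'n::finite \<Rightarrow> real" where
  "mollifier \<delta> x = bump \<delta> x / (LINT y|(box_measure :: (real ^ 'n) measure). bump \<delta> y)"

lemma bump_continuous: "continuous_on UNIV (bump \<delta>)"
  using bump_Ck[where m = 0 and \<delta> = \<delta> and x = 0] by simp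

lemma bump_integral_pos:
  assumes "0 < \<delta>" shows "0 < (LINT y|(box_measure :: (real ^ 'n::finite) measure). bump \<delta> y)"
proof (rule ccontr)
  let ?B = "box_measure :: (real ^ 'n) measure"
  assume "\<not> ?thesis"
  moreover have nonneg: "0 \<le> (LINT y|?B. bump \<delta> y)" by (intro integral_nonneg_AE AE_I2 bump_nonneg)
  ultimately have "(LINT y|?B. bump \<delta> y) = 0" by simp
  then have "AE y in ?B. bump \<delta> y = 0"
    by (subst (asm) integral_nonneg_eq_0_iff_AE)
      (auto intro!: integrable_box_periodic bump_continuous bump_periodic bump_nonneg)
  then have ae: "AE y :: real ^ 'n in lborel. y \<in> torus_box \<longrightarrow> bump \<delta> y = 0"
    unfolding box_measure_def by (subst (asm) AE_restrict_space_iff) auto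
  define U where "U = one_sub_cos -` {..< \<delta>} \<inter> box (\<chi> i. - pi) (\<chi> i. pi) \<inter> (UNIV :: (real ^ 'n) set)"
  have "open U" unfolding U_def by (intro open_Int open_vimage one_sub_cos_continuous) auto
  moreover have "0 \<in> U" using assms by (simp add: U_def mem_box_cart)
  ultimately obtain \<epsilon> where \<epsilon>: "0 < \<epsilon>" "ball 0 \<epsilon> \<subseteq> U" by (metis open_contains_ball)
  have "AE y :: real ^ 'n in lborel. y \<notin> ball 0 \<epsilon>"
    using ae
  proof (eventually_elim, intro notI)
    fix y :: "real ^ 'n" assume y: "y \<in> torus_box \<longrightarrow> bump \<delta> y = 0" "y \<in> ball 0 \<epsilon>"
    then have "y \<in> U" using \<epsilon>(2) by auto
    then have "one_sub_cos y < \<delta>" "y \<in> torus_box"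
      by (auto simp: U_def torus_box_def mem_box_cart less_imp_le)
    then show False using y(1) bump_pos_iff[of \<delta> y] by simp
  qed
  then have "emeasure lborel (ball 0 \<epsilon> :: (real ^ 'n) set) = 0"
    by (subst (asm) AE_iff_measurable[of "ball 0 \<epsilon>"]) auto
  then show False using content_ball_pos[OF \<epsilon>(1), of "0 :: real ^ 'n"] by (simp add: measure_def)
qed

lemma mollifier_nonneg: "0 \<le> mollifier \<delta> x"
  unfolding mollifier_def
  by (rule divide_nonneg_nonneg[OF bump_nonneg Bochner_Integration.integral_nonneg]) (rule bump_nonneg)

lemma mollifier_continuous: "continuous_on UNIV (mollifier \<delta>)"
  unfolding mollifier_def[abs_def] divide_inverse by (intro continuous_intros bump_continuous)

lemma mollifier_measurable [measurable]: "mollifier \<delta> \<in> borel_measurable borel"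
  by (intro continuous_borel mollifier_continuous)

lemma mollifier_periodic: "periodic (mollifier \<delta>)"
  by (simp add: mollifier_def periodic_def periodicD[OF bump_periodic])

lemma mollifier_Ck: "Ck m (\<lambda>z. mollifier \<delta> (z - x))"
  unfolding mollifier_def divide_inverse by (intro Ck_mult bump_Ck Ck_const)

lemma mollifier_integral:
  assumes "0 < \<delta>" shows "(LINT y|(box_measure :: (real ^ 'n::finite) measure). mollifier \<delta> y) = 1"
  using bump_integral_pos[OF assms, where 'n = 'n] by (simp add: mollifier_def)

lemma mollifier_eq_0: "\<delta> \<le> one_sub_cos x \<Longrightarrow> mollifier \<delta> x = 0"
  using bump_pos_iff[of \<delta> x] bump_nonneg[of \<delta> x] by (simp add: mollifier_def)

text \<open>The value at \<open>x\<close> is the pairing of \<open>V\<close> with the smooth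
  function centred at \<open>x\<close>, exactly the form in which the weak equation can be
  tested.\<close>

definition mollify :: "real \<Rightarrow> (real ^ 'n::finite \<Rightarrow> real) \<Rightarrow> real ^ 'n \<Rightarrow> real" where
  "mollify \<delta> V x = (LINT z|box_measure. V z * mollifier \<delta> (z - x))"

lemma mollifier_translate_continuous: "continuous_on UNIV (\<lambda>z. mollifier \<delta> (z - x))"
  by (rule continuous_on_compose2[OF mollifier_continuous]) (auto intro!: continuous_intros)

lemma mollifier_translate_periodic: "periodic (\<lambda>z. mollifier \<delta> (z - x))"
  using periodic_translate[OF mollifier_periodic, of \<delta> "- x"] by simp

lemma integrable_box_mult_continuous:
  fixes V :: "real ^ 'n::finite \<Rightarrow> real" and g :: "real ^ 'n \<Rightarrow> 'b::{banach, second_countable_topology, real_normed_algebra_1}"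
  assumes V: "integrable box_measure V" and g: "continuous_on UNIV g" "periodic g"
  shows "integrable box_measure (\<lambda>z. V z *\<^sub>R g z)"
proof -
  obtain M where M: "\<And>x. norm (g x) \<le> M" "0 \<le> M" using periodic_bounded[OF g] by metis
  have [measurable]: "g \<in> borel_measurable borel" using g by blast
  have [measurable]: "V \<in> borel_measurable box_measure" using V by (rule borel_measurable_integrable)
  have "g \<in> borel_measurable box_measure" by measurable
  show ?thesis
  proof (rule Bochner_Integration.integrable_bound[of box_measure "\<lambda>z. M * V z"])
    show "integrable box_measure (\<lambda>z. M * V z)" using V by simp
    show "AE z in box_measure. norm (V z *\<^sub>R g z) \<le> norm (M * V z)"
      using M by (intro AE_I2) (simp add: abs_mult mult.commute[of M] mult_left_mono)
  qed (use \<open>g \<in> borel_measurable box_measure\<close> in measurable)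
qed

lemma mollify_shifted:
  assumes [measurable]: "V \<in> borel_measurable borel" and per: "periodic V"
  shows "mollify \<delta> V x = (LINT y|box_measure. V (y + x) * mollifier \<delta> y)"
proof -
  have p: "periodic (\<lambda>z. V z * mollifier \<delta> (z - x))"
    using per mollifier_translate_periodic[of \<delta> x] by (simp add: periodic_def)
  have "(LINT y|box_measure. V (y + x) * mollifier \<delta> (y + x - x)) = mollify \<delta> V x"
    unfolding mollify_def by (rule integral_box_translate(1)[OF _ p]) measurable
  then show ?thesis by simp
qed

lemma borel_pair_box_measurable:
  assumes "f \<in> borel_measurable (borel \<Otimes>\<^sub>M borel)"
  shows "f \<in> borel_measurable (box_measure \<Otimes>\<^sub>M box_measure)"
proof -
  have id: "(\<lambda>x. x) \<in> measurable box_measure borel" by (rule measurable_box_measureI) simp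
  have "(\<lambda>p. (fst p, snd p)) \<in> measurable (box_measure \<Otimes>\<^sub>M box_measure) (borel \<Otimes>\<^sub>M borel)"
    by (intro measurable_Pair measurable_compose[OF measurable_fst id] measurable_compose[OF measurable_snd id])
  from measurable_compose[OF this assms] show ?thesis by simp
qed

text \<open>As the mollifier has integral 1, the error at \<open>x\<close> is an average of
  \<open>V (x + y) - V x\<close> over small \<open>y\<close>; Fubini reduces its L1 norm to that of
  the translations.\<close>

lemma mollify_L1_close:
  fixes V :: "real ^ 'n::finite \<Rightarrow> real"
  assumes [measurable]: "V \<in> borel_measurable borel" and per: "periodic V" and int: "integrable box_measure V"
    and e: "0 < e"
  shows "\<exists>\<delta>0>0. \<forall>\<delta>. 0 < \<delta> \<and> \<delta> < \<delta>0 \<longrightarrow> (\<integral>\<^sup>+ x. ennreal \<bar>mollify \<delta> V x - V x\<bar> \<partial>box_measure) \<le> ennreal e"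
proof -
  let ?B = "box_measure :: (real ^ 'n) measure"
  obtain \<eta> where \<eta>: "0 < \<eta>" "\<And>y. norm y < \<eta> \<Longrightarrow> (\<integral>\<^sup>+ x. ennreal \<bar>V (x + y) - V x\<bar> \<partial>?B) \<le> ennreal e"
    using box_shift_continuous[OF assms] by blast
  obtain \<delta>0 where \<delta>0: "0 < \<delta>0" "\<And>x :: real ^ 'n. x \<in> torus_box \<Longrightarrow> one_sub_cos x < \<delta>0 \<Longrightarrow> norm x < \<eta>"
    using one_sub_cos_separates[OF \<eta>(1)] by metis
  interpret P: pair_sigma_finite ?B ?B ..
  have "(\<integral>\<^sup>+ x. ennreal \<bar>mollify \<delta> V x - V x\<bar> \<partial>?B) \<le> ennreal e" if \<delta>: "0 < \<delta>" "\<delta> < \<delta>0" for \<delta>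
  proof -
    let ?m = "mollifier \<delta> :: real ^ 'n \<Rightarrow> real"
    have mi: "integrable ?B ?m" by (rule integrable_box_periodic[OF mollifier_continuous mollifier_periodic])
    have "ennreal \<bar>mollify \<delta> V x - V x\<bar> \<le> (\<integral>\<^sup>+ y. ennreal (\<bar>V (x + y) - V x\<bar> * ?m y) \<partial>?B)" for x
    proof -
      have Vx: "integrable ?B (\<lambda>y. V (y + x))" using int by (simp add: integral_box_translate(2)[OF _ per])
      have i: "integrable ?B (\<lambda>y. V (y + x) * ?m y)"
        using integrable_box_mult_continuous[OF Vx mollifier_continuous mollifier_periodic] by simp
      have "mollify \<delta> V x - V x = (LINT y|?B. V (y + x) * ?m y) - (LINT y|?B. V x * ?m y)"
        by (simp add: mollify_shifted[OF _ per] mollifier_integral[OF \<delta>(1)])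
      also have "\<dots> = (LINT y|?B. (V (x + y) - V x) * ?m y)"
        using i mi by (simp add: left_diff_distrib add.commute)
      finally have "ennreal \<bar>mollify \<delta> V x - V x\<bar> = ennreal (norm (LINT y|?B. (V (x + y) - V x) * ?m y))" by simp
      also have "\<dots> \<le> (\<integral>\<^sup>+ y. ennreal (norm ((V (x + y) - V x) * ?m y)) \<partial>?B)"
        using i mi by (intro integral_norm_bound_ennreal) (simp add: left_diff_distrib add.commute)
      finally show ?thesis by (simp add: abs_mult mollifier_nonneg)
    qed
    then have "(\<integral>\<^sup>+ x. ennreal \<bar>mollify \<delta> V x - V x\<bar> \<partial>?B) \<le> (\<integral>\<^sup>+ x. (\<integral>\<^sup>+ y. ennreal (\<bar>V (x + y) - V x\<bar> * ?m y) \<partial>?B) \<partial>?B)"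
      by (intro nn_integral_mono)
    also have "\<dots> = (\<integral>\<^sup>+ y. (\<integral>\<^sup>+ x. ennreal (\<bar>V (x + y) - V x\<bar> * ?m y) \<partial>?B) \<partial>?B)"
      by (rule P.Fubini'[symmetric], rule borel_pair_box_measurable) measurable
    also have "\<dots> = (\<integral>\<^sup>+ y. (\<integral>\<^sup>+ x. ennreal \<bar>V (x + y) - V x\<bar> \<partial>?B) * ennreal (?m y) \<partial>?B)"
      by (simp add: ennreal_mult mollifier_nonneg nn_integral_multc)
    also have "\<dots> \<le> (\<integral>\<^sup>+ y. ennreal e * ennreal (?m y) \<partial>?B)"
    proof (rule nn_integral_mono)
      fix y assume y: "y \<in> space ?B"
      show "(\<integral>\<^sup>+ x. ennreal \<bar>V (x + y) - V x\<bar> \<partial>?B) * ennreal (?m y) \<le> ennreal e * ennreal (?m y)"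
      proof (cases "one_sub_cos y < \<delta>")
        case True
        then have "norm y < \<eta>" using \<delta>0(2)[of y] \<delta> y by simp
        then show ?thesis using \<eta>(2)[of y] by (intro mult_right_mono) auto
      qed (simp add: mollifier_eq_0)
    qed
    also have "\<dots> = ennreal e * ennreal (LINT y|?B. ?m y)"
      using mi by (simp add: nn_integral_cmult nn_integral_eq_integral mollifier_nonneg)
    finally show ?thesis by (simp add: mollifier_integral[OF \<delta>(1)])
  qed
  then show ?thesis using \<delta>0(1) by blast
qed

text \<open>The usual Fourier coefficient of index \<open>k\<close>; the sign change undoes the
  convention of \<open>box_coeff\<close>.\<close>

definition mollifier_coeff :: "real \<Rightarrow> int ^ 'n::finite \<Rightarrow> complex" where
  "mollifier_coeff \<delta> k = box_coeff (mollifier \<delta>) (- k) / (2 * pi) ^ CARD('n)"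

lemma mollifier_coeff_summable:
  assumes "0 < \<sigma>" "\<sigma> < 1"
  shows "(\<lambda>k :: int ^ 'n::finite. norm (mollifier_coeff \<delta> k) * (1 + norm (freq k) powr (2 * \<sigma>))) summable_on UNIV"
proof -
  have "Ck m (mollifier \<delta>)" for m using mollifier_Ck[where m = m and \<delta> = \<delta> and x = 0] by simp
  from smooth_coeff_summable[OF this mollifier_periodic assms]
  have "(\<lambda>k. norm (box_coeff (mollifier \<delta>) k) * (1 + norm (freq k) powr (2 * \<sigma>))) summable_on (UNIV :: (int ^ 'n) set)" .
  then have "(\<lambda>k. norm (box_coeff (mollifier \<delta>) (- k)) * (1 + norm (freq (- k)) powr (2 * \<sigma>))) summable_on (UNIV :: (int ^ 'n) set)"
    using summable_on_reindex_bij_betw[of uminus UNIV UNIV "\<lambda>k :: int ^ 'n. norm (box_coeff (mollifier \<delta>) k) * (1 + norm (freq k) powr (2 * \<sigma>))"]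
    by (simp add: bij_uminus)
  then have "(\<lambda>k. norm (box_coeff (mollifier \<delta>) (- k)) * (1 + norm (freq (- k)) powr (2 * \<sigma>)) * inverse ((2 * pi) ^ CARD('n))) summable_on (UNIV :: (int ^ 'n) set)"
    by (rule summable_on_cmult_left)
  moreover have "norm (mollifier_coeff \<delta> k) = norm (box_coeff (mollifier \<delta>) (- k)) * inverse ((2 * pi) ^ CARD('n))" for k :: "int ^ 'n"
    by (simp add: mollifier_coeff_def norm_divide norm_power norm_mult divide_inverse norm_inverse)
  ultimately show ?thesis by (simp add: freq_minus mult_ac)
qed

lemma mollifier_coeff_abs_summable: "(\<lambda>k. norm (mollifier_coeff \<delta> k)) summable_on UNIV"
  by (rule summable_on_comparison_test[OF mollifier_coeff_summable[of "1 / 2" \<delta>]])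
    (auto simp: algebra_simps)

lemma mollifier_series:
  "complex_of_real (mollifier \<delta> y) = (\<Sum>\<^sub>\<infinity>k. mollifier_coeff \<delta> k * echar k y)" for y :: "real ^ 'n::finite"
proof -
  let ?g = "\<lambda>x :: real ^ 'n. complex_of_real (mollifier \<delta> x)"
  have s: "(\<lambda>k. norm (LINT x|box_measure. ?g x * echar k x)) summable_on UNIV"
  proof -
    have "Ck m (mollifier \<delta> :: real ^ 'n \<Rightarrow> real)" for m using mollifier_Ck[where m = m and \<delta> = \<delta> and x = 0] by simp
    from smooth_coeff_summable[OF this mollifier_periodic, of "1 / 2"]
    have "(\<lambda>k. norm (box_coeff (mollifier \<delta> :: real ^ 'n \<Rightarrow> real) k) * (1 + norm (freq k) powr (2 * (1 / 2)))) summable_on UNIV" by simp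
    then show ?thesis unfolding box_coeff_def
      by (rule summable_on_comparison_test) (auto simp: algebra_simps)
  qed
  have "?g y = (\<Sum>\<^sub>\<infinity>k. box_coeff (mollifier \<delta>) k / (2 * pi) ^ CARD('n) * echar (- k) y)"
    unfolding box_coeff_def using mollifier_periodic[of \<delta>]
    by (intro fourier_inversion[OF _ _ s] continuous_intros mollifier_continuous) (simp add: periodic_def)
  also have "\<dots> = (\<Sum>\<^sub>\<infinity>k. box_coeff (mollifier \<delta>) (- k) / (2 * pi) ^ CARD('n) * echar (- (- k)) y)"
    by (rule infsum_reindex_bij_betw[OF bij_uminus, symmetric])
  finally show ?thesis by (simp add: mollifier_coeff_def)
qed

text \<open>Termwise integration. For \<open>V\<close> merely integrable its coefficients are only
  bounded, and convergence rests on \<open>c\<close>.\<close>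

lemma integral_mult_series:
  fixes V :: "real ^ 'n::finite \<Rightarrow> real"
  assumes V: "integrable box_measure V" and c: "(\<lambda>k. norm (c k)) summable_on UNIV"
  shows "(LINT z|box_measure. complex_of_real (V z) * (\<Sum>\<^sub>\<infinity>k. c k * echar k z)) = (\<Sum>\<^sub>\<infinity>k. c k * box_coeff V k)"
proof -
  have i: "integrable box_measure (\<lambda>z. complex_of_real (V z) * echar k z)" for k
    using integrable_box_mult_continuous[OF V echar_continuous echar_periodic, of k] by (simp add: scaleR_conv_of_real)
  have "(LINT z|box_measure. (\<Sum>\<^sub>\<infinity>k. c k * (complex_of_real (V z) * echar k z))) = (\<Sum>\<^sub>\<infinity>k. LINT z|box_measure. c k * (complex_of_real (V z) * echar k z))"
  proof (rule has_bochner_integral_integral_eq, rule has_bochner_integral_infsum[OF infinite_UNIV_int_vec])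
    show "integrable box_measure (\<lambda>z. c k * (complex_of_real (V z) * echar k z))" for k using i by simp
    show "(\<lambda>k. LINT z|box_measure. norm (c k * (complex_of_real (V z) * echar k z))) summable_on UNIV"
      by (simp add: norm_mult summable_on_cmult_left[OF c])
    show "(\<lambda>k. norm (c k * (complex_of_real (V z) * echar k z))) summable_on UNIV" for z
      by (simp add: norm_mult summable_on_cmult_left[OF c])
  qed
  moreover have "complex_of_real (V z) * (\<Sum>\<^sub>\<infinity>k. c k * echar k z) = (\<Sum>\<^sub>\<infinity>k. c k * (complex_of_real (V z) * echar k z))" for z
    by (simp add: infsum_cmult_right'[symmetric] mult.left_commute)
  ultimately show ?thesis by (simp add: box_coeff_def)
qed

lemma echar_neg: "echar k (- x) = echar (- k) x"
  by (simp add: echar_def freq_minus)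

text \<open>Expanding the translated mollifier in \<open>z\<close> and pairing with \<open>V\<close>
  multiplies the coefficients, as for any convolution.\<close>

lemma mollify_series:
  fixes V :: "real ^ 'n::finite \<Rightarrow> real"
  assumes V: "integrable box_measure V"
  shows "complex_of_real (mollify \<delta> V x) = (\<Sum>\<^sub>\<infinity>k. mollifier_coeff \<delta> k * box_coeff V k * echar (- k) x)"
proof -
  have "complex_of_real (mollify \<delta> V x) = (LINT z|box_measure. complex_of_real (V z) * complex_of_real (mollifier \<delta> (z - x)))"
    unfolding mollify_def by (subst integral_complex_of_real[symmetric]) simp
  also have "\<dots> = (LINT z|box_measure. complex_of_real (V z) * (\<Sum>\<^sub>\<infinity>k. (mollifier_coeff \<delta> k * echar (- k) x) * echar k z))"
    using echar_add[of _ _ "- x"] by (simp add: mollifier_series echar_neg mult_ac)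
  also have "\<dots> = (\<Sum>\<^sub>\<infinity>k. (mollifier_coeff \<delta> k * echar (- k) x) * box_coeff V k)"
    by (rule integral_mult_series[OF V]) (simp add: norm_mult mollifier_coeff_abs_summable)
  finally show ?thesis by (simp add: mult_ac)
qed

lemma norm_box_coeff_integrable:
  "norm (box_coeff V k) \<le> (LINT z|box_measure. \<bar>V z\<bar>)"
proof -
  have "norm (box_coeff V k) \<le> (LINT z|box_measure. norm (complex_of_real (V z) * echar k z))"
    unfolding box_coeff_def by (rule integral_norm_bound)
  then show ?thesis by (simp add: norm_mult)
qed

lemma mollify_coeff_summable:
  fixes V :: "real ^ 'n::finite \<Rightarrow> real"
  assumes \<sigma>: "0 < \<sigma>" "\<sigma> < 1"
  shows "(\<lambda>k. norm (mollifier_coeff \<delta> k * box_coeff V k) * (1 + norm (freq k) powr (2 * \<sigma>))) summable_on UNIV"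
proof (rule summable_on_comparison_test)
  let ?N = "LINT z|box_measure. \<bar>V z\<bar>"
  show "(\<lambda>k :: int ^ 'n. norm (mollifier_coeff \<delta> k) * (1 + norm (freq k) powr (2 * \<sigma>)) * ?N) summable_on UNIV"
    by (rule summable_on_cmult_left[OF mollifier_coeff_summable[OF \<sigma>]])
  fix k :: "int ^ 'n"
  have "norm (mollifier_coeff \<delta> k) * (1 + norm (freq k) powr (2 * \<sigma>)) * norm (box_coeff V k)
     \<le> norm (mollifier_coeff \<delta> k) * (1 + norm (freq k) powr (2 * \<sigma>)) * ?N"
    by (intro mult_left_mono norm_box_coeff_integrable) auto
  then show "norm (mollifier_coeff \<delta> k * box_coeff V k) * (1 + norm (freq k) powr (2 * \<sigma>))
     \<le> norm (mollifier_coeff \<delta> k) * (1 + norm (freq k) powr (2 * \<sigma>)) * ?N"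
    by (simp add: norm_mult mult_ac)
qed (auto intro!: mult_nonneg_nonneg add_nonneg_nonneg)

lemma mollify_continuous:
  fixes V :: "real ^ 'n::finite \<Rightarrow> real"
  assumes V: "integrable box_measure V"
  shows "continuous_on UNIV (mollify \<delta> V)"
proof -
  have "(\<lambda>k. norm (mollifier_coeff \<delta> k * box_coeff V k)) summable_on UNIV"
    by (rule summable_on_comparison_test[OF mollify_coeff_summable[of "1 / 2" \<delta> V]])
      (auto simp: algebra_simps)
  from continuous_on_Re[OF fourier_series_continuous[OF this]]
  have "continuous_on UNIV (\<lambda>x. Re (complex_of_real (mollify \<delta> V x)))"
    by (simp only: mollify_series[OF V])
  then show ?thesis by simp
qed

lemma mollify_periodic:
  fixes V :: "real ^ 'n::finite \<Rightarrow> real"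
  shows "periodic (mollify \<delta> V)"
proof -
  have "mollifier \<delta> (z - (x + (2 * pi) *\<^sub>R freq m)) = mollifier \<delta> (z - x)" for z x :: "real ^ 'n" and m
    using periodicD[OF mollifier_periodic, of \<delta> "z - x" "- m"] by (simp add: freq_minus algebra_simps)
  then show ?thesis by (simp add: periodic_def mollify_def)
qed


subsection \<open>Weak solutions on the torus\<close>

lemma torus_proj_eq_iff: "torus_proj x = torus_proj y \<longleftrightarrow> (\<exists>m. x = y + (2 * pi) *\<^sub>R freq m)"
proof -
  have "torus_proj x = torus_proj y \<longleftrightarrow> torus_rel x y" by (simp add: torus.abs_eq_iff)
  also have "\<dots> \<longleftrightarrow> (\<exists>m. x = y + (2 * pi) *\<^sub>R freq m)"
    unfolding torus_rel_def by (simp add: vec_eq_iff algebra_simps)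
  finally show ?thesis .
qed

lemma torus_proj_rep [simp]: "torus_proj (rep_torus t) = t"
  using Quotient3_torus by (rule Quotient3_abs_rep)

lemma periodic_rep:
  assumes "periodic f" shows "f (rep_torus (torus_proj x)) = f x"
proof -
  have "torus_proj (rep_torus (torus_proj x)) = torus_proj x" by simp
  then obtain m where "rep_torus (torus_proj x) = x + (2 * pi) *\<^sub>R freq m"
    unfolding torus_proj_eq_iff by blast
  then show ?thesis by (simp add: periodicD[OF assms])
qed

lemma open_torus_iff: "open U \<longleftrightarrow> open (torus_proj -` U)"
  by (rule open_torus_def)

lemma torus_proj_measurable [measurable]: "torus_proj \<in> measurable borel borel"
  by (intro borel_measurable_continuous_onI) (auto simp: continuous_on_open_vimage open_torus_iff)

lemma continuous_on_torusI:
  assumes "continuous_on UNIV (\<lambda>x. f (torus_proj x))"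
  shows "continuous_on UNIV f"
proof -
  have "open (f -` B)" if "open B" for B
    using assms that by (simp add: continuous_on_open_vimage open_torus_iff vimage_comp o_def)
  then show ?thesis by (simp add: continuous_on_open_vimage)
qed

lemma torus_measure_alt: "torus_measure = distr box_measure borel torus_proj"
  by (simp add: torus_measure_def box_measure_def)

lemma sets_torus_measure [measurable_cong]: "sets torus_measure = sets borel"
  by (simp add: torus_measure_def)

lemma integral_torus:
  fixes f :: "'n::finite torus \<Rightarrow> 'b::{banach, second_countable_topology}"
  assumes "f \<in> borel_measurable borel"
  shows "(LINT z|torus_measure. f z) = (LINT x|box_measure. f (torus_proj x))"
    and "integrable torus_measure f \<longleftrightarrow> integrable box_measure (\<lambda>x. f (torus_proj x))"
  unfolding torus_measure_alt using assms by (simp_all add: integral_distr integrable_distr_eq)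

lemma fourier_char_measurable [measurable]: "fourier_char k \<in> borel_measurable borel"
  by (intro borel_measurable_continuous_onI continuous_on_torusI) (simp add: fourier_char_proj continuous_intros)

lemma torus_L2_integrable:
  assumes "v \<in> torus_L2"
  shows "v \<in> borel_measurable borel" "integrable box_measure (\<lambda>x. v (torus_proj x))"
proof -
  show v [measurable]: "v \<in> borel_measurable borel" using assms by (simp add: torus_L2_def measurable_cong_sets[OF sets_torus_measure refl])
  have "integrable torus_measure (\<lambda>z. (v z)\<^sup>2)" using assms by (simp add: torus_L2_def)
  then have "integrable box_measure (\<lambda>x. (v (torus_proj x))\<^sup>2)" by (subst (asm) integral_torus(2)) measurable
  then have "integrable box_measure (\<lambda>x. 1 + (v (torus_proj x))\<^sup>2)" by simp
  then show "integrable box_measure (\<lambda>x. v (torus_proj x))"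
  proof (rule Bochner_Integration.integrable_bound)
    show "AE x in box_measure. norm (v (torus_proj x)) \<le> norm (1 + (v (torus_proj x))\<^sup>2)"
    proof (rule AE_I2)
      fix x
      have "0 \<le> (\<bar>v (torus_proj x)\<bar> - 1)\<^sup>2" by simp
      then have "2 * \<bar>v (torus_proj x)\<bar> \<le> 1 + (v (torus_proj x))\<^sup>2" by (simp add: power2_diff)
      then show "norm (v (torus_proj x)) \<le> norm (1 + (v (torus_proj x))\<^sup>2)" by simp
    qed
  qed measurable
qed

text \<open>The weak equation is tested against the mollifier centred at \<open>x\<close>. Moving
  the symbol from the test function to the product of coefficients turns the pairing into the
  Fourier series of the fractional Laplacian of the mollified function at \<open>x\<close>, whose
  vanishing is what \<open>balanced_fourier_series\<close> asks for.\<close>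

lemma mollify_balanced:
  fixes v :: "'n::finite torus \<Rightarrow> real"
  assumes \<sigma>: "0 < \<sigma>" "\<sigma> < 1" and v: "v \<in> torus_L2" and harm: "frac_harmonic_on \<sigma> \<O> v"
    and \<delta>: "\<And>w :: real ^ 'n. w \<in> torus_box \<Longrightarrow> one_sub_cos w < 2 * \<delta> \<Longrightarrow> norm w < r" "0 < \<delta>"
    and sub: "ball x r \<subseteq> torus_proj -` \<O>"
  shows "balanced \<sigma> (mollify \<delta> (\<lambda>x. v (torus_proj x))) x"
proof -
  define V where "V = (\<lambda>x. v (torus_proj x))"
  note vm [measurable] = torus_L2_integrable(1)[OF v]
  have V: "integrable box_measure V" unfolding V_def by (rule torus_L2_integrable(2)[OF v])
  let ?r = "mollifier_coeff \<delta> :: int ^ 'n \<Rightarrow> complex"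
  define \<phi> where "\<phi> = (\<lambda>t. mollifier \<delta> (rep_torus t - x))"
  have \<phi>: "\<phi> (torus_proj z) = mollifier \<delta> (z - x)" for z
    unfolding \<phi>_def by (rule periodic_rep[OF mollifier_translate_periodic])
  have \<phi>c: "continuous_on UNIV \<phi>"
    by (rule continuous_on_torusI) (simp add: \<phi> mollifier_translate_continuous)
  then have [measurable]: "\<phi> \<in> borel_measurable borel" by (rule borel_measurable_continuous_onI)
  have smooth: "torus_smooth \<phi>" by (simp add: torus_smooth_def \<phi> mollifier_Ck)
  have support: "closure {z. \<phi> z \<noteq> 0} \<subseteq> \<O>"
  proof -
    \<comment> \<open>The closure of the support forces the nonstrict inequality; the factor 2 in
      the assumption on \<open>\<delta>\<close> leaves room for it.\<close>
    define S where "S = {t. one_sub_cos (rep_torus t - x) \<le> \<delta>}"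
    have pS: "torus_proj -` S = {z. one_sub_cos (z - x) \<le> \<delta>}"
      using periodic_rep[OF periodic_translate[OF one_sub_cos_periodic, of "- x"]] by (auto simp: S_def)
    have "closed {z. one_sub_cos (z - x) \<le> \<delta>}"
      by (intro closed_Collect_le continuous_on_const continuous_on_compose2[OF one_sub_cos_continuous]) (auto intro!: continuous_intros)
    then have "closed S" by (simp add: closed_def open_torus_iff vimage_Compl pS)
    moreover have "{z. \<phi> z \<noteq> 0} \<subseteq> S"
    proof
      fix t assume "t \<in> {z. \<phi> z \<noteq> 0}"
      then show "t \<in> S"
        using mollifier_eq_0[of \<delta> "rep_torus t - x"] unfolding \<phi>_def S_def mem_Collect_eq by linarith
    qed
    moreover have "S \<subseteq> \<O>"
    proof
      fix t assume t: "t \<in> S"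
      define z where "z = rep_torus t"
      have "one_sub_cos (z - x) \<le> \<delta>" using t by (simp add: S_def z_def)
      \<comment> \<open>The smallness assumption speaks of points of the box only, so
        \<open>z - x\<close> is replaced by its representative; \<open>x + w\<close> and
        \<open>z\<close> have the same projection.\<close>
      moreover define w where "w = box_reduce (z - x)"
      ultimately have "one_sub_cos w < 2 * \<delta>" using \<delta>(2) by (simp add: periodic_reduce[OF one_sub_cos_periodic])
      then have "norm w < r" using \<delta>(1)[of w] box_reduce_in_box[of "z - x"] by (simp add: w_def)
      then have "x + w \<in> torus_proj -` \<O>" using sub by (auto simp: dist_norm subset_iff)
      moreover have "torus_proj (x + w) = torus_proj z"
      proof -
        have "torus_proj (x + box_reduce (z - x)) = torus_proj (x + (z - x))"
          by (rule periodic_reduce[of "\<lambda>y. torus_proj (x + y)"])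
            (simp add: periodic_def add.assoc[symmetric] torus_proj_periodic)
        then show ?thesis by (simp add: w_def)
      qed
      ultimately show "t \<in> \<O>" by (simp add: z_def)
    qed
    ultimately show ?thesis by (meson closure_minimal order_trans)
  qed
  have coeff: "fourier_coeff k \<phi> = ?r k * echar (- k) x" for k
  proof -
    have "fourier_coeff k \<phi> = box_coeff (\<lambda>z. mollifier \<delta> (z + - x)) (- k) / (2 * pi) ^ CARD('n)"
      unfolding fourier_coeff_def box_coeff_def
      by (subst integral_torus(1)) (simp_all add: \<phi> fourier_char_proj)
    also have "box_coeff (\<lambda>z. mollifier \<delta> (z + - x)) (- k) = echar (- (- k)) (- x) * box_coeff (mollifier \<delta>) (- k)"
      by (rule box_coeff_translate[OF mollifier_continuous mollifier_periodic])
    finally show ?thesis by (simp add: mollifier_coeff_def echar_neg)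
  qed
  \<comment> \<open>The coefficients of the fractional Laplacian of the test function.\<close>
  define c where "c = (\<lambda>k. norm (freq k) powr (2 * \<sigma>) * ?r k * echar (- k) x)"
  have c: "(\<lambda>k. norm (c k)) summable_on UNIV"
    by (rule summable_on_comparison_test[OF mollifier_coeff_summable[OF \<sigma>, of \<delta>]])
      (auto simp: c_def norm_mult algebra_simps)
  have fl: "frac_laplacian \<sigma> \<phi> (torus_proj z) = (\<Sum>\<^sub>\<infinity>k. c k * echar k z)" for z
    by (simp add: frac_laplacian_def coeff fourier_char_proj c_def mult.assoc)
  have flc: "continuous_on UNIV (\<lambda>z. frac_laplacian \<sigma> \<phi> (torus_proj z))"
  proof -
    have "(\<lambda>k. norm (c (- k))) summable_on UNIV"
      using c summable_on_reindex_bij_betw[OF bij_uminus, of "\<lambda>k. norm (c k)"] by simp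
    from fourier_series_continuous[OF this]
    have "continuous_on UNIV (\<lambda>z. \<Sum>\<^sub>\<infinity>k. c (- k) * echar (- k) z)" .
    moreover have "(\<Sum>\<^sub>\<infinity>k. c (- k) * echar (- k) z) = (\<Sum>\<^sub>\<infinity>k. c k * echar k z)" for z
      by (rule infsum_reindex_bij_betw[OF bij_uminus])
    ultimately show ?thesis by (simp add: fl)
  qed
  then have [measurable]: "frac_laplacian \<sigma> \<phi> \<in> borel_measurable borel"
    by (intro borel_measurable_continuous_onI continuous_on_torusI)
  have "(LINT z|torus_measure. complex_of_real (v z) * frac_laplacian \<sigma> \<phi> z) = 0"
    using harm smooth support by (simp add: frac_harmonic_on_def)
  then have "(LINT z|box_measure. complex_of_real (V z) * frac_laplacian \<sigma> \<phi> (torus_proj z)) = 0"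
    by (subst (asm) integral_torus(1)) (simp_all add: V_def)
  then have zero: "(\<Sum>\<^sub>\<infinity>k. c k * box_coeff V k) = 0"
    unfolding fl integral_mult_series[OF V c] .
  define a where "a = (\<lambda>k. ?r k * box_coeff V k)"
  note as = mollify_coeff_summable[OF \<sigma>, of \<delta> V]
  have "balanced \<sigma> (mollify \<delta> V) x"
  proof (rule balanced_fourier_series[OF \<sigma>])
    show "(\<lambda>k. norm (a k)) summable_on UNIV"
      by (rule summable_on_comparison_test[OF as]) (auto simp: a_def algebra_simps)
    show "(\<lambda>k. norm (a k) * norm (freq k) powr (2 * \<sigma>)) summable_on UNIV"
      by (rule summable_on_comparison_test[OF as]) (auto simp: a_def algebra_simps)
    show "complex_of_real (mollify \<delta> V y) = (\<Sum>\<^sub>\<infinity>k. a k * echar (- k) y)" for y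
      unfolding a_def by (rule mollify_series[OF V])
    have "norm (freq k) powr (2 * \<sigma>) * a k * echar (- k) x = c k * box_coeff V k" for k
      by (simp add: a_def c_def mult_ac)
    then show "(\<Sum>\<^sub>\<infinity>k. norm (freq k) powr (2 * \<sigma>) * a k * echar (- k) x) = 0"
      using zero by (simp only:)
  qed
  then show ?thesis by (simp add: V_def)
qed

lemma balanced_diff:
  fixes f g :: "real ^ 'n::finite \<Rightarrow> real"
  assumes "continuous_on UNIV f" "continuous_on UNIV g" "balanced \<sigma> f x" "balanced \<sigma> g x"
  shows "balanced \<sigma> (\<lambda>x. f x - g x) x"
proof -
  let ?\<omega> = "ball_vol TYPE('n)"
  have avg: "ball_avg (\<lambda>x. f x - g x) x s = ball_avg f x s - ball_avg g x s" for s
    unfolding ball_avg_def by (intro Bochner_Integration.integral_diff integrable_ball_continuous assms)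
  have "(ball_avg (\<lambda>x. f x - g x) x s - ?\<omega> * (f x - g x)) * p = (ball_avg f x s - ?\<omega> * f x) * p - (ball_avg g x s - ?\<omega> * g x) * p" for s p
    by (simp add: avg algebra_simps)
  then show ?thesis
    using has_bochner_integral_diff[OF assms(3,4)[unfolded balanced_def]] by (simp only: balanced_def diff_zero)
qed

text \<open>A Lebesgue number argument carried out on the torus, because the preimage of a nonempty
  \<open>\<K>\<close> is unbounded. It rests on \<open>torus_proj\<close> being an open map.\<close>

lemma compact_torus_uniform_ball:
  fixes \<O> \<K> :: "'n::finite torus set"
  assumes "open \<O>" "compact \<K>" "\<K> \<subseteq> \<O>"
  obtains r where "0 < r" "r \<le> 1" "\<And>x. torus_proj x \<in> \<K> \<Longrightarrow> ball x (2 * r) \<subseteq> torus_proj -` \<O>"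
proof -
  have O: "open (torus_proj -` \<O>)" using assms(1) by (simp add: open_torus_iff)
  \<comment> \<open>Factor 3: a point within \<open>\<rho> x\<close> of a centre, plus a further
    distance of \<open>2 * r \<le> 2 * \<rho> x\<close>.\<close>
  have "\<exists>r. 0 < r \<and> ball x (3 * r) \<subseteq> torus_proj -` \<O>" if xK: "torus_proj x \<in> \<K>" for x
  proof -
    obtain e where e: "0 < e" "ball x e \<subseteq> torus_proj -` \<O>"
    proof -
      have "x \<in> torus_proj -` \<O>" using xK assms(3) by auto
      from openE[OF O this] show thesis using that by blast
    qed
    have "3 * (e / 3) = e" by simp
    then show ?thesis using e by (intro exI[of _ "e / 3"] conjI) (simp_all only: divide_pos_pos zero_less_numeral)
  qed
  then have "\<forall>x\<in>torus_proj -` \<K>. \<exists>r. 0 < r \<and> ball x (3 * r) \<subseteq> torus_proj -` \<O>" by blast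
  from bchoice[OF this] obtain \<rho> where
    \<rho>: "\<And>x. torus_proj x \<in> \<K> \<Longrightarrow> 0 < \<rho> x \<and> ball x (3 * \<rho> x) \<subseteq> torus_proj -` \<O>" by blast
  have "open (torus_proj ` ball x e)" for x :: "real ^ 'n" and e
  proof -
    have "torus_proj -` (torus_proj ` ball x e) = (\<Union>m. (\<lambda>y. y + (2 * pi) *\<^sub>R freq m) -` ball x e)"
    proof (intro set_eqI iffI)
      fix y assume "y \<in> torus_proj -` (torus_proj ` ball x e)"
      then obtain y' where y': "y' \<in> ball x e" "torus_proj y' = torus_proj y" by auto
      then obtain m where "y' = y + (2 * pi) *\<^sub>R freq m" unfolding torus_proj_eq_iff by blast
      with y'(1) show "y \<in> (\<Union>m. (\<lambda>y. y + (2 * pi) *\<^sub>R freq m) -` ball x e)" by blast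
    next
      fix y assume "y \<in> (\<Union>m. (\<lambda>y. y + (2 * pi) *\<^sub>R freq m) -` ball x e)"
      then obtain m where "y + (2 * pi) *\<^sub>R freq m \<in> ball x e" by blast
      then show "y \<in> torus_proj -` (torus_proj ` ball x e)" using torus_proj_periodic[of y m] by (auto intro!: image_eqI[of _ _ "y + (2 * pi) *\<^sub>R freq m"])
    qed
    also have "open \<dots>" by (rule open_UN, rule ballI, rule open_vimage[OF open_ball]) (intro continuous_intros)
    finally show ?thesis by (simp add: open_torus_iff)
  qed
  moreover have "\<K> \<subseteq> (\<Union>x\<in>torus_proj -` \<K>. torus_proj ` ball x (\<rho> x))"
  proof
    fix t assume "t \<in> \<K>"
    then have "rep_torus t \<in> torus_proj -` \<K>" "t \<in> torus_proj ` ball (rep_torus t) (\<rho> (rep_torus t))"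
      using \<rho>[of "rep_torus t"] by (auto intro!: image_eqI[of _ _ "rep_torus t"])
    then show "t \<in> (\<Union>x\<in>torus_proj -` \<K>. torus_proj ` ball x (\<rho> x))" by blast
  qed
  ultimately obtain C where C: "C \<subseteq> torus_proj -` \<K>" "finite C" "\<K> \<subseteq> (\<Union>x\<in>C. torus_proj ` ball x (\<rho> x))"
    by (rule compactE_image[OF assms(2), of "torus_proj -` \<K>" "\<lambda>x. torus_proj ` ball x (\<rho> x)"])
  define r where "r = Min (insert 1 (\<rho> ` C))"
  have r: "0 < r" "r \<le> 1" "\<And>x. x \<in> C \<Longrightarrow> r \<le> \<rho> x"
    unfolding r_def using C(1,2) \<rho> by (auto simp: subset_iff)
  have "ball y (2 * r) \<subseteq> torus_proj -` \<O>" if yK: "torus_proj y \<in> \<K>" for y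
  proof
    fix z assume z: "z \<in> ball y (2 * r)"
    obtain x y' where x: "x \<in> C" "y' \<in> ball x (\<rho> x)" "torus_proj y = torus_proj y'"
      using C(3) yK by fastforce
    then obtain m where m: "y = y' + (2 * pi) *\<^sub>R freq m" by (auto simp: torus_proj_eq_iff)
    define z' where "z' = z - (2 * pi) *\<^sub>R freq m"
    have "dist y' z' = dist y z" by (simp add: m z'_def dist_norm algebra_simps)
    then have "dist x z' < \<rho> x + 2 * r" using x(2) z dist_triangle[of x z' y'] by simp
    then have "z' \<in> ball x (3 * \<rho> x)" using r(3)[OF x(1)] by simp
    moreover have "torus_proj x \<in> \<K>" using C(1) x(1) by auto
    ultimately have "torus_proj z' \<in> \<O>" using \<rho>[of x] by auto
    moreover have "torus_proj z = torus_proj z'" using torus_proj_periodic[of z' m] by (simp add: z'_def)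
    ultimately show "z \<in> torus_proj -` \<O>" by simp
  qed
  then show thesis using that r(1,2) by blast
qed


theorem theorem2p1:
  fixes \<sigma> :: real and \<O> \<K> :: "'n::finite torus set"
  assumes "0 < \<sigma>" and "\<sigma> < 1"
    and "open \<O>" and "compact \<K>" and "\<K> \<subseteq> \<O>"
  shows "\<exists>C>0. \<forall>v \<in> frac_laplacian_dom \<sigma>.
           frac_harmonic_on \<sigma> \<O> v \<and> (AE z in torus_measure. 0 \<le> v z) \<longrightarrow>
           (\<exists>w. continuous_rep_on \<O> v w \<and>
              (SUP z\<in>\<K>. ereal (w z)) \<le> ereal C * (INF z\<in>\<K>. ereal (w z)))"
proof -
  let ?B = "box_measure :: (real ^ 'n) measure"
  define D where "D = torus_proj -` \<O>"
  have D: "open D" using assms(3) by (simp add: D_def open_torus_iff)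
  obtain r where r: "0 < r" "r \<le> 1" "\<And>x. torus_proj x \<in> \<K> \<Longrightarrow> ball x (2 * r) \<subseteq> D"
    unfolding D_def using compact_torus_uniform_ball[OF assms(3-5)] by metis
  obtain C where C: "0 < C" "\<And>(u :: real ^ 'n \<Rightarrow> real) z. continuous_on UNIV u \<Longrightarrow> periodic u \<Longrightarrow>
    (\<And>x. x \<in> ball z r \<Longrightarrow> balanced \<sigma> u x) \<Longrightarrow> u z \<le> C * (LINT x|?B. \<bar>u x\<bar>)"
    using balanced_upper_bound[OF assms(1,2) r(1,2)] by metis
  obtain c where c: "0 < c" "\<And>(u :: real ^ 'n \<Rightarrow> real) z. continuous_on UNIV u \<Longrightarrow> periodic u \<Longrightarrow>
    (\<And>x. 0 \<le> u x) \<Longrightarrow> (\<And>x. x \<in> ball z r \<Longrightarrow> balanced \<sigma> u x) \<Longrightarrow> c * (LINT x|?B. u x) \<le> u z"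
    using balanced_lower_bound[OF assms(1,2) r(1)] by metis
  \<comment> \<open>Both estimates go through the mean of \<open>v\<close>: the supremum is at most
    \<open>C * N\<close>, the infimum at least \<open>c * N\<close>.\<close>
  have "\<exists>w. continuous_rep_on \<O> v w \<and> (SUP z\<in>\<K>. ereal (w z)) \<le> ereal (C / c) * (INF z\<in>\<K>. ereal (w z))"
    if v: "v \<in> frac_laplacian_dom \<sigma>" and harm: "frac_harmonic_on \<sigma> \<O> v" and nonneg: "AE z in torus_measure. 0 \<le> v z" for v
  proof -
    have v2: "v \<in> torus_L2" using v by (simp add: frac_laplacian_dom_def)
    note vm [measurable] = torus_L2_integrable(1)[OF v2]
    define V where "V = (\<lambda>x. v (torus_proj x))"
    have V: "integrable ?B V" unfolding V_def by (rule torus_L2_integrable(2)[OF v2])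
    have [measurable]: "V \<in> borel_measurable borel" unfolding V_def by measurable
    have Vp: "periodic V" unfolding V_def by (rule periodic_proj)
    have V0: "AE x in ?B. 0 \<le> V x"
      unfolding V_def by (rule AE_distrD[OF _ nonneg[unfolded torus_measure_alt]]) simp
    define u where "u = (\<lambda>j::nat. mollify (1 / real (Suc j)) V)"
    have uc: "continuous_on UNIV (u j)" for j unfolding u_def by (rule mollify_continuous[OF V])
    have up: "periodic (u j)" for j unfolding u_def by (rule mollify_periodic)
    have ui: "integrable ?B (u j)" for j by (rule integrable_box_periodic[OF uc up])
    have u0: "0 \<le> u j x" for j x
      unfolding u_def mollify_def
    proof (rule integral_nonneg_AE)
      show "AE z in ?B. 0 \<le> V z * mollifier (1 / real (Suc j)) (z - x)"
        using V0 by eventually_elim (simp add: mollifier_nonneg)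
    qed
    have dlim: "(\<lambda>j. 1 / real (Suc j)) \<longlonglongrightarrow> 0"
      using LIMSEQ_inverse_real_of_nat by (simp add: inverse_eq_divide)
    define \<epsilon> where "\<epsilon> = (\<lambda>j. LINT x|?B. \<bar>u j x - V x\<bar>)"
    have \<epsilon>: "\<epsilon> \<longlonglongrightarrow> 0"
    proof (rule LIMSEQ_I)
      fix e :: real assume e: "0 < e"
      obtain \<delta>0 where \<delta>0: "0 < \<delta>0" "\<And>\<delta>. 0 < \<delta> \<Longrightarrow> \<delta> < \<delta>0 \<Longrightarrow> (\<integral>\<^sup>+ x. ennreal \<bar>mollify \<delta> V x - V x\<bar> \<partial>?B) \<le> ennreal (e / 2)"
        using mollify_L1_close[OF _ Vp V, of "e / 2"] e by auto
      obtain N where N: "\<And>j. N \<le> j \<Longrightarrow> 1 / real (Suc j) < \<delta>0"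
        using order_tendstoD(2)[OF dlim \<delta>0(1)] by (auto simp: eventually_sequentially)
      have "norm (\<epsilon> j - 0) < e" if "N \<le> j" for j
      proof -
        have "ennreal (\<epsilon> j) = (\<integral>\<^sup>+ x. ennreal \<bar>u j x - V x\<bar> \<partial>?B)"
          unfolding \<epsilon>_def using ui V by (intro nn_integral_eq_integral[symmetric]) auto
        also have "\<dots> \<le> ennreal (e / 2)" unfolding u_def by (rule \<delta>0(2)) (use N[OF that] in auto)
        finally have "\<epsilon> j \<le> e / 2" using e by (simp add: ennreal_le_iff)
        moreover have "0 \<le> \<epsilon> j" unfolding \<epsilon>_def by (intro Bochner_Integration.integral_nonneg) simp
        ultimately show ?thesis using e by simp
      qed
      then show "\<exists>N. \<forall>j\<ge>N. norm (\<epsilon> j - 0) < e" by blast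
    qed
    \<comment> \<open>The threshold depends on \<open>s\<close> but not on \<open>y\<close>, which
      makes the later convergence locally uniform.\<close>
    have bal: "\<exists>N. \<forall>j\<ge>N. \<forall>y. ball y s \<subseteq> D \<longrightarrow> balanced \<sigma> (u j) y" if s: "0 < s" for s
    proof -
      obtain \<delta>1 where \<delta>1: "0 < \<delta>1" "\<And>w :: real ^ 'n. w \<in> torus_box \<Longrightarrow> one_sub_cos w < \<delta>1 \<Longrightarrow> norm w < s"
        using one_sub_cos_separates[OF s] by metis
      have "0 < \<delta>1 / 2" using \<delta>1 by simp
      from order_tendstoD(2)[OF dlim this] obtain N where N: "\<And>j. N \<le> j \<Longrightarrow> 1 / real (Suc j) < \<delta>1 / 2"
        by (auto simp: eventually_sequentially)
      have "balanced \<sigma> (u j) y" if "N \<le> j" "ball y s \<subseteq> D" for j y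
        unfolding u_def V_def
      proof (rule mollify_balanced[OF assms(1,2) v2 harm])
        show "norm w < s" if "w \<in> torus_box" "one_sub_cos w < 2 * (1 / real (Suc j))" for w :: "real ^ 'n"
          using \<delta>1(2)[OF that(1)] that(2) N[OF \<open>N \<le> j\<close>] by linarith
      qed (use that in \<open>auto simp: D_def\<close>)
      then show ?thesis by blast
    qed
    \<comment> \<open>Balance on a ball of radius \<open>s\<close> around \<open>y\<close> takes a
      further margin \<open>s\<close> around each of its points; hence the radius
      \<open>2 * s\<close>.\<close>
    have bal2: "\<exists>N. \<forall>j\<ge>N. \<forall>y. ball y (2 * s) \<subseteq> D \<longrightarrow> (\<forall>x\<in>ball y s. balanced \<sigma> (u j) x)" if s: "0 < s" for s
    proof -
      obtain N where N: "\<And>j y. N \<le> j \<Longrightarrow> ball y s \<subseteq> D \<Longrightarrow> balanced \<sigma> (u j) y" using bal[OF s] by blast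
      have "balanced \<sigma> (u j) x" if "N \<le> j" "ball y (2 * s) \<subseteq> D" "x \<in> ball y s" for j x y
      proof (rule N[OF that(1)])
        have "ball x s \<subseteq> ball y (2 * s)"
          using that(3) by (simp add: ball_subset_ball_iff dist_commute)
        then show "ball x s \<subseteq> D" using that(2) by blast
      qed
      then show ?thesis by blast
    qed
    have cauchy: "\<exists>A>0. \<exists>N. \<forall>i\<ge>N. \<forall>j\<ge>N. \<forall>y. ball y (2 * s) \<subseteq> D \<longrightarrow> \<bar>u j y - u i y\<bar> \<le> A * (\<epsilon> j + \<epsilon> i)" if s: "0 < s" "s \<le> 1" for s
    proof -
      obtain A where A: "0 < A" "\<And>(h :: real ^ 'n \<Rightarrow> real) z. continuous_on UNIV h \<Longrightarrow> periodic h \<Longrightarrow>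
        (\<And>x. x \<in> ball z s \<Longrightarrow> balanced \<sigma> h x) \<Longrightarrow> h z \<le> A * (LINT x|?B. \<bar>h x\<bar>)"
        using balanced_upper_bound[OF assms(1,2) s] by metis
      obtain N where N: "\<And>j x y. N \<le> j \<Longrightarrow> ball y (2 * s) \<subseteq> D \<Longrightarrow> x \<in> ball y s \<Longrightarrow> balanced \<sigma> (u j) x"
        using bal2[OF s(1)] by blast
      have one: "u j y - u i y \<le> A * (\<epsilon> j + \<epsilon> i)" if ij: "N \<le> i" "N \<le> j" and y: "ball y (2 * s) \<subseteq> D" for i j y
      proof -
        have "u j y - u i y \<le> A * (LINT x|?B. \<bar>u j x - u i x\<bar>)"
        proof (rule A(2)[of "\<lambda>x. u j x - u i x"])
          show "continuous_on UNIV (\<lambda>x. u j x - u i x)" by (intro continuous_intros uc)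
          show "periodic (\<lambda>x. u j x - u i x)" using up[of i] up[of j] by (simp add: periodic_def)
          show "balanced \<sigma> (\<lambda>x. u j x - u i x) x" if "x \<in> ball y s" for x
            by (rule balanced_diff[OF uc uc N[OF ij(2) y that] N[OF ij(1) y that]])
        qed
        also have "(LINT x|?B. \<bar>u j x - u i x\<bar>) \<le> (LINT x|?B. \<bar>u j x - V x\<bar> + \<bar>u i x - V x\<bar>)"
          using ui V by (intro integral_mono) auto
        also have "\<dots> = \<epsilon> j + \<epsilon> i" unfolding \<epsilon>_def using ui V by simp
        finally show ?thesis using A(1) by simp
      qed
      have "\<bar>u j y - u i y\<bar> \<le> A * (\<epsilon> j + \<epsilon> i)" if "N \<le> i" "N \<le> j" "ball y (2 * s) \<subseteq> D" for i j y
        using one[OF that] one[OF that(2,1,3)] by (simp add: add.commute abs_le_iff)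
      then show ?thesis using A(1) by blast
    qed
    \<comment> \<open>Where the sequence diverges, which can only happen outside \<open>D\<close>,
      this is an unspecified value.\<close>
    define W where "W = (\<lambda>x. lim (\<lambda>j. u j x))"
    have D_ball: "\<exists>s>0. s \<le> 1 \<and> ball x (3 * s) \<subseteq> D" if "x \<in> D" for x
    proof -
      from openE[OF D that] obtain e where e: "0 < e" "ball x e \<subseteq> D" by blast
      have "ball x (3 * min 1 (e / 3)) \<subseteq> ball x e" by (rule subset_ball) simp
      with e show ?thesis by (intro exI[of _ "min 1 (e / 3)"]) auto
    qed
    have W: "(\<lambda>j. u j x) \<longlonglongrightarrow> W x" if x: "x \<in> D" for x
    proof -
      obtain s where s: "0 < s" "s \<le> 1" "ball x (3 * s) \<subseteq> D" using D_ball[OF x] by blast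
      have xs: "ball x (2 * s) \<subseteq> D" using s subset_ball[of "2 * s" "3 * s" x] by auto
      obtain A N where A: "0 < A" "\<And>i j y. N \<le> i \<Longrightarrow> N \<le> j \<Longrightarrow> ball y (2 * s) \<subseteq> D \<Longrightarrow> \<bar>u j y - u i y\<bar> \<le> A * (\<epsilon> j + \<epsilon> i)"
        using cauchy[OF s(1,2)] by blast
      have "Cauchy (\<lambda>j. u j x)"
      proof (rule metric_CauchyI)
        fix e :: real assume "0 < e"
        then have "0 < e / (2 * A)" using A(1) by simp
        from order_tendstoD(2)[OF \<epsilon> this] obtain N' where N': "\<And>j. N' \<le> j \<Longrightarrow> \<epsilon> j < e / (2 * A)"
          by (auto simp: eventually_sequentially)
        have "dist (u i x) (u j x) < e" if "max N N' \<le> i" "max N N' \<le> j" for i j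
        proof -
          have "\<bar>u i x - u j x\<bar> \<le> A * (\<epsilon> i + \<epsilon> j)" using A(2)[of j i x] that xs by simp
          also have "\<dots> < A * (e / (2 * A) + e / (2 * A))"
            using N'[of i] N'[of j] that A(1) by (intro mult_strict_left_mono add_strict_mono) auto
          also have "\<dots> = e" using A(1) by (simp add: field_simps)
          finally show ?thesis by (simp add: dist_real_def)
        qed
        then show "\<exists>M. \<forall>m\<ge>M. \<forall>n\<ge>M. dist (u m x) (u n x) < e" by blast
      qed
      then show ?thesis unfolding W_def by (simp add: Cauchy_convergent_iff convergent_LIMSEQ_iff)
    qed
    have Wc: "continuous_on D W"
    proof (rule continuous_at_imp_continuous_on, rule ballI)
      fix x assume x: "x \<in> D"
      obtain s where s: "0 < s" "s \<le> 1" "ball x (3 * s) \<subseteq> D" using D_ball[OF x] by blast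
      have sub: "ball y (2 * s) \<subseteq> D" if "y \<in> ball x s" for y
      proof -
        have "ball y (2 * s) \<subseteq> ball x (3 * s)" using that by (simp add: ball_subset_ball_iff dist_commute)
        then show ?thesis using s(3) by blast
      qed
      obtain A N where A: "0 < A" "\<And>i j y. N \<le> i \<Longrightarrow> N \<le> j \<Longrightarrow> ball y (2 * s) \<subseteq> D \<Longrightarrow> \<bar>u j y - u i y\<bar> \<le> A * (\<epsilon> j + \<epsilon> i)"
        using cauchy[OF s(1,2)] by blast
      have le: "\<bar>u j y - W y\<bar> \<le> A * \<epsilon> j" if "N \<le> j" "y \<in> ball x s" for j y
      proof (rule LIMSEQ_le)
        have "y \<in> D" using sub[OF that(2)] s(1) by auto
        show "(\<lambda>i. \<bar>u j y - u i y\<bar>) \<longlonglongrightarrow> \<bar>u j y - W y\<bar>" by (intro tendsto_intros W \<open>y \<in> D\<close>)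
        have "(\<lambda>i. A * (\<epsilon> j + \<epsilon> i)) \<longlonglongrightarrow> A * (\<epsilon> j + 0)" by (intro tendsto_intros \<epsilon>)
        then show "(\<lambda>i. A * (\<epsilon> j + \<epsilon> i)) \<longlonglongrightarrow> A * \<epsilon> j" by simp
        show "\<exists>M. \<forall>i\<ge>M. \<bar>u j y - u i y\<bar> \<le> A * (\<epsilon> j + \<epsilon> i)" using A(2)[OF _ that(1) sub[OF that(2)]] by blast
      qed
      have "uniform_limit (ball x s) u W sequentially"
      proof (rule uniform_limitI)
        fix e :: real assume "0 < e"
        then have "0 < e / A" using A(1) by simp
        from order_tendstoD(2)[OF \<epsilon> this] have "\<forall>\<^sub>F j in sequentially. \<epsilon> j < e / A" .
        with eventually_ge_at_top[of N] show "\<forall>\<^sub>F j in sequentially. \<forall>y\<in>ball x s. dist (u j y) (W y) < e"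
        proof eventually_elim
          case (elim j)
          have "A * \<epsilon> j < e" using elim(2) A(1) by (simp add: field_simps)
          then show ?case using le[OF elim(1)] by (force simp: dist_real_def)
        qed
      qed
      then have "continuous_on (ball x s) W"
        by (rule uniform_limit_theorem[rotated]) (auto intro!: always_eventually continuous_on_subset[OF uc])
      then show "isCont W x" using s(1) by (simp add: continuous_on_eq_continuous_at)
    qed
    \<comment> \<open>This holds outside \<open>D\<close> too: at equivalent points the sequences
      are identical, and so are their \<open>lim\<close>.\<close>
    have Wp: "periodic W" unfolding W_def periodic_def by (simp add: periodicD[OF up])
    \<comment> \<open>The value 0 outside \<open>\<O>\<close> makes \<open>w\<close> Borel
      measurable on the whole torus, as the almost-everywhere statement requires.\<close>
    define w where "w = (\<lambda>t. if t \<in> \<O> then W (rep_torus t) else 0)"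
    have wW: "w (torus_proj x) = W x" if "x \<in> D" for x
      using that by (simp add: w_def D_def periodic_rep[OF Wp])
    have wc: "continuous_on \<O> w"
    proof -
      have "open (w -` B \<inter> \<O>)" if "open B" for B
      proof -
        have "torus_proj -` (w -` B \<inter> \<O>) = W -` B \<inter> D" using wW by (auto simp: D_def)
        moreover have "open (W -` B \<inter> D)" using Wc that by (simp add: continuous_on_open_vimage[OF D])
        ultimately show ?thesis by (simp add: open_torus_iff)
      qed
      then show ?thesis by (simp add: continuous_on_open_vimage[OF assms(3)])
    qed
    have [measurable]: "w \<in> borel_measurable borel"
    proof -
      have "(\<lambda>t. indicator \<O> t *\<^sub>R w t) \<in> borel_measurable borel"
        by (rule borel_measurable_continuous_on_indicator[OF _ wc]) (simp add: assms(3))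
      moreover have "(\<lambda>t. indicator \<O> t *\<^sub>R w t) = w" by (auto simp: w_def indicator_def)
      ultimately show ?thesis by simp
    qed
    have Ob [measurable]: "\<O> \<in> sets borel" using assms(3) by simp
    have ae: "AE z in torus_measure. z \<in> \<O> \<longrightarrow> w z = v z"
    proof -
      \<comment> \<open>L1 convergence to \<open>V\<close> gives almost everywhere convergence along
        a subsequence, whose limit in \<open>D\<close> is already known to be
        \<open>W\<close>.\<close>
      have "\<exists>q::nat\<Rightarrow>nat. strict_mono q \<and> (AE x in ?B. (\<lambda>j. u (q j) x - V x) \<longlonglongrightarrow> 0)"
      proof (rule tendsto_L1_AE_subseq)
        show "integrable ?B (\<lambda>x. u j x - V x)" for j using ui V by simp
        show "(\<lambda>j. LINT x|?B. norm (u j x - V x)) \<longlonglongrightarrow> 0" using \<epsilon> by (simp add: \<epsilon>_def)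
      qed
      then obtain q :: "nat \<Rightarrow> nat" where q: "strict_mono q" "AE x in ?B. (\<lambda>j. u (q j) x - V x) \<longlonglongrightarrow> 0" by blast
      from q(2) have "AE x in ?B. torus_proj x \<in> \<O> \<longrightarrow> w (torus_proj x) = v (torus_proj x)"
      proof eventually_elim
        case (elim x)
        show ?case
        proof
          assume "torus_proj x \<in> \<O>"
          then have x: "x \<in> D" by (simp add: D_def)
          have "(\<lambda>j. u (q j) x - V x) \<longlonglongrightarrow> W x - V x"
            using LIMSEQ_subseq_LIMSEQ[OF W[OF x] q(1)] by (intro tendsto_intros) (simp add: o_def)
          with elim have "W x - V x = 0" using LIMSEQ_unique by blast
          then show "w (torus_proj x) = v (torus_proj x)" by (simp add: wW[OF x] V_def)
        qed
      qed
      then show ?thesis unfolding torus_measure_alt by (subst AE_distr_iff) auto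
    qed
    define N where "N = (LINT x|?B. V x)"
    have Nlim: "(\<lambda>j. LINT x|?B. u j x) \<longlonglongrightarrow> N"
    proof (rule Lim_null[THEN iffD2], rule tendsto_rabs_zero_cancel, rule tendsto_sandwich[OF _ _ tendsto_const \<epsilon>])
      show "\<forall>\<^sub>F j in sequentially. \<bar>(LINT x|?B. u j x) - N\<bar> \<le> \<epsilon> j"
      proof (intro always_eventually allI)
        fix j
        have "(LINT x|?B. u j x) - N = (LINT x|?B. u j x - V x)" unfolding N_def using ui V by simp
        then show "\<bar>(LINT x|?B. u j x) - N\<bar> \<le> \<epsilon> j"
          unfolding \<epsilon>_def using integral_norm_bound[of ?B "\<lambda>x. u j x - V x"] by simp
      qed
    qed simp
    have bounds: "c * N \<le> W x \<and> W x \<le> C * N" if x: "torus_proj x \<in> \<K>" for x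
    proof -
      have xD: "x \<in> D" using x assms(5) by (auto simp: D_def)
      obtain M where M: "\<And>j y. M \<le> j \<Longrightarrow> y \<in> ball x r \<Longrightarrow> balanced \<sigma> (u j) y"
        using bal2[OF r(1)] r(3)[OF x] by blast
      have "c * N \<le> W x"
      proof (rule LIMSEQ_le[OF _ W[OF xD]])
        show "(\<lambda>j. c * (LINT x|?B. u j x)) \<longlonglongrightarrow> c * N" by (intro tendsto_intros Nlim)
        show "\<exists>M. \<forall>j\<ge>M. c * (LINT x|?B. u j x) \<le> u j x" using c(2)[OF uc up u0 M] by blast
      qed
      moreover have "W x \<le> C * N"
      proof (rule LIMSEQ_le[OF W[OF xD]])
        show "(\<lambda>j. C * (LINT x|?B. u j x)) \<longlonglongrightarrow> C * N" by (intro tendsto_intros Nlim)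
        have "u j x \<le> C * (LINT x|?B. u j x)" if "M \<le> j" for j
          using C(2)[OF uc up M[OF that]] u0 by simp
        then show "\<exists>M. \<forall>j\<ge>M. u j x \<le> C * (LINT x|?B. u j x)" by blast
      qed
      ultimately show ?thesis by simp
    qed
    have wb: "c * N \<le> w t" "w t \<le> C * N" if "t \<in> \<K>" for t
      using bounds[of "rep_torus t"] wW[of "rep_torus t"] that assms(5) by (auto simp: D_def)
    \<comment> \<open>The comparison passes through the real number \<open>C * N\<close>, so it also
      covers an empty \<open>\<K>\<close>, where the supremum is minus infinity and the infimum plus
      infinity.\<close>
    have "(SUP z\<in>\<K>. ereal (w z)) \<le> ereal (C * N)" by (intro SUP_least) (simp add: wb)
    also have "ereal (C * N) = ereal (C / c) * ereal (c * N)" using c(1) by simp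
    also have "\<dots> \<le> ereal (C / c) * (INF z\<in>\<K>. ereal (w z))"
      using c(1) C(1) by (intro ereal_mult_left_mono INF_greatest) (simp_all add: wb)
    finally have "(SUP z\<in>\<K>. ereal (w z)) \<le> ereal (C / c) * (INF z\<in>\<K>. ereal (w z))" .
    then show ?thesis using wc ae by (auto simp: continuous_rep_on_def)
  qed
  moreover have "0 < C / c" using C(1) c(1) by simp
  ultimately show ?thesis by blast
qed

end
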